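(* Let $\lambda\in\mathbb{R}^l_{reg}$ and $\theta\in\mathbb{Z}^l_\lambda$, and let $\eta_1,\dots,\eta_l$ be the ordering of $\{0,\dots,l-1\}$ determined by $\theta$ (see context). For $i=1,\dots,l$ there is an isomorphism of $\mathcal{A}_{\lambda+\theta}$-modules $$e_0\Delta_{\lambda+\theta}(\eta_i)\longrightarrow\mathcal{S}_\lambda^\theta(e_0\Delta_\lambda(\eta_i))=\mathcal{B}_\lambda^\theta\otimes_{\mathcal{A}_\lambda}e_0\Delta_\lambda(\eta_i),$$ $$e_0t_0t_{l-1}\cdots t_{\eta_i+1}\mathbf{1}_{\eta_i}\mapsto\tilde f_i\otimes e_0t_0t_{l-1}\cdots t_{\eta_i+1}\mathbf{1}_{\eta_i},$$ where $$\tilde f_i=\prod_{j=i}^{l-1}(t_{\eta_{j+1}}\cdots t_{\eta_l})^{\theta_{\eta_j}+\theta_{\eta_j+1}+\dots+\theta_{\eta_{j+1}-1}}\prod_{j=1}^{i-1}(\partial_{\eta_1}\cdots\partial_{\eta_j})^{\theta_{\eta_j}+\theta_{\eta_j+1}+\dots+\theta_{\eta_{j+1}-1}}.$$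
   Context: Fix an integer $l\ge 1$; indices $0,\dots,l-1$ are read modulo $l$. For $i\ne j$ in $\{0,\dots,l-1\}$, a sum $\lambda_i+\dots+\lambda_{j-1}$ is cyclic: if $j<i$ it means $\lambda_i+\dots+\lambda_{l-1}+\lambda_0+\dots+\lambda_{j-1}$. Parameters. $\mathbb{R}^l_1=\{\lambda\in\mathbb{R}^l:\sum_i\lambda_i=1\}$, $\mathbb{Z}^l_0=\{\theta\in\mathbb{Z}^l:\sum_i\theta_i=0\}$, $\bar\lambda_i=\lambda_i-\delta_{i0}$, $\mathbb{R}^l_{reg}=\{\lambda\in\mathbb{R}^l_1:\bar\lambda_i+\dots+\bar\lambda_{j-1}\ne0\ \forall i\ne j\}$, $\mathbb{Z}^l_{reg}=\{\theta\in\mathbb{Z}^l_0:\theta_i+\dots+\theta_{j-1}\neq0\ \forall i\ne j\}$, $\mathbb{Z}^l_\lambda=\{\theta\in\mathbb{Z}^l_{reg}:\theta_i+\dots+\theta_{j-1}<0\text{ whenever }i\ne j\text{ and }\lambda_i+\dots+\lambda_{j-1}\in\mathbb{Z}_{\le0}\}$. Ordering. For $\theta\in\mathbb{Z}^l_{reg}$, $i\rhd_\theta j$ iff $\theta_i+\dots+\theta_{j-1}<0$ ($i\ne j$) is a strict total order on $\{0,\dots,l-1\}$; $\eta_1,\dots,\eta_l$ are its elements with $\eta_l\rhd_\theta\eta_{l-1}\rhd_\theta\dots\rhd_\theta\eta_1$. Algebras. $D$ is the algebra of algebraic differential operators on $\mathbb{C}^l$ with coordinates $t_0,\dots,t_{l-1}$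 and $\partial_i=\partial/\partial t_i$. $GL(\delta)=(\mathbb{C}^* )^l$ acts by $g\cdot t_i=g_i^{-1}g_{i-1}t_i$, $g\cdot\partial_i=g_ig_{i-1}^{-1}\partial_i$ on $D$, by $g\cdot E_{ij}=g_ig_j^{-1}E_{ij}$ on $M_l(\mathbb{C})$ (matrix units $E_{ij}$, $0\le i,j\le l-1$), and diagonally on $M_l(D)=M_l(\mathbb{C})\otimes D$. Put $\chi_\theta(g)=\prod_i g_i^{\theta_i}$; $M^{GL(\delta),\chi}=\{v:gv=\chi(g)v\ \forall g\}$. Let $\iota_i=t_{i+1}\partial_{i+1}-t_i\partial_i$, $\tau_i=E_{ii}\otimes1+1\otimes\iota_i$, $e_i=E_{ii}$. Define $\mathcal{T}_\lambda=M_l(D)^{GL(\delta)}/\sum_iM_l(D)^{GL(\delta)}(\tau_i-\lambda_i)$, $\mathcal{A}_\lambda=e_0\mathcal{T}_\lambda e_0\simeq D^{GL(\delta)}/\sum_iD^{GL(\delta)}(\iota_i-\bar\lambda_i)$, $\mathcal{B}_\lambda^\theta=\left[D/\sum_iD(\iota_i-\bar\lambda_i)\right]^{GL(\delta),\chi_\theta}$, an $(\mathcal{A}_{\lambda+\theta},\mathcal{A}_\lambda)$-bimodule; $\mathcal{S}_\lambda^\theta(N)=\mathcal{B}_\lambda^\theta\otimes_{\mathcal{A}_\lambda}N$. Standard modules. With $A=\sum_iE_{i,i-1}\otimes t_i$ and $A^*=\sum_iE_{i-1,i}\otimes\partial_i$ in $\mathcal{T}_\lambda$, $\Delta_\lambda(i)=(\mathcal{T}_\lambda/\mathcal{T}_\lambda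 A^* )e_i$, and $\mathbf{1}_i$ is the image of $e_i$; $\Delta_\lambda(i)=\mathbb{C}[A]\mathbf{1}_i$ as a vector space. The notation $e_0t_0t_{l-1}\cdots t_{k+1}\mathbf{1}_k$ means the class of $E_{0k}\otimes t_0t_{l-1}\cdots t_{k+1}$, i.e. $A^{l-k}\mathbf{1}_k$ for $1\le k\le l-1$; for $k=0$ the product is empty and the element is $\mathbf{1}_0$. *)

theory Defs
  imports
    Complex_Main
    "HOL-Library.Poly_Mapping"
    "HOL-Library.Nonpos_Ints"
    "HOL-Algebra.QuotRing"
    "HOL-Algebra.Module"
    "HOL-Algebra.Free_Abelian_Groups"
    "Jordan_Normal_Form.Matrix"
begin

section \<open>Cyclic indices and parameters\<close>

text \<open>Indices are the naturals below \<open>l\<close>, read modulo \<open>l\<close>. A vector indexed by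
  \<open>{0..l-1}\<close> is a function on \<open>nat\<close> of which only the values below \<open>l\<close> are ever used.\<close>

definition cpred :: "nat \<Rightarrow> nat \<Rightarrow> nat" where
  "cpred l i = (i + l - 1) mod l"

definition csucc :: "nat \<Rightarrow> nat \<Rightarrow> nat" where
  "csucc l i = (i + 1) mod l"

text \<open>The cyclic sum \<open>x\<^sub>i + \<dots> + x\<^sub>j\<^sub>-\<^sub>1\<close>; only used for \<open>i \<noteq> j\<close>.\<close>

definition cyc_sum :: "nat \<Rightarrow> (nat \<Rightarrow> 'a::comm_monoid_add) \<Rightarrow> nat \<Rightarrow> nat \<Rightarrow> 'a" where
  "cyc_sum l x i j = (if i < j then sum x {i..<j} else sum x {i..<l} + sum x {0..<j})"

definition bar :: "(nat \<Rightarrow> real) \<Rightarrow> nat \<Rightarrow> real" where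
  "bar lam i = lam i - (if i = 0 then 1 else 0)"

definition shift_par :: "(nat \<Rightarrow> real) \<Rightarrow> (nat \<Rightarrow> int) \<Rightarrow> nat \<Rightarrow> real" where
  "shift_par lam th i = lam i + of_int (th i)"

definition R_one :: "nat \<Rightarrow> (nat \<Rightarrow> real) set" where
  "R_one l = {lam. (\<Sum>i<l. lam i) = 1}"

definition Z_zero :: "nat \<Rightarrow> (nat \<Rightarrow> int) set" where
  "Z_zero l = {th. (\<Sum>i<l. th i) = 0}"

definition R_reg :: "nat \<Rightarrow> (nat \<Rightarrow> real) set" where
  "R_reg l = {lam \<in> R_one l. \<forall>i<l. \<forall>j<l. i \<noteq> j \<longrightarrow> cyc_sum l (bar lam) i j \<noteq> 0}"

definition Z_reg :: "nat \<Rightarrow> (nat \<Rightarrow> int) set" where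
  "Z_reg l = {th \<in> Z_zero l. \<forall>i<l. \<forall>j<l. i \<noteq> j \<longrightarrow> cyc_sum l th i j \<noteq> 0}"

definition Z_lam :: "nat \<Rightarrow> (nat \<Rightarrow> real) \<Rightarrow> (nat \<Rightarrow> int) set" where
  "Z_lam l lam = {th \<in> Z_reg l. \<forall>i<l. \<forall>j<l.
     i \<noteq> j \<and> cyc_sum l lam i j \<in> \<int>\<^sub>\<le>\<^sub>0 \<longrightarrow> cyc_sum l th i j < 0}"

definition theta_gt :: "nat \<Rightarrow> (nat \<Rightarrow> int) \<Rightarrow> nat \<Rightarrow> nat \<Rightarrow> bool" where
  "theta_gt l th i j \<longleftrightarrow> i \<noteq> j \<and> cyc_sum l th i j < 0"

text \<open>\<open>\<eta> 1, \<dots>, \<eta> l\<close> enumerate \<open>{0..l-1}\<close> increasingly for \<open>theta_gt l th\<close>.\<close>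

definition theta_enum :: "nat \<Rightarrow> (nat \<Rightarrow> int) \<Rightarrow> (nat \<Rightarrow> nat) \<Rightarrow> bool" where
  "theta_enum l th \<eta> \<longleftrightarrow> bij_betw \<eta> {1..l} {..<l} \<and>
     (\<forall>j\<in>{1..<l}. theta_gt l th (\<eta> (j + 1)) (\<eta> j))"


section \<open>Differential operators\<close>

text \<open>Polynomials in variables \<open>t\<^sub>0, t\<^sub>1, \<dots>\<close>, a monomial being its exponent vector.\<close>

type_synonym cpoly = "(nat \<Rightarrow>\<^sub>0 nat) \<Rightarrow>\<^sub>0 complex"

typedef linop = "{f :: cpoly \<Rightarrow> cpoly. (\<forall>p q. f (p + q) = f p + f q) \<and>
    (\<forall>c p. f (Poly_Mapping.single 0 c * p) = Poly_Mapping.single 0 c * f p)}"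
  morphisms app_op Abs_linop
  by (rule exI[of _ id]) simp

setup_lifting type_definition_linop

instantiation linop :: ring_1
begin

lift_definition zero_linop :: linop is "\<lambda>_. 0" by simp
lift_definition one_linop :: linop is "\<lambda>p. p" by simp
lift_definition plus_linop :: "linop \<Rightarrow> linop \<Rightarrow> linop" is "\<lambda>f g p. f p + g p"
  by (simp add: algebra_simps)
lift_definition minus_linop :: "linop \<Rightarrow> linop \<Rightarrow> linop" is "\<lambda>f g p. f p - g p"
  by (simp add: algebra_simps)
lift_definition uminus_linop :: "linop \<Rightarrow> linop" is "\<lambda>f p. - f p"
  by simp
lift_definition times_linop :: "linop \<Rightarrow> linop \<Rightarrow> linop" is "\<lambda>f g p. f (g p)"
  by simp

instance
proof
  show "(0::linop) \<noteq> 1"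
    by transfer (auto simp: fun_eq_iff intro: exI[of _ 1])
qed (transfer; simp add: fun_eq_iff algebra_simps)+

end

lift_definition scal :: "complex \<Rightarrow> linop" is "\<lambda>c p. Poly_Mapping.single 0 c * p"
  by (simp add: algebra_simps)

lift_definition tvar :: "nat \<Rightarrow> linop" is
  "\<lambda>i p. Poly_Mapping.single (Poly_Mapping.single i 1) 1 * p"
  by (simp add: algebra_simps)

text \<open>The coefficient of \<open>t\<^sup>a\<close> in \<open>\<partial>p/\<partial>t\<^sub>i\<close> is \<open>(a\<^sub>i + 1)\<close> times the coefficient of
  \<open>t\<^sub>i t\<^sup>a\<close> in \<open>p\<close>.\<close>

lift_definition poly_deriv :: "nat \<Rightarrow> cpoly \<Rightarrow> cpoly" is
  "\<lambda>i p a. of_nat (Poly_Mapping.lookup a i + 1) * p (a + Poly_Mapping.single i 1)"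
proof -
  fix i and p :: "(nat \<Rightarrow>\<^sub>0 nat) \<Rightarrow> complex"
  assume "finite {x. p x \<noteq> 0}"
  then have "finite ((\<lambda>a. a + Poly_Mapping.single i 1) -` {x. p x \<noteq> 0})"
    by (rule finite_vimageI) (simp add: inj_on_def)
  then show "finite {a. of_nat (Poly_Mapping.lookup a i + 1) * p (a + Poly_Mapping.single i 1) \<noteq> 0}"
    by (rule rev_finite_subset) auto
qed

text \<open>Substitution \<open>t\<^sub>i \<mapsto> g\<^sub>i\<^sup>-\<^sup>1 g\<^sub>i\<^sub>-\<^sub>1 t\<^sub>i\<close> for \<open>i < l\<close>.\<close>

lift_definition poly_subst :: "nat \<Rightarrow> (nat \<Rightarrow> complex) \<Rightarrow> cpoly \<Rightarrow> cpoly" is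
  "\<lambda>l g p a. (\<Prod>i<l. (inverse (g i) * g (cpred l i)) ^ Poly_Mapping.lookup a i) * p a"
  by (rule rev_finite_subset) auto

lemma lookup_const_times:
  "Poly_Mapping.lookup (Poly_Mapping.single 0 c * p) a = c * Poly_Mapping.lookup (p :: cpoly) a"
  by (simp flip: mult_map_scale_conv_mult add: Poly_Mapping.map.rep_eq when_def)

lift_definition pdiff :: "nat \<Rightarrow> linop" is poly_deriv
  by (auto intro!: poly_mapping_eqI
      simp: poly_deriv.rep_eq lookup_const_times lookup_add distrib_left mult.left_commute)

lift_definition subst_op :: "nat \<Rightarrow> (nat \<Rightarrow> complex) \<Rightarrow> linop" is poly_subst
  by (auto intro!: poly_mapping_eqI
      simp: poly_subst.rep_eq lookup_const_times lookup_add distrib_left mult.left_commute)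

lemma cpoly_induct [case_names single add]:
  fixes P :: "cpoly \<Rightarrow> bool"
  assumes single: "\<And>a c. P (Poly_Mapping.single a c)"
    and add: "\<And>p q. P p \<Longrightarrow> P q \<Longrightarrow> P (p + q)"
  shows "P p"
proof (induction p rule: update_induct)
  case const
  show ?case using single[of 0 0] by simp
next
  case (update f a b)
  have "Poly_Mapping.update a b f = f + Poly_Mapping.single a b"
    using update by (intro poly_mapping_eqI) (auto simp: lookup_update lookup_add lookup_single in_keys_iff)
  then show ?case using update single add by simp
qed

lemma linop_eqI: "(\<And>p. app_op f p = app_op g p) \<Longrightarrow> f = g"
  by (simp add: app_op_inject[symmetric] fun_eq_iff)

lemma app_op_add: "app_op f (p + q) = app_op f p + app_op f q"
  by transfer simp

lemma poly_subst_single: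
  "poly_subst l g (Poly_Mapping.single a c) = Poly_Mapping.single a
    ((\<Prod>i<l. (inverse (g i) * g (cpred l i)) ^ Poly_Mapping.lookup a i) * c)"
  by (intro poly_mapping_eqI) (auto simp: poly_subst.rep_eq lookup_single when_def)

lemma poly_deriv_single:
  "poly_deriv i (Poly_Mapping.single a c) = Poly_Mapping.single (a - Poly_Mapping.single i 1)
    (of_nat (Poly_Mapping.lookup a i) * c)"
proof (rule poly_mapping_eqI)
  fix b
  show "Poly_Mapping.lookup (poly_deriv i (Poly_Mapping.single a c)) b =
    Poly_Mapping.lookup (Poly_Mapping.single (a - Poly_Mapping.single i 1)
      (of_nat (Poly_Mapping.lookup a i) * c)) b"
  proof (cases "Poly_Mapping.lookup a i = 0")
    case True
    then have "a \<noteq> b + Poly_Mapping.single i 1"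
      by (auto simp: lookup_add)
    with True show ?thesis
      by (simp add: poly_deriv.rep_eq lookup_single when_def)
  next
    case False
    then have "a = (a - Poly_Mapping.single i 1) + Poly_Mapping.single i 1"
      by (intro poly_mapping_eqI) (auto simp: lookup_add lookup_minus lookup_single when_def)
    then have "a = b + Poly_Mapping.single i 1 \<longleftrightarrow> a - Poly_Mapping.single i 1 = b"
      by (metis add_right_cancel)
    moreover have "Poly_Mapping.lookup a i = Poly_Mapping.lookup b i + 1"
      if "a = b + Poly_Mapping.single i 1"
      unfolding that by (simp add: lookup_add)
    ultimately show ?thesis
      by (cases "a = b + Poly_Mapping.single i 1")
        (simp_all add: poly_deriv.rep_eq lookup_single when_def)
  qed
qed

lemma weyl_relation: "pdiff i * tvar j - tvar j * pdiff i = (if i = j then 1 else 0)"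
proof -
  have *: "a + Poly_Mapping.single j (Suc 0) - Poly_Mapping.single i (Suc 0) =
      Poly_Mapping.single j (Suc 0) + (a - Poly_Mapping.single i (Suc 0))"
    if "Poly_Mapping.lookup a i \<noteq> 0" for a :: "nat \<Rightarrow>\<^sub>0 nat"
    using that
    by (intro poly_mapping_eqI) (auto simp: lookup_add lookup_minus lookup_single when_def)
  have "app_op (pdiff i * tvar j - tvar j * pdiff i) p = app_op (if i = j then 1 else 0) p" for p
  proof (induction p rule: cpoly_induct)
    case (single a c)
    show ?case
      using *[of a] by (cases "Poly_Mapping.lookup a i = 0")
       (auto simp: minus_linop.rep_eq times_linop.rep_eq one_linop.rep_eq zero_linop.rep_eq
          pdiff.rep_eq tvar.rep_eq mult_single poly_deriv_single lookup_add add.commute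
          single_diff[symmetric] lookup_single when_def algebra_simps)
  qed (simp add: app_op_add)
  then show ?thesis
    by (rule linop_eqI)
qed

text \<open>\<open>D\<close>, the algebra of algebraic differential operators on \<open>\<complex>\<^sup>l\<close>: the subalgebra generated
  by \<open>t\<^sub>i\<close> and \<open>\<partial>\<^sub>i\<close> for \<open>i < l\<close>. It is realised on \<open>\<complex>[t\<^sub>0, t\<^sub>1, \<dots>]\<close>, where the variables \<open>t\<^sub>k\<close>
  with \<open>k \<ge> l\<close> are inert scalars; restriction to \<open>\<complex>[t\<^sub>0, \<dots>, t\<^sub>l\<^sub>-\<^sub>1]\<close> is therefore faithful.\<close>

inductive_set weyl :: "nat \<Rightarrow> linop set" for l where
  scal: "scal c \<in> weyl l"
| tvar: "i < l \<Longrightarrow> tvar i \<in> weyl l"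
| pdiff: "i < l \<Longrightarrow> pdiff i \<in> weyl l"
| add: "P \<in> weyl l \<Longrightarrow> Q \<in> weyl l \<Longrightarrow> P + Q \<in> weyl l"
| mult: "P \<in> weyl l \<Longrightarrow> Q \<in> weyl l \<Longrightarrow> P * Q \<in> weyl l"

definition weyl_ring :: "nat \<Rightarrow> linop ring" where
  "weyl_ring l = \<lparr>carrier = weyl l, monoid.mult = (*), monoid.one = 1, ring.zero = 0, ring.add = (+)\<rparr>"


section \<open>The torus action\<close>

definition torus :: "nat \<Rightarrow> (nat \<Rightarrow> complex) set" where
  "torus l = {g. \<forall>i<l. g i \<noteq> 0}"

definition chr :: "nat \<Rightarrow> (nat \<Rightarrow> int) \<Rightarrow> (nat \<Rightarrow> complex) \<Rightarrow> complex" where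
  "chr l th g = (\<Prod>i<l. g i powi th i)"

text \<open>The action on \<open>D\<close> by algebra automorphisms is conjugation with the substitution
  \<open>t\<^sub>i \<mapsto> g\<^sub>i\<^sup>-\<^sup>1 g\<^sub>i\<^sub>-\<^sub>1 t\<^sub>i\<close>; the lemmas \<open>act_tvar\<close>, \<open>act_pdiff\<close>, \<open>act_mult\<close>, \<open>act_add\<close>,
  \<open>act_scal\<close> characterise it.\<close>

definition act :: "nat \<Rightarrow> (nat \<Rightarrow> complex) \<Rightarrow> linop \<Rightarrow> linop" where
  "act l g P = subst_op l g * P * subst_op l (\<lambda>i. inverse (g i))"

lemma subst_op_inverse:
  assumes "g \<in> torus l"
  shows "subst_op l (\<lambda>i. inverse (g i)) * subst_op l g = 1"
    and "subst_op l g * subst_op l (\<lambda>i. inverse (g i)) = 1"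
proof -
  have p: "cpred l i < l" if "i < l" for i
    using that by (simp add: cpred_def)
  have *: "(\<Prod>i<l. (g i * inverse (g (cpred l i))) ^ k i) *
      (\<Prod>i<l. (inverse (g i) * g (cpred l i)) ^ k i) = 1" for k :: "nat \<Rightarrow> nat"
    using assms p
    by (subst prod.distrib[symmetric], subst power_mult_distrib[symmetric])
      (auto intro!: prod.neutral simp: torus_def field_simps)
  note ** = *[unfolded mult.commute[of "\<Prod>i<l. (g i * inverse (g (cpred l i))) ^ k i" for k]]
  show "subst_op l (\<lambda>i. inverse (g i)) * subst_op l g = 1"
    by (intro linop_eqI poly_mapping_eqI)
      (simp add: times_linop.rep_eq one_linop.rep_eq subst_op.rep_eq poly_subst.rep_eq *
        flip: mult.assoc)
  show "subst_op l g * subst_op l (\<lambda>i. inverse (g i)) = 1"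
    by (intro linop_eqI poly_mapping_eqI)
      (simp add: times_linop.rep_eq one_linop.rep_eq subst_op.rep_eq poly_subst.rep_eq **
        flip: mult.assoc)
qed

lemma scal_commute: "scal c * P = P * scal c"
  by transfer (simp add: fun_eq_iff)

lemma scal_mult: "scal c * scal d = scal (c * d)"
  by transfer (simp add: fun_eq_iff mult_single flip: mult.assoc)

lemma act_add: "act l g (P + Q) = act l g P + act l g Q"
  by (simp add: act_def algebra_simps)

lemma act_mult:
  assumes "g \<in> torus l"
  shows "act l g (P * Q) = act l g P * act l g Q"
proof -
  let ?S = "subst_op l g" and ?S' = "subst_op l (\<lambda>i. inverse (g i))"
  have "act l g P * act l g Q = ?S * P * (?S' * ?S) * Q * ?S'"
    by (simp only: act_def mult.assoc)
  then show ?thesis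
    by (simp add: act_def subst_op_inverse(1)[OF assms] mult.assoc)
qed

lemma act_scal: "g \<in> torus l \<Longrightarrow> act l g (scal c) = scal c"
  by (simp add: act_def scal_commute[of c "subst_op l g", symmetric] mult.assoc subst_op_inverse(2))

lemma subst_coeff_add_single:
  fixes f :: "nat \<Rightarrow> complex" and i l :: nat
  assumes "i < l"
  shows "(\<Prod>j<l. f j ^ Poly_Mapping.lookup (a + Poly_Mapping.single i 1) j) =
    f i * (\<Prod>j<l. f j ^ Poly_Mapping.lookup a j)"
proof -
  have "(\<Prod>j<l. f j ^ Poly_Mapping.lookup (a + Poly_Mapping.single i 1) j) =
      (\<Prod>j<l. (if j = i then f i else 1) * f j ^ Poly_Mapping.lookup a j)"
    by (rule prod.cong) (auto simp: lookup_add lookup_single when_def)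
  also have "\<dots> = f i * (\<Prod>j<l. f j ^ Poly_Mapping.lookup a j)"
    using assms unfolding prod.distrib by (subst prod.delta) auto
  finally show ?thesis .
qed

lemma act_tvar:
  assumes "g \<in> torus l" "i < l"
  shows "act l g (tvar i) = scal (inverse (g i) * g (cpred l i)) * tvar i"
proof -
  let ?c = "inverse (g i) * g (cpred l i)"
  have "app_op (subst_op l g * tvar i) p = app_op (scal ?c * tvar i * subst_op l g) p" for p
  proof (induction p rule: cpoly_induct)
    case (single a c)
    show ?case
      by (simp add: times_linop.rep_eq subst_op.rep_eq tvar.rep_eq scal.rep_eq mult_single
          poly_subst_single subst_coeff_add_single[OF assms(2), simplified] add.commute mult_ac)
  qed (simp add: app_op_add)
  then have "subst_op l g * tvar i = scal ?c * tvar i * subst_op l g"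
    by (rule linop_eqI)
  then show ?thesis
    by (simp add: act_def mult.assoc subst_op_inverse(2)[OF assms(1)])
qed

lemma act_pdiff:
  assumes "g \<in> torus l" "i < l"
  shows "act l g (pdiff i) = scal (g i * inverse (g (cpred l i))) * pdiff i"
proof -
  let ?c = "g i * inverse (g (cpred l i))"
  have c: "?c * (inverse (g i) * g (cpred l i)) = 1"
    using assms by (simp add: torus_def cpred_def field_simps)
  have "app_op (subst_op l g * pdiff i) p = app_op (scal ?c * pdiff i * subst_op l g) p" for p
  proof (rule poly_mapping_eqI)
    fix a
    have "w * (n * x) = ?c * (n * ((inverse (g i) * g (cpred l i)) * w * x))" for w n x :: complex
    proof -
      have "?c * (n * ((inverse (g i) * g (cpred l i)) * w * x)) =
          (?c * (inverse (g i) * g (cpred l i))) * (w * (n * x))"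
        by (simp only: mult_ac)
      then show ?thesis by (simp only: c mult_1_left)
    qed
    then show "Poly_Mapping.lookup (app_op (subst_op l g * pdiff i) p) a =
        Poly_Mapping.lookup (app_op (scal ?c * pdiff i * subst_op l g) p) a"
      by (simp only: times_linop.rep_eq subst_op.rep_eq pdiff.rep_eq scal.rep_eq
          lookup_const_times poly_subst.rep_eq poly_deriv.rep_eq
          subst_coeff_add_single[OF assms(2)])
  qed
  then have "subst_op l g * pdiff i = scal ?c * pdiff i * subst_op l g"
    by (rule linop_eqI)
  then show ?thesis
    by (simp add: act_def mult.assoc subst_op_inverse(2)[OF assms(1)])
qed

definition weyl_inv :: "nat \<Rightarrow> linop ring" where
  "weyl_inv l = (weyl_ring l)\<lparr>carrier := {P \<in> weyl l. \<forall>g\<in>torus l. act l g P = P}\<rparr>"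

definition mat_weyl :: "nat \<Rightarrow> linop mat ring" where
  "mat_weyl l = (ring_mat TYPE(linop) l ())
     \<lparr>carrier := {M \<in> carrier_mat l l. elements_mat M \<subseteq> weyl l}\<rparr>"

definition mat_act :: "nat \<Rightarrow> (nat \<Rightarrow> complex) \<Rightarrow> linop mat \<Rightarrow> linop mat" where
  "mat_act l g M = mat l l (\<lambda>(i, j). scal (g i * inverse (g j)) * act l g (M $$ (i, j)))"

definition mat_weyl_inv :: "nat \<Rightarrow> linop mat ring" where
  "mat_weyl_inv l = (mat_weyl l)
     \<lparr>carrier := {M \<in> carrier (mat_weyl l). \<forall>g\<in>torus l. mat_act l g M = M}\<rparr>"

text \<open>\<open>E\<^sub>i\<^sub>j \<otimes> P\<close> and \<open>1 \<otimes> P\<close> in \<open>M\<^sub>l(D)\<close>.\<close>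

definition E_tensor :: "nat \<Rightarrow> nat \<Rightarrow> nat \<Rightarrow> linop \<Rightarrow> linop mat" where
  "E_tensor l i j P = mat l l (\<lambda>(a, b). if a = i \<and> b = j then P else 0)"

definition one_tensor :: "nat \<Rightarrow> linop \<Rightarrow> linop mat" where
  "one_tensor l P = mat l l (\<lambda>(a, b). if a = b then P else 0)"


section \<open>Left ideals, quotients and tensor products over noncommutative rings\<close>

text \<open>\<open>\<Sum>\<^sub>i\<^sub><\<^sub>l R x\<^sub>i\<close>\<close>

definition left_ideal_gen :: "('a, 'm) ring_scheme \<Rightarrow> nat \<Rightarrow> (nat \<Rightarrow> 'a) \<Rightarrow> 'a set" where
  "left_ideal_gen R l x =
     {finsum R (\<lambda>i. r i \<otimes>\<^bsub>R\<^esub> x i) {..<l} | r. r \<in> {..<l} \<rightarrow> carrier R}"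

text \<open>Left modules over possibly noncommutative rings use the record type of
  \<^theory>\<open>HOL-Algebra.Module\<close>, whose fields \<open>mult\<close> and \<open>one\<close> play no role.\<close>

definition left_quot :: "('a, 'm) ring_scheme \<Rightarrow> 'a set \<Rightarrow> ('a, 'a set) module" where
  "left_quot R J =
     \<lparr>carrier = a_rcosets\<^bsub>R\<^esub> J, monoid.mult = undefined, monoid.one = undefined, ring.zero = J, ring.add = set_add R,
      module.smult = (\<lambda>a X. \<Union>x\<in>X. J +>\<^bsub>R\<^esub> (a \<otimes>\<^bsub>R\<^esub> x))\<rparr>"

definition left_module_iso ::
  "('a, 'm) ring_scheme \<Rightarrow> ('a, 'b, 'n) module_scheme \<Rightarrow> ('a, 'c, 'k) module_scheme \<Rightarrow> ('b \<Rightarrow> 'c) set"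
  where
  "left_module_iso R M N = {h. bij_betw h (carrier M) (carrier N) \<and>
     (\<forall>x\<in>carrier M. \<forall>y\<in>carrier M. h (x \<oplus>\<^bsub>M\<^esub> y) = h x \<oplus>\<^bsub>N\<^esub> h y) \<and>
     (\<forall>a\<in>carrier R. \<forall>x\<in>carrier M. h (a \<odot>\<^bsub>M\<^esub> x) = a \<odot>\<^bsub>N\<^esub> h x)}"

text \<open>\<open>B \<otimes>\<^sub>R N\<close> for a left module \<open>N\<close> and a bimodule \<open>B\<close> whose left action is the \<open>smult\<close> of \<open>B\<close>
  and whose right \<open>R\<close>-action is \<open>ract\<close>: the free abelian group on \<open>B \<times> N\<close> modulo the relations of
  additivity in both arguments and \<open>b a \<otimes> n = b \<otimes> a n\<close>.\<close>

definition tensor_free :: "('c, 'b, 'k) module_scheme \<Rightarrow> ('a, 'n, 'p) module_scheme \<Rightarrow>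
    (('b \<times> 'n) \<Rightarrow>\<^sub>0 int) monoid" where
  "tensor_free B N = free_Abelian_group (carrier B \<times> carrier N)"

definition tensor_rel :: "('a, 'm) ring_scheme \<Rightarrow> ('c, 'b, 'k) module_scheme \<Rightarrow> ('b \<Rightarrow> 'a \<Rightarrow> 'b) \<Rightarrow>
    ('a, 'n, 'p) module_scheme \<Rightarrow> (('b \<times> 'n) \<Rightarrow>\<^sub>0 int) set" where
  "tensor_rel R B ract N = generate (tensor_free B N)
    ({frag_of (b \<oplus>\<^bsub>B\<^esub> b', n) - frag_of (b, n) - frag_of (b', n) | b b' n.
        b \<in> carrier B \<and> b' \<in> carrier B \<and> n \<in> carrier N} \<union>
     {frag_of (b, n \<oplus>\<^bsub>N\<^esub> n') - frag_of (b, n) - frag_of (b, n') | b n n'.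
        b \<in> carrier B \<and> n \<in> carrier N \<and> n' \<in> carrier N} \<union>
     {frag_of (ract b a, n) - frag_of (b, a \<odot>\<^bsub>N\<^esub> n) | b a n.
        b \<in> carrier B \<and> a \<in> carrier R \<and> n \<in> carrier N})"

definition tensor :: "('a, 'm) ring_scheme \<Rightarrow> ('c, 'b, 'k) module_scheme \<Rightarrow> ('b \<Rightarrow> 'a \<Rightarrow> 'b) \<Rightarrow>
    ('a, 'n, 'p) module_scheme \<Rightarrow> ('c, (('b \<times> 'n) \<Rightarrow>\<^sub>0 int) set) module" where
  "tensor R B ract N = (let F = tensor_free B N; H = tensor_rel R B ract N in
     \<lparr>carrier = carrier (F Mod H), monoid.mult = undefined, monoid.one = undefined,
      ring.zero = \<one>\<^bsub>F Mod H\<^esub>, ring.add = monoid.mult (F Mod H),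
      module.smult = (\<lambda>a X. \<Union>x\<in>X. H #>\<^bsub>F\<^esub> frag_extend (\<lambda>(b, n). frag_of (a \<odot>\<^bsub>B\<^esub> b, n)) x)\<rparr>)"

definition pure_tensor :: "('a, 'm) ring_scheme \<Rightarrow> ('c, 'b, 'k) module_scheme \<Rightarrow>
    ('b \<Rightarrow> 'a \<Rightarrow> 'b) \<Rightarrow> ('a, 'n, 'p) module_scheme \<Rightarrow> 'b \<Rightarrow> 'n \<Rightarrow> (('b \<times> 'n) \<Rightarrow>\<^sub>0 int) set" where
  "pure_tensor R B ract N b n =
     tensor_rel R B ract N #>\<^bsub>tensor_free B N\<^esub> frag_of (b, n)"


section \<open>The algebras \<open>\<T>\<^sub>\<lambda>\<close> and \<open>\<A>\<^sub>\<lambda>\<close>\<close>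

definition iota :: "nat \<Rightarrow> nat \<Rightarrow> linop" where
  "iota l i = tvar (csucc l i) * pdiff (csucc l i) - tvar i * pdiff i"

definition tau :: "nat \<Rightarrow> nat \<Rightarrow> linop mat" where
  "tau l i = E_tensor l i i 1 + one_tensor l (iota l i)"

definition T_ideal :: "nat \<Rightarrow> (nat \<Rightarrow> real) \<Rightarrow> linop mat set" where
  "T_ideal l lam = left_ideal_gen (mat_weyl_inv l) l
     (\<lambda>i. tau l i - one_tensor l (scal (of_real (lam i))))"

definition T_alg :: "nat \<Rightarrow> (nat \<Rightarrow> real) \<Rightarrow> linop mat set ring" where
  "T_alg l lam = mat_weyl_inv l Quot T_ideal l lam"

definition T_class :: "nat \<Rightarrow> (nat \<Rightarrow> real) \<Rightarrow> linop mat \<Rightarrow> linop mat set" where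
  "T_class l lam M = T_ideal l lam +>\<^bsub>mat_weyl_inv l\<^esub> M"

definition T_e :: "nat \<Rightarrow> (nat \<Rightarrow> real) \<Rightarrow> nat \<Rightarrow> linop mat set" where
  "T_e l lam i = T_class l lam (E_tensor l i i 1)"

definition A_alg :: "nat \<Rightarrow> (nat \<Rightarrow> real) \<Rightarrow> linop mat set ring" where
  "A_alg l lam = (T_alg l lam)
     \<lparr>carrier := {T_e l lam 0 \<otimes>\<^bsub>T_alg l lam\<^esub> x \<otimes>\<^bsub>T_alg l lam\<^esub> T_e l lam 0 | x. x \<in> carrier (T_alg l lam)},
      monoid.one := T_e l lam 0\<rparr>"

text \<open>The isomorphism \<open>\<A>\<^sub>\<lambda> \<simeq> D\<^sup>G\<^sup>L / \<Sum> D\<^sup>G\<^sup>L (\<iota>\<^sub>i - bar \<lambda>\<^sub>i)\<close> sends the class of a matrix in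
  \<open>e\<^sub>0 M\<^sub>l(D)\<^sup>G\<^sup>L e\<^sub>0\<close> to the class of its entry at \<open>(0, 0)\<close>; its inverse is \<open>[P] \<mapsto> [E\<^sub>0\<^sub>0 \<otimes> P]\<close>.\<close>

definition AD_ideal :: "nat \<Rightarrow> (nat \<Rightarrow> real) \<Rightarrow> linop set" where
  "AD_ideal l lam = left_ideal_gen (weyl_inv l) l (\<lambda>i. iota l i - scal (of_real (bar lam i)))"

definition A_to_AD :: "nat \<Rightarrow> (nat \<Rightarrow> real) \<Rightarrow> linop mat set \<Rightarrow> linop set" where
  "A_to_AD l lam X = (\<Union>M\<in>X. AD_ideal l lam +>\<^bsub>weyl_inv l\<^esub> (M $$ (0, 0)))"


section \<open>The bimodule \<open>\<B>\<^sub>\<lambda>\<^sup>\<theta>\<close> and the shift functor\<close>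

definition B_ideal :: "nat \<Rightarrow> (nat \<Rightarrow> real) \<Rightarrow> linop set" where
  "B_ideal l lam = left_ideal_gen (weyl_ring l) l (\<lambda>i. iota l i - scal (of_real (bar lam i)))"

definition B_class :: "nat \<Rightarrow> (nat \<Rightarrow> real) \<Rightarrow> linop \<Rightarrow> linop set" where
  "B_class l lam P = B_ideal l lam +>\<^bsub>weyl_ring l\<^esub> P"

text \<open>\<open>B_ideal\<close> is stable under the torus and under nonzero scalars, so the image of a coset under
  either is the coset of the image. The left action is that of \<open>\<A>\<^sub>\<lambda>\<^sub>+\<^sub>\<theta>\<close>.\<close>

definition B_mod :: "nat \<Rightarrow> (nat \<Rightarrow> real) \<Rightarrow> (nat \<Rightarrow> int) \<Rightarrow> (linop mat set, linop set) module" where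
  "B_mod l lam th =
     \<lparr>carrier = {X \<in> a_rcosets\<^bsub>weyl_ring l\<^esub> (B_ideal l lam).
        \<forall>g\<in>torus l. act l g ` X = (\<lambda>P. scal (chr l th g) * P) ` X},
      monoid.mult = undefined, monoid.one = undefined, ring.zero = B_ideal l lam, ring.add = set_add (weyl_ring l),
      module.smult = (\<lambda>a X. \<Union>P\<in>A_to_AD l (shift_par lam th) a. \<Union>Q\<in>X. B_class l lam (P * Q))\<rparr>"

definition B_ract :: "nat \<Rightarrow> (nat \<Rightarrow> real) \<Rightarrow> linop set \<Rightarrow> linop mat set \<Rightarrow> linop set" where
  "B_ract l lam X a = (\<Union>Q\<in>X. \<Union>P\<in>A_to_AD l lam a. B_class l lam (Q * P))"

definition S_fun :: "nat \<Rightarrow> (nat \<Rightarrow> real) \<Rightarrow> (nat \<Rightarrow> int) \<Rightarrow> (linop mat set, 'n) module \<Rightarrow>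
    (linop mat set, ((linop set \<times> 'n) \<Rightarrow>\<^sub>0 int) set) module" where
  "S_fun l lam th N = tensor (A_alg l lam) (B_mod l lam th) (B_ract l lam) N"

definition S_tensor :: "nat \<Rightarrow> (nat \<Rightarrow> real) \<Rightarrow> (nat \<Rightarrow> int) \<Rightarrow> (linop mat set, 'n) module \<Rightarrow>
    linop set \<Rightarrow> 'n \<Rightarrow> ((linop set \<times> 'n) \<Rightarrow>\<^sub>0 int) set" where
  "S_tensor l lam th N b n = pure_tensor (A_alg l lam) (B_mod l lam th) (B_ract l lam) N b n"


section \<open>Standard modules\<close>

text \<open>\<open>A\<^sup>* = \<Sum>\<^sub>i E\<^sub>i\<^sub>-\<^sub>1\<^sub>,\<^sub>i \<otimes> \<partial>\<^sub>i\<close>\<close>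

definition A_star :: "nat \<Rightarrow> linop mat" where
  "A_star l = mat l l (\<lambda>(a, b). if a = cpred l b then pdiff b else 0)"

definition TA_star :: "nat \<Rightarrow> (nat \<Rightarrow> real) \<Rightarrow> linop mat set set" where
  "TA_star l lam = {x \<otimes>\<^bsub>T_alg l lam\<^esub> T_class l lam (A_star l) | x. x \<in> carrier (T_alg l lam)}"

text \<open>Right multiplication by \<open>e\<^sub>i\<close> descends to \<open>\<T>/\<T>A\<^sup>*\<close> because \<open>A\<^sup>* e\<^sub>i = e\<^sub>i\<^sub>-\<^sub>1 A\<^sup>*\<close>.\<close>

definition Delta :: "nat \<Rightarrow> (nat \<Rightarrow> real) \<Rightarrow> nat \<Rightarrow> (linop mat set, linop mat set set) module" where
  "Delta l lam i = (let T = T_alg l lam; J = TA_star l lam in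
     (left_quot T J)\<lparr>carrier := {\<Union>x\<in>X. J +>\<^bsub>T\<^esub> (x \<otimes>\<^bsub>T\<^esub> T_e l lam i) | X. X \<in> carrier (left_quot T J)}\<rparr>)"

definition e0_Delta :: "nat \<Rightarrow> (nat \<Rightarrow> real) \<Rightarrow> nat \<Rightarrow> (linop mat set, linop mat set set) module" where
  "e0_Delta l lam i = (Delta l lam i)
     \<lparr>carrier := {T_e l lam 0 \<odot>\<^bsub>Delta l lam i\<^esub> X | X. X \<in> carrier (Delta l lam i)}\<rparr>"

text \<open>\<open>t\<^sub>0 t\<^sub>l\<^sub>-\<^sub>1 \<cdots> t\<^sub>k\<^sub>+\<^sub>1\<close>, which is empty for \<open>k = 0\<close>\<close>

definition t_path :: "nat \<Rightarrow> nat \<Rightarrow> linop" where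
  "t_path l k = (if k = 0 then 1 else tvar 0 * prod_list (map tvar (rev [k + 1..<l])))"

definition e0_vec :: "nat \<Rightarrow> (nat \<Rightarrow> real) \<Rightarrow> nat \<Rightarrow> linop mat set set" where
  "e0_vec l lam k = TA_star l lam +>\<^bsub>T_alg l lam\<^esub> T_class l lam (E_tensor l 0 k (t_path l k))"


section \<open>The elements \<open>f\<^sub>i\<close>\<close>

text \<open>If \<open>theta_enum l th \<eta>\<close> holds then all exponents \<open>cyc_sum l th (\<eta> j) (\<eta> (j + 1))\<close> are
  positive, so \<open>nat\<close> does not truncate.\<close>

definition f_tilde :: "nat \<Rightarrow> (nat \<Rightarrow> int) \<Rightarrow> (nat \<Rightarrow> nat) \<Rightarrow> nat \<Rightarrow> linop" where
  "f_tilde l th \<eta> i =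
     (\<Prod>j\<leftarrow>[i..<l]. (\<Prod>m\<leftarrow>[j + 1..<l + 1]. tvar (\<eta> m)) ^ nat (cyc_sum l th (\<eta> j) (\<eta> (j + 1)))) *
     (\<Prod>j\<leftarrow>[1..<i]. (\<Prod>m\<leftarrow>[1..<j + 1]. pdiff (\<eta> m)) ^ nat (cyc_sum l th (\<eta> j) (\<eta> (j + 1))))"

end

theory Submission
  imports Defs "HOL-Library.Function_Algebras" "HOL-Computational_Algebra.Polynomial"
begin

text \<open>Write \<open>k = \<eta>\<^sub>i\<close>, \<open>s\<^sub>j = \<theta>\<^sub>0 + \<dots> + \<theta>\<^sub>j\<^sub>-\<^sub>1\<close> and \<open>T = t\<^sub>0 \<cdots> t\<^sub>l\<^sub>-\<^sub>1\<close>. Both modules are compared inside one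
  larger \<open>D\<close>-module: the formal combinations of monomials \<open>t\<^sup>x\<close> with real exponent vectors \<open>x\<close>, on
  which \<open>t\<^sub>j\<close> raises \<open>x\<^sub>j\<close> by one and \<open>\<partial>\<^sub>j t\<^sup>x = x\<^sub>j t\<^sup>x / t\<^sub>j\<close>. The generator \<open>1\<^sub>k\<close> of the standard module
  is killed by \<open>\<partial>\<^sub>k\<close> and by all \<open>\<iota>\<^sub>j + \<delta>\<^sub>j\<^sub>k - \<lambda>\<^sub>j\<close>. A suitable \<open>t\<^sup>x\<close> with \<open>x\<^sub>k = 0\<close> is killed by the same
  operators, so \<open>P 1\<^sub>k \<mapsto> P t\<^sup>x\<close> is well defined on \<open>e\<^sub>0 \<Delta>\<^sub>\<lambda>(k)\<close> (\<open>vec_eq_imp_rho_eq\<close>). It takes the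
  highest weight vector to \<open>t\<^sup>\<nu>\<close>, where \<open>\<nu>\<^sub>j\<close> is the cyclic sum of the shifted parameters from \<open>k\<close>
  to \<open>j\<close>, and its image is the span of the \<open>T\<^sup>n t\<^sup>\<nu>\<close>. In the same way \<open>Q \<otimes> P 1\<^sub>k \<mapsto> Q P t\<^sup>x\<close> is well
  defined on the tensor product. Passing from \<open>\<lambda>\<close> to \<open>\<lambda> + \<theta>\<close> changes \<open>\<nu>\<close> into
  \<open>\<nu>' = \<nu> + (s\<^sub>j - s\<^sub>k)\<^sub>j\<close> (\<open>hw_exp_shift\<close>), and the exponents in the element of the theorem telescope
  to make it an operator of degree exactly \<open>(s\<^sub>j - s\<^sub>k)\<^sub>j\<close> (\<open>f_tilde_words\<close>), so it maps \<open>t\<^sup>\<nu>\<close> to a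
  multiple \<open>\<gamma> t\<^sup>\<nu>\<^sup>'\<close>. Hence both modules have the span of the \<open>T\<^sup>n t\<^sup>\<nu>\<^sup>'\<close> as image, and the isomorphism is
  one comparison map followed by the inverse of the other. This needs the following.

  First, \<open>\<gamma> \<noteq> 0\<close>. The operator differentiates \<open>s\<^sub>k - s\<^sub>j\<close> times in direction \<open>j\<close> when this number is
  positive, so it could kill \<open>t\<^sup>\<nu>\<close> only if \<open>\<nu>\<^sub>j\<close> is a natural number below \<open>s\<^sub>k - s\<^sub>j\<close>. Regularity
  excludes \<open>\<nu>\<^sub>j = 0\<close>; for \<open>\<nu>\<^sub>j \<ge> 1\<close> the sum \<open>\<lambda>\<^sub>j + \<dots> + \<lambda>\<^sub>k\<^sub>-\<^sub>1\<close> is a nonpositive integer, and then the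
  condition on \<open>\<theta>\<close> says \<open>s\<^sub>k < s\<^sub>j\<close> (\<open>hw_exp_avoids\<close>).

  Second, each module is spanned by the \<open>T\<^sup>n\<close>-multiples of its generator. The algebra \<open>D\<close> is graded by
  \<open>\<int>\<^sup>l\<close>, and once the eigenvalues of the Euler operators \<open>t\<^sub>j \<partial>\<^sub>j\<close> are fixed each degree contributes at
  most one dimension (\<open>normal_form\<close>). Semi-invariants of a given weight have degrees
  \<open>d + m(1, \<dots>, 1)\<close> with \<open>d\<close> fixed, and the part with \<open>m < 0\<close> vanishes: in the standard module because
  a \<open>\<partial>\<^sub>k\<close> splits off on the right (\<open>nmon_vec_null\<close>), in the tensor product because, by
  regularity, \<open>\<partial>\<^sub>0 \<cdots> \<partial>\<^sub>l\<^sub>-\<^sub>1\<close> splits off on the right up to a nonzero scalar; it crosses the tensor sign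
  and kills the highest weight vector (\<open>below_null\<close>). Both cases are instances of \<open>wspace_spanned\<close>.

  Third, the \<open>T\<^sup>n t\<^sup>\<nu>\<^sup>'\<close> are linearly independent (\<open>tpoly_faithful\<close>), so the spanning sets are bases and
  both comparison maps are injective.

  The elements of \<open>D\<close> are operators on polynomials, so it has to be shown that they act on real
  exponents at all: each is a finite sum of exponent shifts with polynomial coefficients, and a
  polynomial is determined by its values at natural vectors (\<open>shift_sum_eq_0\<close>).\<close>

section \<open>The grading of the Weyl algebra\<close>

lemma scal_0 [simp]: "scal 0 = 0"
  by transfer (simp add: fun_eq_iff)

lemma scal_1 [simp]: "scal 1 = 1"
  by transfer (simp add: fun_eq_iff flip: one_poly_mapping_def)

lemma scal_add: "scal (c + d) = scal c + scal d"
  by transfer (simp add: fun_eq_iff single_add distrib_right)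

lemma scal_minus: "scal (- c) = - scal c"
  using scal_add[of c "- c"] by (simp add: eq_neg_iff_add_eq_0 add.commute)

lemma scal_diff: "scal (c - d) = scal c - scal d"
  using scal_add[of c "- d"] by (simp add: scal_minus)

lemma scal_left_commute: "P * (scal c * Q) = scal c * (P * Q)"
  by (metis mult.assoc scal_commute)

lemma scal_mult_mult: "(scal a * P) * (scal b * Q) = scal (a * b) * (P * Q)"
  by (metis mult.assoc scal_commute scal_mult)

lemma tvar_commute: "tvar i * tvar j = tvar j * tvar i"
  by transfer (simp add: fun_eq_iff mult_single add.commute flip: mult.assoc)

lemma pdiff_tvar: "pdiff i * tvar j = tvar j * pdiff i + (if i = j then 1 else 0)"
  using weyl_relation[of i j] by (simp add: algebra_simps)

lemma pdiff_commute: "pdiff i * pdiff j = pdiff j * pdiff i"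
proof (rule linop_eqI, rule poly_mapping_eqI)
  fix p a
  show "Poly_Mapping.lookup (app_op (pdiff i * pdiff j) p) a =
    Poly_Mapping.lookup (app_op (pdiff j * pdiff i) p) a"
    by (cases "i = j") (simp_all add: times_linop.rep_eq pdiff.rep_eq poly_deriv.rep_eq
       lookup_add lookup_single add_ac mult_ac)
qed

definition euler :: "nat \<Rightarrow> linop" where
  "euler i = tvar i * pdiff i"

lemma iota_euler: "iota l i = euler (csucc l i) - euler i"
  by (simp add: iota_def euler_def)

lemma zero_weyl [simp]: "0 \<in> weyl l"
  using weyl.scal[of 0 l] by simp

lemma uminus_weyl [simp]: "P \<in> weyl l \<Longrightarrow> - P \<in> weyl l"
  using weyl.mult[OF weyl.scal[of "-1"], of P l] by (simp add: scal_minus)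

lemma diff_weyl [simp]: "P \<in> weyl l \<Longrightarrow> Q \<in> weyl l \<Longrightarrow> P - Q \<in> weyl l"
  using weyl.add[of P l "- Q"] by simp

lemma sum_weyl [simp]: "(\<And>i. i \<in> A \<Longrightarrow> f i \<in> weyl l) \<Longrightarrow> sum f A \<in> weyl l"
  by (induction A rule: infinite_finite_induct) (auto intro: weyl.add)

lemma csucc_less [simp]: "i < l \<Longrightarrow> csucc l i < l"
  by (simp add: csucc_def)

lemma cpred_less [simp]: "i < l \<Longrightarrow> cpred l i < l"
  by (simp add: cpred_def)

lemma csucc_cpred: "i < l \<Longrightarrow> csucc l (cpred l i) = i"
  unfolding csucc_def cpred_def by (cases i) (simp_all add: mod_Suc)

lemma cpred_csucc: "i < l \<Longrightarrow> cpred l (csucc l i) = i"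
  unfolding csucc_def cpred_def by (cases "i + 1 = l") simp_all

lemma csucc_eq_iff: "i < l \<Longrightarrow> j < l \<Longrightarrow> csucc l j = i \<longleftrightarrow> j = cpred l i"
  using csucc_cpred cpred_csucc by metis

lemma euler_weyl [simp]: "i < l \<Longrightarrow> euler i \<in> weyl l"
  by (auto simp: euler_def intro: weyl.intros)

lemma iota_weyl [simp]: "i < l \<Longrightarrow> iota l i \<in> weyl l"
  by (auto simp: iota_euler)

definition unit_deg :: "nat \<Rightarrow> nat \<Rightarrow> int" where
  "unit_deg i j = (if j = i then 1 else 0)"

inductive weyl_deg :: "nat \<Rightarrow> (nat \<Rightarrow> int) \<Rightarrow> linop \<Rightarrow> bool" for l where
  zero: "weyl_deg l d 0"
| scal: "weyl_deg l 0 (scal c)"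
| tvar: "i < l \<Longrightarrow> weyl_deg l (unit_deg i) (tvar i)"
| pdiff: "i < l \<Longrightarrow> weyl_deg l (- unit_deg i) (pdiff i)"
| add: "weyl_deg l d P \<Longrightarrow> weyl_deg l d Q \<Longrightarrow> weyl_deg l d (P + Q)"
| mult: "weyl_deg l d P \<Longrightarrow> weyl_deg l e Q \<Longrightarrow> weyl_deg l (d + e) (P * Q)"

lemma weyl_deg_weyl: "weyl_deg l d P \<Longrightarrow> P \<in> weyl l"
  by (induction rule: weyl_deg.induct) (auto intro: weyl.intros)

lemma weyl_deg_one [intro]: "weyl_deg l 0 1"
  using weyl_deg.scal[of l 1] by simp

lemma weyl_deg_scal_mult: "weyl_deg l d P \<Longrightarrow> weyl_deg l d (scal c * P)"
  using weyl_deg.mult[OF weyl_deg.scal, of l d P c] by simp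

lemma weyl_deg_uminus: "weyl_deg l d P \<Longrightarrow> weyl_deg l d (- P)"
  using weyl_deg_scal_mult[of l d P "-1"] by (simp add: scal_minus)

lemma weyl_deg_diff: "weyl_deg l d P \<Longrightarrow> weyl_deg l d Q \<Longrightarrow> weyl_deg l d (P - Q)"
  using weyl_deg.add[OF _ weyl_deg_uminus, of l d P Q] by simp

lemma weyl_deg_cong: "weyl_deg l d P \<Longrightarrow> (\<And>i. d i = e i) \<Longrightarrow> weyl_deg l e P"
  by (metis ext)

lemma weyl_deg_euler: "i < l \<Longrightarrow> weyl_deg l 0 (euler i)"
  using weyl_deg.mult[OF weyl_deg.tvar weyl_deg.pdiff, of i l i] by (simp add: euler_def)

lemma weyl_deg_supp: "weyl_deg l d P \<Longrightarrow> P = 0 \<or> (\<forall>i\<ge>l. d i = 0)"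
proof (induction rule: weyl_deg.induct)
  case (add d P Q)
  then show ?case by (cases "P = 0") auto
next
  case (mult d P e Q)
  then show ?case by (cases "P = 0"; cases "Q = 0") auto
qed (auto simp: unit_deg_def)

lemma euler_scal: "euler i * scal c = scal c * euler i"
  by (simp add: scal_commute)

lemma euler_tvar: "euler i * tvar j = tvar j * (euler i + (if i = j then 1 else 0))"
proof -
  have "euler i * tvar j = tvar i * (pdiff i * tvar j)" by (simp add: euler_def mult.assoc)
  also have "\<dots> = tvar j * tvar i * pdiff i + tvar i * (if i = j then 1 else 0)"
    by (simp add: pdiff_tvar distrib_left tvar_commute flip: mult.assoc)
  finally show ?thesis by (auto simp: euler_def algebra_simps)
qed

lemma euler_pdiff: "euler i * pdiff j = pdiff j * (euler i - (if i = j then 1 else 0))"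
proof -
  have "pdiff j * euler i = (tvar i * pdiff j + (if i = j then 1 else 0)) * pdiff i"
    by (simp add: euler_def pdiff_tvar flip: mult.assoc)
  then show ?thesis by (auto simp: euler_def algebra_simps pdiff_commute[of j i])
qed

text \<open>The Euler operators \<open>t\<^sub>i \<partial>\<^sub>i\<close> measure the degree. This is what converts relations for the parameter
  \<open>\<lambda>\<close> into relations for \<open>\<lambda> + \<theta>\<close>.\<close>

lemma euler_weyl_deg: "weyl_deg l d P \<Longrightarrow> euler i * P = P * (euler i + scal (of_int (d i)))"
proof (induction rule: weyl_deg.induct)
  case (tvar j)
  then show ?case by (auto simp: euler_tvar unit_deg_def)
next
  case (pdiff j)
  then show ?case by (auto simp: euler_pdiff unit_deg_def scal_minus)
next
  case (mult d P e Q)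
  have "euler i * (P * Q) = P * (euler i + scal (of_int (d i))) * Q"
    using mult.IH(1) by (simp flip: mult.assoc)
  also have "\<dots> = P * (euler i * Q + Q * scal (of_int (d i)))"
    by (simp add: mult.assoc distrib_left distrib_right scal_commute[of _ Q])
  also have "\<dots> = P * Q * (euler i + scal (of_int ((d + e) i)))"
    by (simp add: mult.IH(2) mult.assoc scal_add distrib_left add_ac)
  finally show ?case .
next
  case (scal c)
  show ?case by (simp add: euler_scal)
next
  case (add d P Q)
  then show ?case by (simp add: distrib_left distrib_right)
qed simp

text \<open>The character through which the torus acts on the degree-\<open>d\<close> part.\<close>

definition deg_wt :: "nat \<Rightarrow> (nat \<Rightarrow> int) \<Rightarrow> nat \<Rightarrow> int" where
  "deg_wt l d i = d (csucc l i) - d i"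

lemma deg_wt_add: "deg_wt l (d + e) = deg_wt l d + deg_wt l e"
  by (auto simp: deg_wt_def fun_eq_iff)

lemma deg_wt_uminus: "deg_wt l (- d) = - deg_wt l d"
  by (auto simp: deg_wt_def fun_eq_iff)

lemma chr_0 [simp]: "chr l 0 g = 1"
  by (simp add: chr_def)

lemma chr_add: "g \<in> torus l \<Longrightarrow> chr l (a + b) g = chr l a g * chr l b g"
  by (auto simp: chr_def torus_def power_int_add prod.distrib[symmetric] intro!: prod.cong)

lemma chr_uminus: "chr l (- a) g = inverse (chr l a g)"
  by (simp add: chr_def power_int_minus flip: prod_inversef)

lemma chr_diff: "g \<in> torus l \<Longrightarrow> chr l (a - b) g = chr l a g * inverse (chr l b g)"
  using chr_add[of g l a "- b"] by (simp add: chr_uminus)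

lemma chr_nonzero [simp]: "g \<in> torus l \<Longrightarrow> chr l a g \<noteq> 0"
  by (auto simp: chr_def torus_def power_int_not_zero)

lemma chr_cong: "(\<And>i. i < l \<Longrightarrow> a i = b i) \<Longrightarrow> chr l a g = chr l b g"
  by (auto simp: chr_def)

lemma chr_unit_deg: "i < l \<Longrightarrow> chr l (unit_deg i) g = g i"
proof -
  assume "i < l"
  have "chr l (unit_deg i) g = (\<Prod>j<l. if j = i then g i else 1)"
    unfolding chr_def by (rule prod.cong) (auto simp: unit_deg_def)
  then show ?thesis using \<open>i < l\<close> by (simp add: prod.delta)
qed

lemma deg_wt_unit_deg:
  "i < l \<Longrightarrow> j < l \<Longrightarrow> deg_wt l (unit_deg i) j = (unit_deg (cpred l i) - unit_deg i) j"
  by (auto simp: deg_wt_def unit_deg_def csucc_eq_iff)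

lemma chr_deg_wt_unit:
  assumes "g \<in> torus l" "i < l"
  shows "chr l (deg_wt l (unit_deg i)) g = inverse (g i) * g (cpred l i)"
proof -
  have "chr l (deg_wt l (unit_deg i)) g = chr l (unit_deg (cpred l i) - unit_deg i) g"
    using deg_wt_unit_deg[OF assms(2)] by (intro chr_cong)
  then show ?thesis
    using assms by (simp add: chr_diff chr_unit_deg)
qed

lemma act_weyl_deg:
  assumes "g \<in> torus l" "weyl_deg l d P"
  shows "act l g P = scal (chr l (deg_wt l d) g) * P"
  using assms(2)
proof (induction rule: weyl_deg.induct)
  case (zero d)
  show ?case by (simp add: act_def)
next
  case (scal c)
  have "chr l (deg_wt l 0) g = chr l 0 g" by (rule chr_cong) (simp add: deg_wt_def)
  then show ?case using assms by (simp only: act_scal chr_0 scal_1 mult_1)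
next
  case (tvar i)
  then show ?case using assms by (simp add: act_tvar chr_deg_wt_unit)
next
  case (pdiff i)
  then have "inverse (chr l (deg_wt l (unit_deg i)) g) = g i * inverse (g (cpred l i))"
    using assms by (simp add: chr_deg_wt_unit)
  then show ?case using assms pdiff by (simp only: act_pdiff deg_wt_uminus chr_uminus)
next
  case (add d P Q)
  then show ?case by (simp add: act_add distrib_left)
next
  case (mult d P e Q)
  then show ?case using assms(1)
    by (simp only: act_mult deg_wt_add chr_add scal_mult_mult)
qed

lemma act_0 [simp]: "act l g 0 = 0"
  by (simp add: act_def)

lemma act_sum: "act l g (sum f A) = (\<Sum>i\<in>A. act l g (f i))"
  by (induction A rule: infinite_finite_induct) (auto simp: act_add)

lemma act_diff: "act l g (P - Q) = act l g P - act l g Q"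
  by (simp add: act_def algebra_simps)

text \<open>The components are indexed by all degrees and vanish outside \<open>S\<close>, so that two decompositions can
  be added over the union of their supports.\<close>

definition graded_sum :: "nat \<Rightarrow> linop \<Rightarrow> bool" where
  "graded_sum l P \<longleftrightarrow> (\<exists>S p. finite S \<and> (\<forall>d. weyl_deg l d (p d)) \<and> (\<forall>d. d \<notin> S \<longrightarrow> p d = 0) \<and> P = sum p S)"

lemma graded_sum_deg: "weyl_deg l d P \<Longrightarrow> graded_sum l P"
  unfolding graded_sum_def
  by (rule exI[of _ "{d}"], rule exI[of _ "\<lambda>e. if e = d then P else 0"]) (auto intro: weyl_deg.zero)

lemma graded_sum_add:
  assumes "graded_sum l P" "graded_sum l Q" shows "graded_sum l (P + Q)"
proof -
  obtain S p where p: "finite S" "\<forall>d. weyl_deg l d (p d)" "\<forall>d. d \<notin> S \<longrightarrow> p d = 0" "P = sum p S"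
    using assms(1) unfolding graded_sum_def by blast
  obtain T q where q: "finite T" "\<forall>d. weyl_deg l d (q d)" "\<forall>d. d \<notin> T \<longrightarrow> q d = 0" "Q = sum q T"
    using assms(2) unfolding graded_sum_def by blast
  have "sum p S = sum p (S \<union> T)" "sum q T = sum q (S \<union> T)"
    using p q by (auto intro!: sum.mono_neutral_left)
  then have "P + Q = (\<Sum>d\<in>S \<union> T. p d + q d)" using p q by (simp add: sum.distrib)
  then show ?thesis
    unfolding graded_sum_def using p q
    by (intro exI[of _ "S \<union> T"] exI[of _ "\<lambda>d. p d + q d"]) (auto intro: weyl_deg.add)
qed

lemma graded_sum_sum: "(\<And>i. i \<in> A \<Longrightarrow> graded_sum l (f i)) \<Longrightarrow> graded_sum l (sum f A)"
  by (induction A rule: infinite_finite_induct)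
    (auto intro: graded_sum_add graded_sum_deg[OF weyl_deg.zero])

lemma graded_sum_mult:
  assumes "graded_sum l P" "graded_sum l Q" shows "graded_sum l (P * Q)"
proof -
  obtain S p where p: "finite S" "\<forall>d. weyl_deg l d (p d)" "P = sum p S"
    using assms(1) unfolding graded_sum_def by blast
  obtain T q where q: "finite T" "\<forall>d. weyl_deg l d (q d)" "Q = sum q T"
    using assms(2) unfolding graded_sum_def by blast
  have "P * Q = (\<Sum>d\<in>S. \<Sum>e\<in>T. p d * q e)"
    using p q by (simp add: sum_product)
  moreover have "graded_sum l (p d * q e)" for d e
    using p q by (meson graded_sum_deg weyl_deg.mult)
  ultimately show ?thesis by (simp add: graded_sum_sum)
qed

lemma weyl_graded_sum: "P \<in> weyl l \<Longrightarrow> graded_sum l P"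
  by (induction rule: weyl.induct)
    (auto intro: graded_sum_add graded_sum_mult graded_sum_deg weyl_deg.intros)

text \<open>The semi-invariants of \<open>D\<close> for the character \<open>\<chi>\<^sub>\<theta>\<close>.\<close>

definition wspace :: "nat \<Rightarrow> (nat \<Rightarrow> int) \<Rightarrow> linop set" where
  "wspace l th = {P \<in> weyl l. \<forall>g\<in>torus l. act l g P = scal (chr l th g) * P}"

lemma weyl_deg_wspace:
  assumes "weyl_deg l d P" "\<And>i. i < l \<Longrightarrow> deg_wt l d i = th i" shows "P \<in> wspace l th"
proof -
  have "chr l (deg_wt l d) g = chr l th g" for g using assms(2) by (rule chr_cong)
  then show ?thesis using assms(1) by (simp add: wspace_def weyl_deg_weyl act_weyl_deg)
qed

lemma torus_separates:
  assumes "i < l" "a i \<noteq> b i"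
  obtains g where "g \<in> torus l" "chr l a g \<noteq> chr l b g"
proof
  \<comment> \<open>The powers of 2 with different integer exponents are different.\<close>
  let ?g = "\<lambda>j. if j = i then 2 else (1::complex)"
  show "?g \<in> torus l" by (simp add: torus_def)
  have "chr l c ?g = 2 powi (c i)" for c
  proof -
    have "chr l c ?g = (\<Prod>j<l. if j = i then 2 powi (c i) else 1)"
      unfolding chr_def by (rule prod.cong) auto
    then show ?thesis using assms(1) by (simp add: prod.delta)
  qed
  moreover have "(2::complex) powi (a i) \<noteq> 2 powi (b i)"
  proof
    assume "(2::complex) powi (a i) = 2 powi (b i)"
    then have "norm ((2::complex) powi (a i)) = norm ((2::complex) powi (b i))" by simp
    then have *: "(2::real) powi (a i) = 2 powi (b i)" by (simp add: norm_power_int)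
    show False
      using assms(2) * power_int_strict_increasing[of "a i" "b i" "2::real"]
        power_int_strict_increasing[of "b i" "a i" "2::real"] by linarith
  qed
  ultimately show "chr l a ?g \<noteq> chr l b ?g" by simp
qed

definition linop_subgroup :: "linop set \<Rightarrow> bool" where
  "linop_subgroup J \<longleftrightarrow> 0 \<in> J \<and> (\<forall>x\<in>J. \<forall>y\<in>J. x - y \<in> J)"

lemma linop_subgroupD:
  assumes "linop_subgroup J"
  shows "0 \<in> J" "x \<in> J \<Longrightarrow> y \<in> J \<Longrightarrow> x - y \<in> J" "x \<in> J \<Longrightarrow> - x \<in> J"
    "x \<in> J \<Longrightarrow> y \<in> J \<Longrightarrow> x + y \<in> J"
proof -
  show *: "0 \<in> J" "x \<in> J \<Longrightarrow> y \<in> J \<Longrightarrow> x - y \<in> J" for x y using assms by (auto simp: linop_subgroup_def)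
  show **: "x \<in> J \<Longrightarrow> - x \<in> J" for x using *(1) *(2)[of 0 x] by simp
  show "x \<in> J \<Longrightarrow> y \<in> J \<Longrightarrow> x + y \<in> J" using *(2)[of x "- y"] ** by simp
qed

lemma linop_subgroup_sum:
  "linop_subgroup J \<Longrightarrow> (\<And>i. i \<in> A \<Longrightarrow> f i \<in> J) \<Longrightarrow> sum f A \<in> J"
  by (induction A rule: infinite_finite_induct) (auto dest: linop_subgroupD)

text \<open>Characters are separated by torus elements, so modulo a torus-stable subspace a
  semi-invariant element can only have components of its own weight: a component \<open>p w\<close> of
  another weight is removed by applying \<open>g - \<chi>\<^sub>w(g)\<close>, which preserves the hypotheses.\<close>

lemma other_weights_vanish:
  assumes J: "linop_subgroup J" "\<And>c P. P \<in> J \<Longrightarrow> scal c * P \<in> J"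
      "\<And>g P. g \<in> torus l \<Longrightarrow> P \<in> J \<Longrightarrow> act l g P \<in> J"
    and S: "finite S" "\<And>d. d \<in> S \<Longrightarrow> weyl_deg l d (p d)"
      "\<And>d. d \<in> S \<Longrightarrow> \<exists>i<l. deg_wt l d i \<noteq> th i"
    and inv: "\<And>g. g \<in> torus l \<Longrightarrow>
      (\<Sum>d\<in>S. scal (chr l (deg_wt l d) g - chr l th g) * p d) \<in> J"
  shows "sum p S \<in> J"
  using S inv
proof (induction S arbitrary: p rule: finite_induct)
  case empty
  then show ?case using linop_subgroupD(1)[OF J(1)] by simp
next
  case (insert w S)
  define L where "L c = (\<Sum>d\<in>insert w S. scal (c d) * p d)" for c
  define x where "x = (\<lambda>g d. chr l (deg_wt l d) g)"
  have act_L: "act l g (L c) = L (\<lambda>d. x g d * c d)" if "g \<in> torus l" for g c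
    unfolding L_def act_sum x_def
  proof (rule sum.cong[OF refl])
    fix d assume "d \<in> insert w S"
    then show "act l g (scal (c d) * p d) = scal (chr l (deg_wt l d) g * c d) * p d"
      using act_weyl_deg[OF that weyl_deg_scal_mult[OF insert.prems(1)]] by (simp add: scal_mult flip: mult.assoc)
  qed
  have scal_L: "scal a * L c = L (\<lambda>d. a * c d)" for a c
    unfolding L_def sum_distrib_left by (simp add: scal_mult flip: mult.assoc)
  have diff_L: "L c - L c' = L (\<lambda>d. c d - c' d)" for c c'
    unfolding L_def sum_subtractf[symmetric] by (simp add: scal_diff left_diff_distrib)
  have L_J: "L (\<lambda>d. x h d - chr l th h) \<in> J" if "h \<in> torus l" for h
    using insert.prems(3)[OF that] by (simp only: L_def x_def)
  have L_w: "L c = (\<Sum>d\<in>S. scal (c d) * p d)" if "c w = 0" for c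
    using insert.hyps that by (simp add: L_def)
  have L_1: "L (\<lambda>_. 1) = sum p (insert w S)"
    by (simp only: L_def scal_1 mult_1)
  have step: "L (\<lambda>d. x g d - x g w) \<in> J" if g: "g \<in> torus l" for g
  proof -
    have "(\<Sum>d\<in>S. scal (x g d - x g w) * p d) \<in> J"
    proof (rule insert.IH)
      show "weyl_deg l d (scal (x g d - x g w) * p d)" if "d \<in> S" for d
        using insert.prems(1)[of d] that by (auto intro: weyl_deg_scal_mult)
      show "\<exists>i<l. deg_wt l d i \<noteq> th i" if "d \<in> S" for d
        using insert.prems(2)[of d] that by auto
      show "(\<Sum>d\<in>S. scal (chr l (deg_wt l d) h - chr l th h) * (scal (x g d - x g w) * p d)) \<in> J"
        if h: "h \<in> torus l" for h
      proof -
        let ?c = "\<lambda>d. x h d - chr l th h"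
        have "L (\<lambda>d. (x g d - x g w) * ?c d) = act l g (L ?c) - scal (x g w) * L ?c"
          by (simp only: act_L[OF g] scal_L diff_L left_diff_distrib)
        also have "\<dots> \<in> J"
          using J g L_J[OF h] by (intro linop_subgroupD(2)[OF J(1)]) auto
        finally show ?thesis
          by (subst (asm) L_w) (simp_all add: x_def scal_mult mult.commute flip: mult.assoc)
      qed
    qed
    then show ?thesis by (subst L_w) simp_all
  qed
  obtain i where i: "i < l" "deg_wt l w i \<noteq> th i" using insert.prems(2)[of w] by auto
  obtain g where g: "g \<in> torus l" "x g w \<noteq> chr l th g"
    using torus_separates[of i l "deg_wt l w" th] i unfolding x_def by blast
  let ?c = "x g w - chr l th g"
  have "L (\<lambda>d. x g d - chr l th g) - L (\<lambda>d. x g d - x g w) \<in> J"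
    by (rule linop_subgroupD(2)[OF J(1) L_J[OF g(1)] step[OF g(1)]])
  then have "L (\<lambda>_. ?c) \<in> J" by (simp add: diff_L)
  then have "scal (inverse ?c) * L (\<lambda>_. ?c) \<in> J" by (rule J(2))
  then have "L (\<lambda>_. 1) \<in> J" using g(2) by (simp only: scal_L) simp
  then show ?case by (simp only: L_1)
qed

text \<open>For \<open>J = 0\<close> this decomposes a semi-invariant operator into homogeneous ones; for the left ideal
  defining the bimodule it replaces a representative of a semi-invariant coset by a semi-invariant
  operator.\<close>

lemma weight_component:
  assumes J: "linop_subgroup J" "\<And>c P. P \<in> J \<Longrightarrow> scal c * P \<in> J"
      "\<And>g P. g \<in> torus l \<Longrightarrow> P \<in> J \<Longrightarrow> act l g P \<in> J"
    and P: "P \<in> weyl l" "\<And>g. g \<in> torus l \<Longrightarrow> act l g P - scal (chr l th g) * P \<in> J"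
  shows "\<exists>S p. finite S \<and> (\<forall>d\<in>S. weyl_deg l d (p d) \<and> (\<forall>i<l. deg_wt l d i = th i)) \<and> P - sum p S \<in> J"
proof -
  obtain S p where p: "finite S" "\<And>d. weyl_deg l d (p d)" "P = sum p S"
    using weyl_graded_sum[OF P(1)] unfolding graded_sum_def by blast
  define A where "A = {d\<in>S. \<forall>i<l. deg_wt l d i = th i}"
  have sp: "P = sum p A + sum p (S - A)"
    using p(1,3) by (metis (no_types, lifting) A_def add.commute mem_Collect_eq subsetI sum.subset_diff)
  have "sum p (S - A) \<in> J"
  proof (rule other_weights_vanish[OF J])
    fix g assume g: "g \<in> torus l"
    let ?x = "\<lambda>d. chr l (deg_wt l d) g"
    have "chr l (deg_wt l d) g = chr l th g" if "d \<in> A" for d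
      using that by (intro chr_cong) (simp add: A_def)
    then have "(\<Sum>d\<in>A. scal (?x d - chr l th g) * p d) = 0" by simp
    moreover have "act l g P - scal (chr l th g) * P = (\<Sum>d\<in>S. scal (?x d - chr l th g) * p d)"
      unfolding p(3) act_sum sum_distrib_left sum_subtractf[symmetric]
      by (simp add: act_weyl_deg[OF g p(2)] scal_diff left_diff_distrib)
    moreover have "(\<Sum>d\<in>S. scal (?x d - chr l th g) * p d) =
        (\<Sum>d\<in>A. scal (?x d - chr l th g) * p d) + (\<Sum>d\<in>S - A. scal (?x d - chr l th g) * p d)"
      using p(1) by (subst sum.subset_diff[of A]) (auto simp: A_def)
    ultimately show "(\<Sum>d\<in>S - A. scal (?x d - chr l th g) * p d) \<in> J"
      using P(2)[OF g] by simp
  qed (use p A_def in auto)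
  then have "P - sum p A \<in> J" using sp by simp
  then show ?thesis using p(1,2) by (intro exI[of _ A] exI[of _ p]) (simp add: A_def)
qed

lemma wspace_components:
  assumes "P \<in> wspace l th"
  shows "\<exists>S p. finite S \<and> (\<forall>d\<in>S. weyl_deg l d (p d) \<and> (\<forall>i<l. deg_wt l d i = th i)) \<and> P = sum p S"
proof -
  have "\<exists>S p. finite S \<and> (\<forall>d\<in>S. weyl_deg l d (p d) \<and> (\<forall>i<l. deg_wt l d i = th i)) \<and> P - sum p S \<in> {0}"
    using assms by (intro weight_component) (auto simp: wspace_def linop_subgroup_def)
  then show ?thesis by auto
qed

lemma wspace_induct [consumes 1, case_names deg zero add]:
  assumes "P \<in> wspace l th"
    and "\<And>d P. weyl_deg l d P \<Longrightarrow> (\<And>i. i < l \<Longrightarrow> deg_wt l d i = th i) \<Longrightarrow> Q P"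
    and "Q 0" "\<And>P P'. Q P \<Longrightarrow> Q P' \<Longrightarrow> Q (P + P')"
  shows "Q P"
proof -
  obtain S p where p: "finite S" "\<forall>d\<in>S. weyl_deg l d (p d) \<and> (\<forall>i<l. deg_wt l d i = th i)" "P = sum p S"
    using wspace_components[OF assms(1)] by auto
  have "Q (sum p S)" using p(1,2)
    by (induction S rule: finite_induct) (auto intro!: assms(2-))
  then show ?thesis using p(3) by simp
qed

lemma wspace_weyl: "P \<in> wspace l th \<Longrightarrow> P \<in> weyl l"
  by (simp add: wspace_def)

lemma wspace_zero [simp]: "0 \<in> wspace l th"
  by (simp add: wspace_def)

lemma wspace_add: "P \<in> wspace l th \<Longrightarrow> Q \<in> wspace l th \<Longrightarrow> P + Q \<in> wspace l th"
  by (auto simp: wspace_def act_add distrib_left intro: weyl.add)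

lemma wspace_diff: "P \<in> wspace l th \<Longrightarrow> Q \<in> wspace l th \<Longrightarrow> P - Q \<in> wspace l th"
  by (auto simp: wspace_def act_diff right_diff_distrib)

lemma wspace_uminus: "P \<in> wspace l th \<Longrightarrow> - P \<in> wspace l th"
  using wspace_diff[of 0 l th P] by simp

lemma wspace_sum: "(\<And>i. i \<in> A \<Longrightarrow> f i \<in> wspace l th) \<Longrightarrow> sum f A \<in> wspace l th"
  by (induction A rule: infinite_finite_induct) (auto intro: wspace_add)

lemma wspace_mult:
  assumes "P \<in> wspace l a" "Q \<in> wspace l b" shows "P * Q \<in> wspace l (a + b)"
  using assms by (auto simp: wspace_def act_mult chr_add scal_mult_mult intro: weyl.mult)

lemma wspace_scal [simp]: "scal c \<in> wspace l 0"
  by (auto simp: wspace_def act_scal intro: weyl.scal)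

lemma wspace_one [simp]: "1 \<in> wspace l 0"
  using wspace_scal[of 1 l] by simp

lemma wspace_euler [simp]: "i < l \<Longrightarrow> euler i \<in> wspace l 0"
  by (rule weyl_deg_wspace[OF weyl_deg_euler]) (auto simp: deg_wt_def)

lemma wspace_iota [simp]: "i < l \<Longrightarrow> iota l i \<in> wspace l 0"
  by (simp add: iota_euler wspace_diff)

text \<open>The \<open>\<iota>\<^sub>i\<close> generate the torus action infinitesimally, so commuting with them measures the weight.\<close>

lemma iota_wspace:
  assumes "P \<in> wspace l th" "i < l"
  shows "iota l i * P = P * (iota l i + scal (of_int (th i)))"
  using assms(1)
proof (induction rule: wspace_induct)
  case (deg d P)
  have "iota l i * P = P * (euler (csucc l i) + scal (of_int (d (csucc l i)))) -
      P * (euler i + scal (of_int (d i)))"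
    unfolding iota_euler left_diff_distrib by (simp only: euler_weyl_deg[OF deg(1)])
  also have "\<dots> = P * (iota l i + scal (of_int (deg_wt l d i)))"
    unfolding iota_euler deg_wt_def of_int_diff scal_diff by (simp only: right_diff_distrib distrib_left) simp
  finally show ?case using deg(2)[OF assms(2)] by simp
qed (simp_all add: distrib_left distrib_right)

section \<open>Normal forms modulo Euler eigenvalues\<close>

text \<open>A negative exponent stands for a power of the derivative, so that \<open>nmon l d\<close> is the
  operator of least order in degree \<open>d\<close>.\<close>

definition tpow :: "nat \<Rightarrow> int \<Rightarrow> linop" where
  "tpow i d = (if d \<ge> 0 then tvar i ^ nat d else pdiff i ^ nat (- d))"

definition nmon :: "nat \<Rightarrow> (nat \<Rightarrow> int) \<Rightarrow> linop" where
  "nmon l d = prod_list (map (\<lambda>i. tpow i (d i)) [0..<l])"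

lemma power_commute_left: "a * x = x * a \<Longrightarrow> a * x ^ n = x ^ n * (a::linop)"
  by (metis power_commuting_commutes)

lemma tpow_commute:
  "i \<noteq> j \<Longrightarrow> tvar i * tpow j d = tpow j d * tvar i"
  "i \<noteq> j \<Longrightarrow> pdiff i * tpow j d = tpow j d * pdiff i"
  unfolding tpow_def
  by (auto intro!: power_commute_left simp: tvar_commute pdiff_commute[of i j] pdiff_tvar)

lemma euler_tpow_commute: "i \<noteq> j \<Longrightarrow> euler i * tpow j d = tpow j d * euler i"
  unfolding euler_def by (metis mult.assoc tpow_commute)

lemma weyl_deg_tvar_power: "i < l \<Longrightarrow> weyl_deg l (\<lambda>j. of_nat n * unit_deg i j) (tvar i ^ n)"
proof (induction n)
  case 0
  have "weyl_deg l 0 (tvar i ^ 0)" by (simp add: weyl_deg_one)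
  then show ?case by (rule weyl_deg_cong) simp
next
  case (Suc n)
  then have "weyl_deg l (unit_deg i + (\<lambda>j. of_nat n * unit_deg i j)) (tvar i * tvar i ^ n)"
    by (intro weyl_deg.mult weyl_deg.tvar) auto
  then show ?case by (simp add: algebra_simps plus_fun_def)
qed

lemma weyl_deg_pdiff_power: "i < l \<Longrightarrow> weyl_deg l (\<lambda>j. - of_nat n * unit_deg i j) (pdiff i ^ n)"
proof (induction n)
  case 0
  have "weyl_deg l 0 (pdiff i ^ 0)" by (simp add: weyl_deg_one)
  then show ?case by (rule weyl_deg_cong) simp
next
  case (Suc n)
  then have "weyl_deg l (- unit_deg i + (\<lambda>j. - of_nat n * unit_deg i j)) (pdiff i * pdiff i ^ n)"
    by (intro weyl_deg.mult weyl_deg.pdiff) auto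
  then show ?case by (simp add: algebra_simps plus_fun_def)
qed

lemma weyl_deg_tpow: "i < l \<Longrightarrow> weyl_deg l (\<lambda>j. d * unit_deg i j) (tpow i d)"
  using weyl_deg_tvar_power[of i l "nat d"] weyl_deg_pdiff_power[of i l "nat (- d)"]
  by (auto simp: tpow_def)

lemma weyl_deg_prod_list:
  "(\<And>x. x \<in> set xs \<Longrightarrow> weyl_deg l (d x) (f x)) \<Longrightarrow>
    weyl_deg l (\<lambda>j. \<Sum>x\<leftarrow>xs. d x j) (prod_list (map f xs))"
proof (induction xs)
  case Nil
  have "weyl_deg l 0 (prod_list (map f []))" by (simp add: weyl_deg_one)
  then show ?case by (rule weyl_deg_cong) simp
next
  case (Cons x xs)
  then show ?case using weyl_deg.mult[of l "d x" "f x" "\<lambda>j. \<Sum>x\<leftarrow>xs. d x j" "prod_list (map f xs)"]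
    by (simp add: plus_fun_def)
qed

lemma weyl_deg_nmon:
  assumes "\<And>i. i \<ge> l \<Longrightarrow> d i = 0" shows "weyl_deg l d (nmon l d)"
proof -
  have "weyl_deg l (\<lambda>j. \<Sum>i\<leftarrow>[0..<l]. d i * unit_deg i j) (nmon l d)"
    unfolding nmon_def by (rule weyl_deg_prod_list) (simp add: weyl_deg_tpow)
  moreover have "(\<lambda>j. \<Sum>i\<leftarrow>[0..<l]. d i * unit_deg i j) = d"
  proof
    fix j
    have "(\<Sum>i\<leftarrow>[0..<l]. d i * unit_deg i j) = (\<Sum>i\<in>{0..<l}. if i = j then d j else 0)"
      unfolding sum_list_distinct_conv_sum_set[OF distinct_upt] set_upt
      by (rule sum.cong) (auto simp: unit_deg_def)
    then show "(\<Sum>i\<leftarrow>[0..<l]. d i * unit_deg i j) = d j"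
      using assms[of j] by (cases "j < l") (simp_all add: sum.delta)
  qed
  ultimately show ?thesis by simp
qed

lemma euler_tpow: "euler i * tpow i d = tpow i d * (euler i + scal (of_int d))"
  using euler_weyl_deg[OF weyl_deg_tpow[of i "Suc i" d], of i] by (simp add: unit_deg_def)

lemma tvar_tpow:
  "tvar i * tpow i d = tpow i (d + 1) * (if d \<ge> 0 then 1 else euler i + scal (of_int (d + 1)))"
proof (cases "d \<ge> 0")
  case True
  then have "nat (d + 1) = Suc (nat d)" by simp
  with True show ?thesis by (simp add: tpow_def)
next
  case False
  then have "nat (- d) = Suc (nat (- (d + 1)))" by simp
  then have "tvar i * tpow i d = euler i * pdiff i ^ nat (- (d + 1))"
    using False by (simp only: tpow_def if_False power_Suc euler_def mult.assoc)
  also have "pdiff i ^ nat (- (d + 1)) = tpow i (d + 1)"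
    using False by (auto simp: tpow_def)
  finally show ?thesis using False by (simp add: euler_tpow)
qed

lemma pdiff_tpow:
  "pdiff i * tpow i d = tpow i (d - 1) * (if d \<le> 0 then 1 else euler i + scal (of_int d))"
proof (cases "d \<le> 0")
  case True
  then have *: "nat (- (d - 1)) = Suc (nat (- d))" by simp
  show ?thesis
  proof (cases "d = 0")
    case False
    then show ?thesis using True * by (simp add: tpow_def)
  qed (simp add: tpow_def)
next
  case False
  then have "nat d = Suc (nat (d - 1))" by simp
  then have "pdiff i * tpow i d = pdiff i * tvar i * tpow i (d - 1)"
    using False by (simp add: tpow_def mult.assoc)
  also have "\<dots> = (euler i + 1) * tpow i (d - 1)"
    using pdiff_tvar[of i i] by (simp add: euler_def)
  also have "\<dots> = tpow i (d - 1) * (euler i + scal (of_int (d - 1)) + 1)"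
    by (simp add: distrib_left distrib_right euler_tpow)
  also have "euler i + scal (of_int (d - 1)) + 1 = euler i + scal (of_int d)"
    by (simp add: scal_diff)
  finally show ?thesis using False by simp
qed

lemma tpow_pdiff: "tpow i d * pdiff i = tpow i (d - 1) * (if d \<le> 0 then 1 else euler i)"
proof (cases "d \<le> 0")
  case True
  then show ?thesis using tpow_def pdiff_tpow[of i d]
    by (auto simp: tpow_def power_commutes)
next
  case False
  then have "nat d = Suc (nat (d - 1))" by simp
  then show ?thesis using False
    by (simp add: tpow_def euler_def power_Suc2 mult.assoc del: power_Suc)
qed

lemma prod_list_commute: "(\<And>x. x \<in> set xs \<Longrightarrow> a * x = x * a) \<Longrightarrow> a * prod_list xs = prod_list xs * (a::linop)"
proof (induction xs)
  case (Cons x xs)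
  then have "a * x = x * a" "a * prod_list xs = prod_list xs * a" by auto
  then show ?case by (metis mult.assoc prod_list.Cons)
qed simp

lemma prod_list_split:
  "i < l \<Longrightarrow> prod_list (map f [0..<l]) =
    prod_list (map f [0..<i]) * (f i :: linop) * prod_list (map f [Suc i..<l])"
  using upt_add_eq_append[of 0 i "l - i"] by (simp add: upt_conv_Cons mult.assoc)

text \<open>An operator that commutes with all factors but the \<open>i\<close>-th can be absorbed there. What it
  leaves behind, \<open>c\<close>, commutes with the remaining factors and is moved to the far right, where in
  the applications it is an Euler operator that meets its eigenvector.\<close>

lemma prod_list_replace_factor:
  fixes f f' :: "nat \<Rightarrow> linop"
  assumes i: "i < l" and eq: "\<And>j. j < l \<Longrightarrow> j \<noteq> i \<Longrightarrow> f' j = f j"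
    and c: "\<And>j. j < l \<Longrightarrow> j \<noteq> i \<Longrightarrow> c * f j = f j * c"
    and a: "\<And>j. j < l \<Longrightarrow> j \<noteq> i \<Longrightarrow> a * f j = f j * a"
  shows "a * f i = f' i * c \<Longrightarrow> a * prod_list (map f [0..<l]) = prod_list (map f' [0..<l]) * c"
    and "f i * a = f' i * c \<Longrightarrow> prod_list (map f [0..<l]) * a = prod_list (map f' [0..<l]) * c"
proof -
  let ?L = "prod_list (map f [0..<i])" and ?R = "prod_list (map f [Suc i..<l])"
  have L: "prod_list (map f' [0..<i]) = ?L" and R: "prod_list (map f' [Suc i..<l]) = ?R"
    using eq i by (auto intro!: arg_cong[of _ _ prod_list])
  have aL: "a * ?L = ?L * a" and aR: "a * ?R = ?R * a" and cR: "c * ?R = ?R * c"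
    using a c i by (auto intro!: prod_list_commute)
  show "a * prod_list (map f [0..<l]) = prod_list (map f' [0..<l]) * c" if "a * f i = f' i * c"
  proof -
    have "a * (?L * f i * ?R) = ?L * (a * f i) * ?R"
      by (simp only: aL mult.assoc[symmetric])
    also have "\<dots> = ?L * f' i * ?R * c"
      by (simp only: that mult.assoc cR)
    finally show ?thesis by (simp only: prod_list_split[OF i, of f] prod_list_split[OF i, of f'] L R)
  qed
  show "prod_list (map f [0..<l]) * a = prod_list (map f' [0..<l]) * c" if "f i * a = f' i * c"
  proof -
    have "?L * f i * ?R * a = ?L * (f i * a) * ?R"
      by (simp only: aR mult.assoc)
    also have "\<dots> = ?L * f' i * ?R * c"
      by (simp only: that mult.assoc cR)
    finally show ?thesis by (simp only: prod_list_split[OF i, of f] prod_list_split[OF i, of f'] L R)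
  qed
qed

lemma tvar_nmon:
  assumes "i < l"
  shows "tvar i * nmon l d = nmon l (unit_deg i + d) *
    (if d i \<ge> 0 then 1 else euler i + scal (of_int (d i + 1)))"
  unfolding nmon_def
  by (rule prod_list_replace_factor(1)[OF assms])
    (auto simp: tvar_tpow unit_deg_def tpow_commute distrib_left distrib_right euler_tpow_commute
       scal_commute[symmetric] add.commute)

lemma pdiff_nmon:
  assumes "i < l"
  shows "pdiff i * nmon l d = nmon l (- unit_deg i + d) *
    (if d i \<le> 0 then 1 else euler i + scal (of_int (d i)))"
  unfolding nmon_def
  by (rule prod_list_replace_factor(1)[OF assms])
    (auto simp: pdiff_tpow unit_deg_def tpow_commute distrib_left distrib_right euler_tpow_commute
       scal_commute[symmetric])

lemma nmon_pdiff:
  assumes "i < l"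
  shows "nmon l d * pdiff i = nmon l (d - unit_deg i) * (if d i \<le> 0 then 1 else euler i)"
  unfolding nmon_def
  by (rule prod_list_replace_factor(2)[OF assms])
    (auto simp: tpow_pdiff unit_deg_def tpow_commute euler_tpow_commute)

text \<open>The degree-\<open>d\<close> part of the left ideal \<open>\<Sum>\<^sub>i D(t\<^sub>i\<partial>\<^sub>i - \<nu>\<^sub>i)\<close>. The coefficients are kept
  homogeneous so that membership survives the passage to semi-invariants.\<close>

inductive eig :: "nat \<Rightarrow> (nat \<Rightarrow> real) \<Rightarrow> (nat \<Rightarrow> int) \<Rightarrow> linop \<Rightarrow> bool" for l nu d where
  zero: "eig l nu d 0"
| gen: "i < l \<Longrightarrow> weyl_deg l d r \<Longrightarrow> eig l nu d (r * (euler i - scal (of_real (nu i))))"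
| add: "eig l nu d P \<Longrightarrow> eig l nu d Q \<Longrightarrow> eig l nu d (P + Q)"

lemma eig_mult: "eig l nu d P \<Longrightarrow> weyl_deg l e Q \<Longrightarrow> eig l nu (e + d) (Q * P)"
  by (induction rule: eig.induct)
    (auto simp: distrib_left mult.assoc[symmetric] intro: eig.intros weyl_deg.mult)

lemma eig_scal: "eig l nu d P \<Longrightarrow> eig l nu d (scal c * P)"
  using eig_mult[OF _ weyl_deg.scal, of l nu d P c] by simp

lemma eig_diff: "eig l nu d P \<Longrightarrow> eig l nu d Q \<Longrightarrow> eig l nu d (P - Q)"
  using eig.add[OF _ eig_scal[of l nu d Q "-1"], of P] by (simp add: scal_minus)

lemma eig_weyl_deg: "eig l nu d P \<Longrightarrow> weyl_deg l d P"
proof (induction rule: eig.induct)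
  case (gen i r)
  have "weyl_deg l 0 (euler i - scal (of_real (nu i)))"
    using gen by (intro weyl_deg_diff weyl_deg_euler weyl_deg.scal)
  from weyl_deg.mult[OF gen(2) this] show ?case by simp
qed (auto intro: weyl_deg.intros)

lemma eig_euler_factor:
  assumes "i < l" "weyl_deg l d u"
  shows "eig l nu d (u * (euler i + scal c) - scal (of_real (nu i) + c) * u)"
proof -
  have "u * (euler i + scal c) - scal (of_real (nu i) + c) * u = u * (euler i - scal (of_real (nu i)))"
    by (simp add: scal_add algebra_simps scal_commute[of _ u])
  then show ?thesis using eig.gen[OF assms, of nu] by simp
qed

text \<open>Multiplication by a generator carries the normal form of one degree to that of a neighbouring
  degree, up to an Euler operator on the right, which is replaced by its eigenvalue.\<close>

lemma normal_form_step:
  assumes "weyl_deg l d P" "\<And>i. i \<ge> l \<Longrightarrow> e i = 0"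
  shows "\<exists>\<alpha>. eig l nu (d + e) (P * nmon l e - scal \<alpha> * nmon l (d + e))"
  using assms
proof (induction arbitrary: e rule: weyl_deg.induct)
  case (zero d)
  show ?case by (rule exI[of _ 0]) (simp add: eig.zero)
next
  case (scal c)
  show ?case by (rule exI[of _ c]) (simp add: eig.zero)
next
  case (tvar i)
  have u: "weyl_deg l (unit_deg i + e) (nmon l (unit_deg i + e))"
    using tvar by (intro weyl_deg_nmon) (auto simp: unit_deg_def)
  show ?case
  proof (cases "e i \<ge> 0")
    case True
    then show ?thesis unfolding tvar_nmon[OF tvar(1), of e]
      by (intro exI[of _ 1]) (simp only: if_True scal_1 mult_1 mult_1_right diff_self eig.zero)
  next
    case False
    show ?thesis unfolding tvar_nmon[OF tvar(1), of e] if_not_P[OF False]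
      by (intro exI) (rule eig_euler_factor[OF tvar(1) u])
  qed
next
  case (pdiff i)
  have u: "weyl_deg l (- unit_deg i + e) (nmon l (- unit_deg i + e))"
    using pdiff by (intro weyl_deg_nmon) (auto simp: unit_deg_def)
  show ?case
  proof (cases "e i \<le> 0")
    case True
    then show ?thesis unfolding pdiff_nmon[OF pdiff(1), of e]
      by (intro exI[of _ 1]) (simp only: if_True scal_1 mult_1 mult_1_right diff_self eig.zero)
  next
    case False
    show ?thesis unfolding pdiff_nmon[OF pdiff(1), of e] if_not_P[OF False]
      by (intro exI) (rule eig_euler_factor[OF pdiff(1) u])
  qed
next
  case (add d P Q)
  obtain a b where "eig l nu (d + e) (P * nmon l e - scal a * nmon l (d + e))"
    "eig l nu (d + e) (Q * nmon l e - scal b * nmon l (d + e))"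
    using add by meson
  from eig.add[OF this] show ?case
    by (intro exI[of _ "a + b"])
      (simp only: scal_add distrib_right diff_add_eq add_diff_eq diff_diff_eq add_ac diff_diff_eq2)
next
  case (mult d P d' Q)
  show ?case
  proof (cases "Q = 0")
    case True
    then show ?thesis by (intro exI[of _ 0]) (simp add: eig.zero)
  next
    case False
    then have "\<forall>i\<ge>l. (d' + e) i = 0"
      using weyl_deg_supp[OF mult(2)] mult.prems by simp
    then obtain a b where ab: "eig l nu (d' + e) (Q * nmon l e - scal a * nmon l (d' + e))"
      "eig l nu (d + (d' + e)) (P * nmon l (d' + e) - scal b * nmon l (d + (d' + e)))"
      using mult.IH(2)[OF mult.prems] mult.IH(1)[of "d' + e"] by meson
    have "P * (Q * nmon l e - scal a * nmon l (d' + e)) +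
        scal a * (P * nmon l (d' + e) - scal b * nmon l (d + (d' + e))) =
        P * Q * nmon l e - scal (a * b) * nmon l (d + d' + e)"
      by (simp only: right_diff_distrib scal_left_commute[of P] mult.assoc scal_mult[symmetric] add.assoc)
         (simp only: add_diff_eq diff_add_cancel)
    with eig.add[OF eig_mult[OF ab(1) mult(1)] eig_scal[OF ab(2), of a]] show ?thesis
      by (metis add.assoc)
  qed
qed

text \<open>Modulo Euler eigenvalues each graded piece of \<open>D\<close> is at most one-dimensional.\<close>

lemma normal_form:
  assumes "weyl_deg l d P"
  shows "\<exists>\<alpha>. eig l nu d (P - scal \<alpha> * nmon l d)"
proof -
  have "nmon l 0 = 1"
    unfolding nmon_def by (induction l) (simp_all add: tpow_def)
  then show ?thesis using normal_form_step[OF assms, of 0 nu] by (simp only: add_0_right mult_1_right) simp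
qed

definition tprod :: "nat \<Rightarrow> linop" where "tprod l = prod_list (map tvar [0..<l])"
definition pdprod :: "nat \<Rightarrow> linop" where "pdprod l = prod_list (map pdiff [0..<l])"
definition one_deg :: "nat \<Rightarrow> nat \<Rightarrow> int" where "one_deg l i = (if i < l then 1 else 0)"

lemma one_deg_Suc: "one_deg (Suc n) = one_deg n + unit_deg n"
  by (auto simp: one_deg_def unit_deg_def fun_eq_iff)

lemma weyl_deg_tprod_le: "n \<le> l \<Longrightarrow> weyl_deg l (one_deg n) (tprod n)"
proof (induction n)
  case 0
  have "weyl_deg l 0 (tprod 0)" by (simp add: tprod_def weyl_deg_one)
  then show ?case by (rule weyl_deg_cong) (simp add: one_deg_def)
next
  case (Suc n)
  then have "weyl_deg l (one_deg n + unit_deg n) (tprod n * tvar n)"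
    by (intro weyl_deg.mult weyl_deg.tvar) auto
  then have "weyl_deg l (one_deg n + unit_deg n) (tprod (Suc n))" by (simp add: tprod_def)
  then show ?case by (rule weyl_deg_cong) (simp add: one_deg_Suc)
qed

lemma weyl_deg_tprod: "weyl_deg l (one_deg l) (tprod l)"
  by (rule weyl_deg_tprod_le) simp

lemma weyl_deg_pdprod_le: "n \<le> l \<Longrightarrow> weyl_deg l (- one_deg n) (pdprod n)"
proof (induction n)
  case 0
  have "weyl_deg l 0 (pdprod 0)" by (simp add: pdprod_def weyl_deg_one)
  then show ?case by (rule weyl_deg_cong) (simp add: one_deg_def)
next
  case (Suc n)
  have "weyl_deg l (- one_deg n + - unit_deg n) (pdprod n * pdiff n)"
    using Suc by (intro weyl_deg.mult weyl_deg.pdiff) (assumption | rule Suc.IH | simp only: Suc_le_eq less_imp_le)+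
  then have "weyl_deg l (- one_deg n + - unit_deg n) (pdprod (Suc n))" by (simp add: pdprod_def)
  then show ?case by (rule weyl_deg_cong) (simp add: one_deg_Suc)
qed

lemma weyl_deg_pdprod: "weyl_deg l (- one_deg l) (pdprod l)"
  by (rule weyl_deg_pdprod_le) simp

definition euler_prod :: "(nat \<Rightarrow> int) \<Rightarrow> nat \<Rightarrow> linop" where
  "euler_prod d n = prod_list (map (\<lambda>i. if d i \<ge> 0 then euler i else 1) [0..<n])"

lemma euler_pdiff_commute: "i \<noteq> j \<Longrightarrow> euler i * pdiff j = pdiff j * euler i"
  by (simp add: euler_pdiff)

lemma euler_commute: "euler i * euler j = euler j * euler i"
  using euler_weyl_deg[OF weyl_deg_euler[of j "Suc j"], of i] by simp

text \<open>Each \<open>\<partial>\<^sub>i\<close> lowers the exponent \<open>d\<^sub>i + 1\<close> to \<open>d\<^sub>i\<close>. It meets a \<open>t\<^sub>i\<close>, and leaves an Euler operator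
  behind, exactly when \<open>d\<^sub>i \<ge> 0\<close>.\<close>

lemma nmon_pdprod_le:
  "n \<le> l \<Longrightarrow> nmon l (d + one_deg l) * pdprod n = nmon l (d + one_deg l - one_deg n) * euler_prod d n"
proof (induction n)
  case 0
  have "d + one_deg l - one_deg 0 = d + one_deg l" by (auto simp: one_deg_def)
  then show ?case by (simp add: pdprod_def euler_prod_def)
next
  case (Suc n)
  let ?d = "d + one_deg l - one_deg n" and ?c = "if d n \<ge> 0 then euler n else 1"
  have n: "n < l" using Suc by simp
  then have dn: "?d n = d n + 1" by (simp add: one_deg_def)
  have d': "?d - unit_deg n = d + one_deg l - one_deg (Suc n)" by (auto simp: one_deg_Suc)
  have "euler_prod d n * pdiff n = pdiff n * euler_prod d n"
    unfolding euler_prod_def by (rule prod_list_commute[symmetric]) (auto simp: euler_pdiff_commute)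
  moreover have "?c * euler_prod d n = euler_prod d n * ?c"
    unfolding euler_prod_def
    by (rule prod_list_commute) (auto simp: euler_commute)
  moreover have "nmon l ?d * pdiff n = nmon l (?d - unit_deg n) * ?c"
    unfolding nmon_pdiff[OF n, of ?d] dn by simp
  ultimately have "nmon l ?d * euler_prod d n * pdiff n = nmon l (?d - unit_deg n) * (euler_prod d n * ?c)"
    by (metis mult.assoc)
  moreover have "pdprod (Suc n) = pdprod n * pdiff n" "euler_prod d (Suc n) = euler_prod d n * ?c"
    by (simp_all add: pdprod_def euler_prod_def)
  moreover have "nmon l (d + one_deg l) * pdprod n = nmon l ?d * euler_prod d n"
    by (rule Suc.IH) (use n in simp)
  ultimately show ?case unfolding d' by (metis mult.assoc)
qed

lemma nmon_pdprod: "nmon l (d + one_deg l) * pdprod l = nmon l d * euler_prod d l"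
proof -
  have "d + one_deg l - one_deg l = d" by auto
  then show ?thesis using nmon_pdprod_le[of l l d] by simp
qed

lemma eig_euler_prod:
  assumes "weyl_deg l d u" "n \<le> l"
  shows "eig l nu d (u * euler_prod e n - scal (\<Prod>i<n. if e i \<ge> 0 then of_real (nu i) else 1) * u)"
  using assms(2)
proof (induction n)
  case 0
  then show ?case by (simp add: euler_prod_def eig.zero)
next
  case (Suc n)
  let ?g = "\<Prod>i<n. if e i \<ge> 0 then of_real (nu i) else 1"
  have IH: "eig l nu d (u * euler_prod e n - scal ?g * u)" using Suc by simp
  show ?case
  proof (cases "e n \<ge> 0")
    case True
    have "weyl_deg l d (u * euler_prod e n)"
      using weyl_deg.add[OF eig_weyl_deg[OF IH] weyl_deg_scal_mult[OF assms(1), of ?g]] by simp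
    then have f: "eig l nu d (u * euler_prod e n * (euler n - scal (of_real (nu n))))"
      using Suc by (intro eig.gen) auto
    have e: "euler_prod e (Suc n) = euler_prod e n * euler n"
      using True by (simp add: euler_prod_def)
    have g: "(\<Prod>i<Suc n. if e i \<ge> 0 then of_real (nu i) else 1) = (of_real (nu n) :: complex) * ?g"
      using True by (simp add: mult.commute)
    have *: "X * (E - scal a) + scal a * (X - scal b * u) = X * E - scal (a * b) * u" for X E a b
    proof -
      have "X * scal a = scal a * X" by (rule scal_commute[symmetric])
      then show ?thesis by (simp add: right_diff_distrib scal_mult flip: mult.assoc)
    qed
    show ?thesis
      using eig.add[OF f eig_scal[OF IH, of "of_real (nu n)"]] unfolding e g *[of "u * euler_prod e n" "euler n"] by (simp only: mult.assoc)
  next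
    case False
    then show ?thesis using IH by (simp add: euler_prod_def)
  qed
qed

section \<open>Monomials with real exponents\<close>

text \<open>Polynomial functions of the first \<open>l\<close> coordinates, in a form that makes closure under
  translations evident: hence the constant in \<open>coord\<close>.\<close>

inductive polyfun :: "nat \<Rightarrow> ((nat \<Rightarrow> real) \<Rightarrow> complex) \<Rightarrow> bool" for l where
  const: "polyfun l (\<lambda>x. c)"
| coord: "i < l \<Longrightarrow> polyfun l (\<lambda>x. of_real (x i) + c)"
| add: "polyfun l p \<Longrightarrow> polyfun l q \<Longrightarrow> polyfun l (\<lambda>x. p x + q x)"
| mult: "polyfun l p \<Longrightarrow> polyfun l q \<Longrightarrow> polyfun l (\<lambda>x. p x * q x)"

lemma polyfun_shift: "polyfun l p \<Longrightarrow> polyfun l (\<lambda>x. p (\<lambda>i. x i + real_of_int (d i)))"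
proof (induction rule: polyfun.induct)
  case (coord i c)
  from polyfun.coord[OF this, of "of_int (d i) + c"] show ?case by (simp add: add.assoc)
qed (auto intro: polyfun.intros)

lemma polyfun_line:
  "polyfun l p \<Longrightarrow> \<exists>P. \<forall>y::real. p (x(i := y)) = poly P (of_real y)"
proof (induction rule: polyfun.induct)
  case (const c)
  show ?case by (rule exI[of _ "[:c:]"]) simp
next
  case (coord j c)
  show ?case
  proof (cases "j = i")
    case True
    then show ?thesis by (intro exI[of _ "[:c, 1:]"]) simp
  next
    case False
    then show ?thesis by (intro exI[of _ "[:of_real (x j) + c:]"]) simp
  qed
next
  case (add p q)
  then obtain P Q where "\<forall>y. p (x(i := y)) = poly P (of_real y)" "\<forall>y. q (x(i := y)) = poly Q (of_real y)"
    by blast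
  then show ?case by (intro exI[of _ "P + Q"]) (simp only: poly_add simp_thms)
next
  case (mult p q)
  then obtain P Q where "\<forall>y. p (x(i := y)) = poly P (of_real y)" "\<forall>y. q (x(i := y)) = poly Q (of_real y)"
    by blast
  then show ?case by (intro exI[of _ "P * Q"]) (simp only: poly_mult simp_thms)
qed

lemma polyfun_zero_line:
  assumes "polyfun l p" "\<And>n. p (x(i := real n)) = 0" shows "p (x(i := y)) = 0"
proof -
  obtain P where P: "\<And>y. p (x(i := y)) = poly P (of_real y)"
    using polyfun_line[OF assms(1)] by meson
  have "range (of_nat :: nat \<Rightarrow> complex) \<subseteq> {z. poly P z = 0}"
  proof clarify
    fix n show "poly P (of_nat n) = 0" using P[of "real n"] assms(2)[of n] by simp
  qed
  moreover have "infinite (range (of_nat :: nat \<Rightarrow> complex))"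
    by (rule range_inj_infinite) (simp add: inj_on_def)
  ultimately have "P = 0"
    using poly_roots_finite[of P] finite_subset by blast
  then show ?thesis by (simp add: P)
qed

definition nat_vec :: "(nat \<Rightarrow>\<^sub>0 nat) \<Rightarrow> nat \<Rightarrow> real" where
  "nat_vec a i = real (Poly_Mapping.lookup a i)"

lemma nat_vec_inj: "nat_vec a = nat_vec b \<longleftrightarrow> a = b"
  by (auto simp: nat_vec_def fun_eq_iff intro!: poly_mapping_eqI)

lemma nat_vec_surj:
  assumes "\<And>i. i < l \<Longrightarrow> \<exists>n. x i = real n" "\<And>i. i \<ge> l \<Longrightarrow> x i = 0"
  shows "\<exists>a. x = nat_vec a"
proof -
  have "finite {i. nat \<lfloor>x i\<rfloor> \<noteq> 0}"
    by (rule finite_subset[of _ "{..<l}"]) (use assms(2) in \<open>force simp: not_less[symmetric]\<close>, simp)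
  then have "Poly_Mapping.lookup (Abs_poly_mapping (\<lambda>i. nat \<lfloor>x i\<rfloor>)) = (\<lambda>i. nat \<lfloor>x i\<rfloor>)"
    by (intro lookup_Abs_poly_mapping) simp
  moreover have "x i = real (nat \<lfloor>x i\<rfloor>)" for i
    using assms[of i] by (cases "i < l") auto
  ultimately show ?thesis
    by (intro exI[of _ "Abs_poly_mapping (\<lambda>i. nat \<lfloor>x i\<rfloor>)"]) (auto simp: nat_vec_def fun_eq_iff)
qed

lemma polyfun_cong: "polyfun l p \<Longrightarrow> (\<And>i. i < l \<Longrightarrow> x i = y i) \<Longrightarrow> p x = p y"
  by (induction rule: polyfun.induct) auto

text \<open>The natural vectors are Zariski dense. The coordinates are freed from the restriction to natural
  values one at a time, since a polynomial in one variable has finitely many roots.\<close>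

lemma polyfun_eq_0:
  assumes p: "polyfun l p" and 0: "\<And>a. p (nat_vec a) = 0"
  shows "p x = 0"
proof -
  have "m \<le> l \<Longrightarrow> (\<And>i. m \<le> i \<Longrightarrow> i < l \<Longrightarrow> \<exists>n. x i = real n) \<Longrightarrow> (\<And>i. i \<ge> l \<Longrightarrow> x i = 0) \<Longrightarrow> p x = 0" for m x
  proof (induction m arbitrary: x)
    case 0
    then show ?case using nat_vec_surj[of l x] assms(2) by auto
  next
    case (Suc m)
    have "p (x(m := real n)) = 0" for n
      using Suc.prems by (intro Suc.IH) (auto simp: not_less_eq_eq le_Suc_eq)
    from polyfun_zero_line[OF p this, of "x m"] show ?case by simp
  qed
  from this[of l "\<lambda>i. if i < l then x i else 0"]
  have "p (\<lambda>i. if i < l then x i else 0) = 0" by simp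
  then show ?thesis using polyfun_cong[OF p, of x "\<lambda>i. if i < l then x i else 0"] by simp
qed

text \<open>A formal combination \<open>\<Sum>\<^sub>x f\<^sub>x t\<^sup>x\<close> of monomials with real exponents is given by its
  coefficient function \<open>f\<close>.\<close>

type_synonym rmon = "(nat \<Rightarrow> real) \<Rightarrow> complex"

definition tmon :: "(nat \<Rightarrow> real) \<Rightarrow> rmon" where
  "tmon x = (\<lambda>y. if y = x then 1 else 0)"

definition smul :: "complex \<Rightarrow> rmon \<Rightarrow> rmon" where
  "smul c f = (\<lambda>x. c * f x)"

definition shift :: "(nat \<Rightarrow> int) \<Rightarrow> (nat \<Rightarrow> real) \<Rightarrow> nat \<Rightarrow> real" where
  "shift d x = (\<lambda>i. x i + of_int (d i))"

lemma shift_shift: "shift d (shift e x) = shift (d + e) x"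
  by (auto simp: shift_def)

lemma shift_0 [simp]: "shift 0 x = x"
  by (auto simp: shift_def)

lemma shift_inverse [simp]: "shift (- d) (shift d x) = x" "shift d (shift (- d) x) = x"
  by (auto simp: shift_def)

lemma shift_eq_iff: "shift (- d) y = x \<longleftrightarrow> y = shift d x"
  by (metis shift_inverse)

text \<open>An operator on polynomials together with its extension to real exponents, word by word in the
  generators. The shifts go in the opposite direction because the functions are coefficients:
  the coefficient of \<open>t\<^sup>x\<close> in \<open>t\<^sub>i f\<close> is the coefficient of \<open>t\<^sup>x / t\<^sub>i\<close> in \<open>f\<close>.\<close>

inductive diffop :: "nat \<Rightarrow> linop \<Rightarrow> (rmon \<Rightarrow> rmon) \<Rightarrow> bool" for l where
  scal: "diffop l (scal c) (smul c)"
| tvar: "i < l \<Longrightarrow> diffop l (tvar i) (\<lambda>f x. f (shift (- unit_deg i) x))"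
| pdiff: "i < l \<Longrightarrow> diffop l (pdiff i) (\<lambda>f x. of_real (x i + 1) * f (shift (unit_deg i) x))"
| add: "diffop l P F \<Longrightarrow> diffop l Q G \<Longrightarrow> diffop l (P + Q) (\<lambda>f x. F f x + G f x)"
| mult: "diffop l P F \<Longrightarrow> diffop l Q G \<Longrightarrow> diffop l (P * Q) (\<lambda>f. F (G f))"

text \<open>Polynomials are the finitely supported coefficient functions on natural vectors; the value is
  zero elsewhere, so that the embedding commutes with \<open>t\<^sub>i\<close> and \<open>\<partial>\<^sub>i\<close>.\<close>

definition of_cpoly :: "cpoly \<Rightarrow> rmon" where
  "of_cpoly p x = (if x \<in> range nat_vec then Poly_Mapping.lookup p (the_inv nat_vec x) else 0)"

lemma of_cpoly_nat_vec [simp]: "of_cpoly p (nat_vec a) = Poly_Mapping.lookup p a"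
proof -
  have "inj nat_vec" by (simp add: inj_on_def nat_vec_inj)
  then show ?thesis by (simp add: of_cpoly_def the_inv_f_f)
qed

lemma of_cpoly_0: "x \<notin> range nat_vec \<Longrightarrow> of_cpoly p x = 0"
  by (simp add: of_cpoly_def)

lemma nat_vec_add_single: "nat_vec (a + Poly_Mapping.single i 1) = shift (unit_deg i) (nat_vec a)"
  by (auto simp: nat_vec_def shift_def unit_deg_def lookup_add lookup_single when_def fun_eq_iff)

text \<open>The only step from outside into the natural vectors starts at \<open>x\<^sub>i = -1\<close>, where the factor
  \<open>x\<^sub>i + 1\<close> of the derivative vanishes.\<close>

lemma nat_vec_shift_unit:
  assumes "shift (unit_deg i) x \<in> range nat_vec" "x i \<noteq> - 1"
  shows "x \<in> range nat_vec"
proof -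
  obtain a where a: "shift (unit_deg i) x = nat_vec a" using assms(1) by auto
  have "x i + 1 = real (Poly_Mapping.lookup a i)"
    using fun_cong[OF a, of i] by (simp add: shift_def unit_deg_def nat_vec_def)
  then have "Poly_Mapping.lookup a i \<noteq> 0" using assms(2) by auto
  then have "a = (a - Poly_Mapping.single i 1) + Poly_Mapping.single i 1"
    by (intro poly_mapping_eqI) (auto simp: lookup_add lookup_minus lookup_single when_def)
  then have "shift (unit_deg i) x = shift (unit_deg i) (nat_vec (a - Poly_Mapping.single i 1))"
    using a nat_vec_add_single by metis
  then have "x = nat_vec (a - Poly_Mapping.single i 1)" by (metis shift_inverse(1))
  then show ?thesis by simp
qed

lemma of_cpoly_zero: "of_cpoly 0 = (\<lambda>x. 0)"
  by (auto simp: of_cpoly_def)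

lemma of_cpoly_single: "of_cpoly (Poly_Mapping.single b c) = smul c (tmon (nat_vec b))"
proof
  fix x
  show "of_cpoly (Poly_Mapping.single b c) x = smul c (tmon (nat_vec b)) x"
  proof (cases "x \<in> range nat_vec")
    case True
    then show ?thesis by (auto simp: smul_def tmon_def nat_vec_inj lookup_single when_def)
  next
    case False
    then show ?thesis by (auto simp: smul_def tmon_def of_cpoly_0)
  qed
qed

lemma of_cpoly_tvar: "of_cpoly (app_op (tvar i) p) x = of_cpoly p (shift (- unit_deg i) x)"
proof (induction p rule: cpoly_induct)
  case (single a c)
  have "app_op (tvar i) (Poly_Mapping.single a c) = Poly_Mapping.single (a + Poly_Mapping.single i 1) c"
    by (simp add: tvar.rep_eq mult_single add.commute)
  then show ?case
    by (simp only: of_cpoly_single nat_vec_add_single smul_def tmon_def shift_eq_iff)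
next
  case (add p q)
  have "of_cpoly (p + q) x = of_cpoly p x + of_cpoly q x" for p q x
    by (simp add: of_cpoly_def lookup_add)
  then show ?case using add by (simp add: app_op_add)
qed

lemma of_cpoly_pdiff:
  "of_cpoly (app_op (pdiff i) p) x = of_real (x i + 1) * of_cpoly p (shift (unit_deg i) x)"
proof (cases "x \<in> range nat_vec")
  case True
  then obtain a where "x = nat_vec a" by auto
  then show ?thesis
    by (simp add: nat_vec_add_single[symmetric] pdiff.rep_eq poly_deriv.rep_eq del: One_nat_def)
      (simp add: nat_vec_def)
next
  case False
  then show ?thesis using nat_vec_shift_unit[of i x] of_cpoly_0[of x] of_cpoly_0[of "shift (unit_deg i) x" p]
    by (cases "x i = - 1") auto
qed

lemma diffop_of_cpoly: "diffop l P F \<Longrightarrow> of_cpoly (app_op P p) = F (of_cpoly p)"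
proof (induction arbitrary: p rule: diffop.induct)
  case (scal c)
  show ?case by (auto simp: of_cpoly_def smul_def scal.rep_eq lookup_const_times)
next
  case (add P F Q G)
  have "of_cpoly (p + q) = (\<lambda>x. of_cpoly p x + of_cpoly q x)" for p q
    by (auto simp: of_cpoly_def lookup_add)
  then show ?case using add by (simp only: plus_linop.rep_eq)
qed (auto simp: of_cpoly_tvar of_cpoly_pdiff times_linop.rep_eq)

text \<open>Every such operator is a finite sum of shifts with polynomial coefficients.\<close>

definition shift_sum :: "nat \<Rightarrow> (rmon \<Rightarrow> rmon) \<Rightarrow> bool" where
  "shift_sum l F \<longleftrightarrow> (\<exists>S q. finite S \<and> (\<forall>d. polyfun l (q d)) \<and> (\<forall>d. d \<notin> S \<longrightarrow> q d = (\<lambda>x. 0)) \<and>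
     (\<forall>d\<in>S. \<forall>i\<ge>l. d i = 0) \<and> F = (\<lambda>f x. \<Sum>d\<in>S. q d x * f (shift d x)))"

lemma shift_sum_single:
  assumes "polyfun l q" "\<forall>i\<ge>l. d i = 0"
  shows "shift_sum l (\<lambda>f x. q x * f (shift d x))"
  unfolding shift_sum_def
  by (rule exI[of _ "{d}"], rule exI[of _ "\<lambda>e. if e = d then q else (\<lambda>x. 0)"])
    (use assms in \<open>auto intro: polyfun.const\<close>)

lemma shift_sum_add:
  assumes "shift_sum l F" "shift_sum l G"
  shows "shift_sum l (\<lambda>f x. F f x + G f x)"
proof -
  obtain S p where p: "finite S" "\<forall>d. polyfun l (p d)" "\<forall>d. d \<notin> S \<longrightarrow> p d = (\<lambda>x. 0)"
    "\<forall>d\<in>S. \<forall>i\<ge>l. d i = 0" "F = (\<lambda>f x. \<Sum>d\<in>S. p d x * f (shift d x))"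
    using assms(1) unfolding shift_sum_def by blast
  obtain T q where q: "finite T" "\<forall>d. polyfun l (q d)" "\<forall>d. d \<notin> T \<longrightarrow> q d = (\<lambda>x. 0)"
    "\<forall>d\<in>T. \<forall>i\<ge>l. d i = 0" "G = (\<lambda>f x. \<Sum>d\<in>T. q d x * f (shift d x))"
    using assms(2) unfolding shift_sum_def by blast
  have "F f x + G f x = (\<Sum>d\<in>S \<union> T. (p d x + q d x) * f (shift d x))" for f x
  proof -
    have "F f x = (\<Sum>d\<in>S \<union> T. p d x * f (shift d x))"
      unfolding p(5) using p(1,3) q(1) by (intro sum.mono_neutral_left) auto
    moreover have "G f x = (\<Sum>d\<in>S \<union> T. q d x * f (shift d x))"
      unfolding q(5) using q(1,3) p(1) by (intro sum.mono_neutral_left) auto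
    ultimately show ?thesis by (simp add: distrib_right sum.distrib)
  qed
  then show ?thesis unfolding shift_sum_def using p(1-4) q(1-4)
    by (intro exI[of _ "S \<union> T"] exI[of _ "\<lambda>d x. p d x + q d x"]) (auto intro: polyfun.add)
qed

lemma shift_sum_zero: "shift_sum l (\<lambda>f x. 0)"
  using shift_sum_single[OF polyfun.const[of l 0], of 0] by simp

lemma shift_sum_sum:
  "finite A \<Longrightarrow> (\<And>a. a \<in> A \<Longrightarrow> shift_sum l (F a)) \<Longrightarrow> shift_sum l (\<lambda>f x. \<Sum>a\<in>A. F a f x)"
  by (induction A rule: finite_induct) (auto intro: shift_sum_zero shift_sum_add)

lemma shift_sum_mult:
  assumes "shift_sum l F" "shift_sum l G"
  shows "shift_sum l (\<lambda>f. F (G f))"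
proof -
  obtain S p where p: "finite S" "\<forall>d. polyfun l (p d)" 
    "\<forall>d\<in>S. \<forall>i\<ge>l. d i = 0" "F = (\<lambda>f x. \<Sum>d\<in>S. p d x * f (shift d x))"
    using assms(1) unfolding shift_sum_def by blast
  obtain T q where q: "finite T" "\<forall>d. polyfun l (q d)" 
    "\<forall>d\<in>T. \<forall>i\<ge>l. d i = 0" "G = (\<lambda>f x. \<Sum>d\<in>T. q d x * f (shift d x))"
    using assms(2) unfolding shift_sum_def by blast
  have *: "F (G f) x = (\<Sum>d\<in>S. \<Sum>e\<in>T. (p d x * q e (shift d x)) * f (shift (e + d) x))" for f x
    unfolding p(4) q(4) by (simp add: sum_distrib_left mult.assoc shift_shift)
  have "shift_sum l (\<lambda>f x. (p d x * q e (shift d x)) * f (shift (e + d) x))"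
    if "d \<in> S" "e \<in> T" for d e
    using that p q by (intro shift_sum_single polyfun.mult)
      (auto simp: shift_def intro: polyfun_shift)
  then have "shift_sum l (\<lambda>f x. \<Sum>d\<in>S. \<Sum>e\<in>T. (p d x * q e (shift d x)) * f (shift (e + d) x))"
    using p(1) q(1) by (intro shift_sum_sum)
  moreover have "(\<lambda>f. F (G f)) = (\<lambda>f x. \<Sum>d\<in>S. \<Sum>e\<in>T. (p d x * q e (shift d x)) * f (shift (e + d) x))"
    by (intro ext *)
  ultimately show ?thesis by simp
qed

lemma diffop_shift_sum: "diffop l P F \<Longrightarrow> shift_sum l F"
proof (induction rule: diffop.induct)
  case (scal c)
  show ?case using shift_sum_single[OF polyfun.const[of l c], of 0] by (simp add: smul_def[abs_def])
next
  case (tvar i)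
  then show ?case using shift_sum_single[OF polyfun.const[of l 1], of "- unit_deg i"]
    by (simp add: unit_deg_def)
next
  case (pdiff i)
  then show ?case using shift_sum_single[OF polyfun.coord[of i l 1], of "unit_deg i"]
    by (simp add: unit_deg_def)
qed (auto intro: shift_sum_add shift_sum_mult)

text \<open>Applied to a single monomial the summands have different exponents, so each coefficient
  polynomial can be read off at all natural vectors.\<close>

lemma shift_sum_eq_0:
  assumes "shift_sum l F" "\<And>p. F (of_cpoly p) = (\<lambda>x. 0)"
  shows "F f = (\<lambda>x. 0)"
proof -
  obtain S q where q: "finite S" "\<And>d. polyfun l (q d)"
    "\<And>d i. d \<in> S \<Longrightarrow> i \<ge> l \<Longrightarrow> d i = 0" "F = (\<lambda>f x. \<Sum>d\<in>S. q d x * f (shift d x))"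
    using assms(1) unfolding shift_sum_def by blast
  have "q d x = 0" if d: "d \<in> S" for d x
  proof -
    have "q d (shift (- d) (nat_vec a)) = 0" for a
    proof -
      let ?y = "shift (- d) (nat_vec a)"
      have "tmon (nat_vec a) (shift e ?y) = (if e = d then 1 else 0)" for e
      proof -
        have "shift e ?y = nat_vec a \<longleftrightarrow> e = d"
          by (auto simp: shift_def fun_eq_iff)
        then show ?thesis by (simp add: tmon_def)
      qed
      then have "F (tmon (nat_vec a)) ?y = (\<Sum>e\<in>S. if e = d then q d ?y else 0)"
        unfolding q(4) by (intro sum.cong) auto
      then have "F (tmon (nat_vec a)) ?y = q d ?y" using d q(1) by (simp add: sum.delta)
      moreover have "of_cpoly (Poly_Mapping.single a 1) = tmon (nat_vec a)"
        by (simp add: of_cpoly_single smul_def)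
      ultimately show ?thesis using assms(2)[of "Poly_Mapping.single a 1"] by simp
    qed
    moreover have "polyfun l (\<lambda>x. q d (shift (- d) x))"
      using polyfun_shift[OF q(2)[of d], of "- d"] by (simp add: shift_def)
    ultimately have "q d (shift (- d) (shift d x)) = 0"
      using polyfun_eq_0 by blast
    then show ?thesis by simp
  qed
  then show ?thesis by (simp add: q(4))
qed

lemma diffop_diff:
  assumes "diffop l P F" "diffop l Q G" shows "diffop l (P - Q) (\<lambda>f x. F f x - G f x)"
proof -
  have "diffop l (P + scal (- 1) * Q) (\<lambda>f x. F f x + smul (- 1) (G f) x)"
    using assms by (intro diffop.intros)
  then show ?thesis by (simp add: scal_minus smul_def)
qed

lemma diffop_unique:
  assumes "diffop l P F" "diffop l P G" shows "F = G"
proof (intro ext)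
  fix f x
  have "diffop l 0 (\<lambda>f x. F f x - G f x)" using diffop_diff[OF assms] by simp
  moreover from this have "(\<lambda>x. F (of_cpoly p) x - G (of_cpoly p) x) = (\<lambda>x. 0)" for p
    using diffop_of_cpoly[of l 0 "\<lambda>f x. F f x - G f x" p, symmetric]
    by (simp add: zero_linop.rep_eq of_cpoly_zero)
  ultimately have "(\<lambda>x. F f x - G f x) = (\<lambda>x. 0)"
    using diffop_shift_sum shift_sum_eq_0[of l "\<lambda>f x. F f x - G f x"] by blast
  then show "F f x = G f x" by (metis eq_iff_diff_eq_0)
qed

lemma diffop_exists: "P \<in> weyl l \<Longrightarrow> \<exists>F. diffop l P F"
proof (induction rule: weyl.induct)
  case (add P Q)
  then show ?case by (meson diffop.add)
next
  case (mult P Q)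
  then show ?case by (meson diffop.mult)
qed (rule exI, erule diffop.intros | rule exI, rule diffop.intros)+

text \<open>The action of \<open>D\<close> on formal combinations of monomials with real exponents.\<close>

definition rho :: "nat \<Rightarrow> linop \<Rightarrow> rmon \<Rightarrow> rmon" where
  "rho l P = (THE F. diffop l P F)"

lemma rho_eq: "diffop l P F \<Longrightarrow> rho l P = F"
  unfolding rho_def using diffop_unique by blast

lemma diffop_rho: "P \<in> weyl l \<Longrightarrow> diffop l P (rho l P)"
  using diffop_exists rho_eq by metis

lemma rho_add: "P \<in> weyl l \<Longrightarrow> Q \<in> weyl l \<Longrightarrow> rho l (P + Q) f = rho l P f + rho l Q f"
  using rho_eq[OF diffop.add[OF diffop_rho diffop_rho], of P l Q] by (simp add: fun_eq_iff)

lemma rho_diff: "P \<in> weyl l \<Longrightarrow> Q \<in> weyl l \<Longrightarrow> rho l (P - Q) f = rho l P f - rho l Q f"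
  using rho_eq[OF diffop_diff[OF diffop_rho diffop_rho], of P l Q] by (simp add: fun_eq_iff)

lemma rho_mult: "P \<in> weyl l \<Longrightarrow> Q \<in> weyl l \<Longrightarrow> rho l (P * Q) f = rho l P (rho l Q f)"
  using rho_eq[OF diffop.mult[OF diffop_rho diffop_rho], of P l Q] by simp

lemma rho_scal: "rho l (scal c) f = smul c f"
  using rho_eq[OF diffop.scal, of l c] by simp

lemma rho_0: "rho l 0 f = 0"
  using rho_scal[of l 0 f] by (simp add: smul_def fun_eq_iff)

lemma rho_1: "rho l 1 f = f"
  using rho_scal[of l 1 f] by (simp add: smul_def)

lemma rho_tvar: "i < l \<Longrightarrow> rho l (tvar i) (tmon x) = tmon (shift (unit_deg i) x)"
  using rho_eq[OF diffop.tvar, of i l] by (simp add: tmon_def shift_eq_iff)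

lemma rho_pdiff: "i < l \<Longrightarrow> rho l (pdiff i) (tmon x) = smul (of_real (x i)) (tmon (shift (- unit_deg i) x))"
proof -
  assume i: "i < l"
  have "y = shift (- unit_deg i) x \<Longrightarrow> y i + 1 = x i" for y by (simp add: shift_def unit_deg_def)
  moreover have "shift (unit_deg i) y = x \<longleftrightarrow> y = shift (- unit_deg i) x" for y
    by (metis shift_inverse)
  ultimately show ?thesis
    using rho_eq[OF diffop.pdiff[OF i]] by (auto simp: tmon_def smul_def fun_eq_iff simp flip: of_real_add)
qed

lemma diffop_linear: "diffop l P F \<Longrightarrow> F (f + g) = F f + F g \<and> F (smul c f) = smul c (F f)"
proof (induction arbitrary: f g c rule: diffop.induct)
  case (mult P F Q G)
  then show ?case by simp
qed (auto simp: smul_def fun_eq_iff algebra_simps)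

lemma rho_linear:
  assumes "P \<in> weyl l"
  shows "rho l P (f + g) = rho l P f + rho l P g" "rho l P (smul c f) = smul c (rho l P f)"
    "rho l P (f - g) = rho l P f - rho l P g" "rho l P 0 = 0"
proof -
  show *: "rho l P (f + g) = rho l P f + rho l P g" "rho l P (smul c f) = smul c (rho l P f)" for f g c
    using diffop_linear[OF diffop_rho[OF assms]] by auto
  show "rho l P (f - g) = rho l P f - rho l P g" using *(1)[of "f - g" g] by simp
  show "rho l P 0 = 0" using *(1)[of 0 0] by simp
qed

lemma smul_smul: "smul a (smul b f) = smul (a * b) f"
  by (simp add: smul_def mult.assoc)

lemma smul_add: "smul a f + smul b f = smul (a + b) f"
  by (auto simp: smul_def distrib_right)

lemma rho_euler: "i < l \<Longrightarrow> rho l (euler i) (tmon x) = smul (of_real (x i)) (tmon x)"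
  by (simp add: euler_def rho_mult weyl.intros rho_pdiff rho_linear rho_tvar)

section \<open>Semi-invariants modulo Euler eigenvalues\<close>

definition ray :: "nat \<Rightarrow> (nat \<Rightarrow> int) \<Rightarrow> int \<Rightarrow> nat \<Rightarrow> int" where
  "ray l d m = (\<lambda>i. d i + m * one_deg l i)"

text \<open>The weight of a degree records the differences of consecutive exponents, which determine the
  exponents up to a common constant.\<close>

lemma deg_wt_eq_imp_ray:
  assumes "\<And>i. i < l \<Longrightarrow> deg_wt l d i = deg_wt l e i"
    and "\<And>i. i \<ge> l \<Longrightarrow> d i = 0" "\<And>i. i \<ge> l \<Longrightarrow> e i = 0"
  shows "d = ray l e (d 0 - e 0)"
proof
  fix i
  have "i < l \<Longrightarrow> d i - e i = d 0 - e 0"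
  proof (induction i)
    case (Suc i)
    then have "csucc l i = Suc i" by (simp add: csucc_def)
    then show ?case using Suc assms(1)[of i] by (simp add: deg_wt_def)
  qed simp
  then show "d i = ray l e (d 0 - e 0) i"
    using assms(2,3)[of i] by (cases "i < l") (auto simp: ray_def one_deg_def)
qed

lemma deg_wt_ray: "deg_wt l (ray l d m) i = deg_wt l d i" if "i < l"
  using that by (simp add: deg_wt_def ray_def one_deg_def)

text \<open>Polynomials in \<open>T = t\<^sub>0 \<cdots> t\<^sub>l\<^sub>-\<^sub>1\<close>. The coefficients vanish outside \<open>S\<close>, so that differences can be
  formed over the union of the supports.\<close>

definition tpoly :: "nat \<Rightarrow> linop set" where
  "tpoly l = {\<Sum>n\<in>S. scal (a n) * tprod l ^ n | S a. finite S \<and> (\<forall>n. n \<notin> S \<longrightarrow> a n = 0)}"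

lemma tpoly_zero [simp]: "0 \<in> tpoly l"
  unfolding tpoly_def by (auto intro!: exI[of _ "{}"] exI[of _ "\<lambda>_. 0"])

lemma tpoly_power: "scal c * tprod l ^ n \<in> tpoly l"
  unfolding tpoly_def
  by (intro CollectI exI[of _ "\<lambda>m. if m = n then c else 0"] exI[of _ "{n}"]) simp

lemma tpoly_one: "1 \<in> tpoly l"
  using tpoly_power[of 1 l 0] by simp

lemma tpoly_diff:
  assumes "P \<in> tpoly l" "Q \<in> tpoly l" shows "P - Q \<in> tpoly l"
proof -
  obtain S a where p: "finite S" "\<forall>n. n \<notin> S \<longrightarrow> a n = 0" "P = (\<Sum>n\<in>S. scal (a n) * tprod l ^ n)"
    using assms(1) unfolding tpoly_def by blast
  obtain T b where q: "finite T" "\<forall>n. n \<notin> T \<longrightarrow> b n = 0" "Q = (\<Sum>n\<in>T. scal (b n) * tprod l ^ n)"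
    using assms(2) unfolding tpoly_def by blast
  have "P = (\<Sum>n\<in>S \<union> T. scal (a n) * tprod l ^ n)"
    unfolding p(3) using p q by (intro sum.mono_neutral_left) auto
  moreover have "Q = (\<Sum>n\<in>S \<union> T. scal (b n) * tprod l ^ n)"
    unfolding q(3) using p q by (intro sum.mono_neutral_left) auto
  ultimately have "P - Q = (\<Sum>n\<in>S \<union> T. scal (a n - b n) * tprod l ^ n)"
    by (simp add: scal_diff left_diff_distrib sum_subtractf)
  then show ?thesis unfolding tpoly_def using p(1,2) q(1,2)
    by (auto intro!: exI[of _ "S \<union> T"] exI[of _ "\<lambda>n. a n - b n"])
qed

lemma tpoly_subgroup: "linop_subgroup (tpoly l)"
  by (simp add: linop_subgroup_def tpoly_diff)

lemma weyl_deg_tprod_power: "weyl_deg l (ray l 0 (int n)) (tprod l ^ n)"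
proof (induction n)
  case 0
  have "weyl_deg l 0 (tprod l ^ 0)" by (simp add: weyl_deg_one)
  then show ?case by (rule weyl_deg_cong) (simp add: ray_def)
next
  case (Suc n)
  have "weyl_deg l (one_deg l + ray l 0 (int n)) (tprod l * tprod l ^ n)"
    by (intro weyl_deg.mult weyl_deg_tprod Suc.IH)
  then show ?case unfolding power_Suc by (rule weyl_deg_cong) (simp add: ray_def algebra_simps)
qed

lemma tprod_power_wspace: "tprod l ^ n \<in> wspace l 0"
proof -
  have "weyl_deg l (ray l 0 (int n)) (tprod l ^ n)" by (rule weyl_deg_tprod_power)
  then show ?thesis
    by (rule weyl_deg_wspace) (simp add: deg_wt_ray, simp add: deg_wt_def)
qed

lemma tpoly_wspace: "R \<in> tpoly l \<Longrightarrow> R \<in> wspace l 0"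
  unfolding tpoly_def using wspace_mult[OF wspace_scal tprod_power_wspace]
  by (auto intro!: wspace_sum)

lemma tprod_weyl: "tprod l ^ n \<in> weyl l"
  using tprod_power_wspace wspace_weyl by blast

lemma rho_tprod_le: "n \<le> l \<Longrightarrow> rho l (tprod n) (tmon x) = tmon (shift (one_deg n) x)"
proof (induction n arbitrary: x)
  case 0
  have "shift (one_deg 0) x = x" by (auto simp: shift_def one_deg_def)
  then show ?case by (simp add: tprod_def rho_1)
next
  case (Suc n)
  have "tprod (Suc n) = tprod n * tvar n" by (simp add: tprod_def)
  moreover have "tprod n \<in> weyl l" using weyl_deg_tprod_le[of n l] Suc by (simp add: weyl_deg_weyl)
  ultimately show ?case using Suc
    by (simp only: rho_mult weyl.tvar Suc_le_eq rho_tvar Suc.IH less_imp_le shift_shift one_deg_Suc)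
qed

lemma rho_tprod_power: "rho l (tprod l ^ n) (tmon x) = tmon (shift (ray l 0 (int n)) x)"
proof (induction n)
  case 0
  have "shift (ray l 0 (int 0)) x = x" by (auto simp: shift_def ray_def)
  then show ?case by (simp only: power_0 rho_1)
next
  case (Suc n)
  have s: "one_deg l + ray l 0 (int n) = ray l 0 (int (Suc n))"
    by (rule ext) (simp add: ray_def distrib_right)
  have "rho l (tprod l ^ Suc n) (tmon x) = rho l (tprod l) (rho l (tprod l ^ n) (tmon x))"
    using rho_mult[of "tprod l" l "tprod l ^ n"] tprod_weyl[of l 1] tprod_weyl[of l n] by simp
  also have "\<dots> = tmon (shift (one_deg l + ray l 0 (int n)) x)"
    by (simp only: Suc.IH rho_tprod_le[OF order_refl] shift_shift)
  finally show ?case by (simp only: s)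
qed

lemma rho_sum:
  "(\<And>n. n \<in> S \<Longrightarrow> P n \<in> weyl l) \<Longrightarrow> rho l (sum P S) f = (\<Sum>n\<in>S. rho l (P n) f)"
  by (induction S rule: infinite_finite_induct) (simp_all add: rho_0 rho_add)

text \<open>The monomials \<open>T\<^sup>n t\<^sup>x\<close> have different exponents for different \<open>n\<close>, because \<open>l \<ge> 1\<close>.\<close>

lemma tpoly_faithful:
  assumes "l \<ge> 1" "R \<in> tpoly l" "rho l R (smul c (tmon x)) = 0" "c \<noteq> 0"
  shows "R = 0"
proof -
  obtain S a where R: "finite S" "R = (\<Sum>n\<in>S. scal (a n) * tprod l ^ n)"
    using assms(2) unfolding tpoly_def by blast
  have "rho l R (smul c (tmon x)) = (\<Sum>n\<in>S. smul (c * a n) (tmon (shift (ray l 0 (int n)) x)))"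
    unfolding R(2)
    by (subst rho_sum)
      (simp_all add: rho_mult rho_scal rho_linear tprod_weyl weyl.intros rho_tprod_power smul_smul mult.commute)
  moreover have "(\<Sum>n\<in>S. smul (c * a n) (tmon (shift (ray l 0 (int n)) x))) (shift (ray l 0 (int m)) x) = c * a m"
    if "m \<in> S" for m
  proof -
    have "shift (ray l 0 (int n)) x \<noteq> shift (ray l 0 (int m)) x" if "n \<noteq> m" for n
      using that assms(1) by (auto simp: shift_def ray_def one_deg_def fun_eq_iff intro!: exI[of _ 0])
    then have "smul (c * a n) (tmon (shift (ray l 0 (int n)) x)) (shift (ray l 0 (int m)) x) =
        (if n = m then c * a m else 0)" for n
      by (cases "n = m") (simp_all add: smul_def tmon_def eq_commute[of "shift (ray l 0 (int m)) x"])
    moreover have "(\<Sum>n\<in>S. F n) y = (\<Sum>n\<in>S. F n y)" for F :: "nat \<Rightarrow> rmon" and y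
      using R(1) by (induction S rule: finite_induct) auto
    ultimately show ?thesis using that R(1) by (simp add: sum.delta')
  qed
  ultimately have "a m = 0" if "m \<in> S" for m using assms(3,4) that by (metis mult_eq_0_iff zero_fun_apply)
  then show ?thesis unfolding R(2) by simp
qed

lemma rho_eig: "eig l nu d P \<Longrightarrow> rho l P (tmon nu) = 0"
proof (induction rule: eig.induct)
  case (gen i r)
  have "r \<in> weyl l" using gen weyl_deg_weyl by blast
  then show ?case using gen
    by (simp add: rho_mult rho_diff weyl.intros rho_euler rho_scal rho_linear)
next
  case (add P Q)
  then have "P \<in> weyl l" "Q \<in> weyl l" using eig_weyl_deg weyl_deg_weyl by blast+
  then have "rho l (P + Q) (tmon nu) = 0 + 0" by (simp only: rho_add add.IH)
  then show ?case by simp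
qed (rule rho_0)

text \<open>Semi-invariants of a fixed weight have degrees on one line \<open>d + m(1,\<dots>,1)\<close>. Each degree
  contributes at most one dimension modulo Euler eigenvalues; if the part \<open>m < 0\<close> dies in the
  quotient and \<open>G\<close> has degree \<open>d\<close> and does not kill the eigenvector \<open>t\<^sup>\<nu>\<close>, then
  \<open>T\<^sup>m G\<close> spans degree \<open>m\<close>.\<close>

lemma wspace_spanned:
  assumes Z: "linop_subgroup Z"
    and K: "\<And>m P. eig l nu (ray l d m) P \<Longrightarrow> P \<in> Z"
    and neg: "\<And>m c. m < 0 \<Longrightarrow> scal c * nmon l (ray l d m) \<in> Z"
    and G: "weyl_deg l d G" "rho l G (tmon nu) = smul \<gamma> (tmon x)" "\<gamma> \<noteq> 0"
    and d: "\<And>i. i \<ge> l \<Longrightarrow> d i = 0" "\<And>i. i < l \<Longrightarrow> deg_wt l d i = th i"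
    and P: "P \<in> wspace l th"
  shows "\<exists>R\<in>tpoly l. P - R * G \<in> Z"
  using P
proof (induction rule: wspace_induct)
  case (deg e P)
  show ?case
  proof (cases "P = 0")
    case True
    then show ?thesis using Z by (intro bexI[of _ 0]) (auto dest: linop_subgroupD)
  next
    case False
    then have e0: "e i = 0" if "i \<ge> l" for i using weyl_deg_supp[OF deg(1)] that by auto
    define m where "m = e 0 - d 0"
    have e: "e = ray l d m"
      unfolding m_def by (rule deg_wt_eq_imp_ray) (use deg(2) d e0 in auto)
    obtain a where a: "eig l nu e (P - scal a * nmon l e)" using normal_form[OF deg(1)] by blast
    show ?thesis
    proof (cases "m < 0")
      case True
      have "P - scal a * nmon l e \<in> Z" using K a e by simp
      moreover have "scal a * nmon l e \<in> Z" using neg[OF True] e by simp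
      ultimately have "P \<in> Z" using linop_subgroupD(4)[OF Z] by fastforce
      then show ?thesis by (intro bexI[of _ 0]) auto
    next
      case False
      define H where "H = tprod l ^ nat m * G"
      have "weyl_deg l (ray l 0 (int (nat m)) + d) H"
        unfolding H_def by (intro weyl_deg.mult weyl_deg_tprod_power G)
      then have "weyl_deg l e H"
        by (rule weyl_deg_cong) (use False in \<open>simp add: e ray_def\<close>)
      then obtain b where b: "eig l nu e (H - scal b * nmon l e)" using normal_form by blast
      have nm: "nmon l e \<in> weyl l" using weyl_deg_nmon[of l e] e0 weyl_deg_weyl by blast
      have GW: "G \<in> weyl l" using G(1) weyl_deg_weyl by blast
      have HW: "H \<in> weyl l" using \<open>weyl_deg l e H\<close> weyl_deg_weyl by blast
      have "rho l H (tmon nu) = smul \<gamma> (tmon (shift (ray l 0 (int (nat m))) x))"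
        unfolding H_def using GW by (simp add: rho_mult tprod_weyl G(2) rho_linear rho_tprod_power)
      moreover have "smul \<gamma> (tmon y) \<noteq> 0" for y
        using G(3) by (auto simp: smul_def tmon_def fun_eq_iff)
      ultimately have "b \<noteq> 0"
        using rho_eig[OF b] HW nm
        by (auto simp: rho_0)
      define R where "R = scal (a / b) * tprod l ^ nat m"
      have "P - R * G = (P - scal a * nmon l e) - scal (a / b) * (H - scal b * nmon l e)"
        using \<open>b \<noteq> 0\<close> by (simp add: R_def H_def right_diff_distrib mult.assoc scal_mult flip: mult.assoc[of "scal (a / b)" "scal b"])
      also have "\<dots> \<in> Z" using a b by (intro K[of m]) (simp add: e[symmetric] eig_diff eig_scal)
      finally show ?thesis using tpoly_power unfolding R_def by blast
    qed
  qed
next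
  case zero
  then show ?case using Z by (intro bexI[of _ 0]) (auto dest: linop_subgroupD)
next
  case (add P Q)
  then obtain R R' where R: "R \<in> tpoly l" "P - R * G \<in> Z" "R' \<in> tpoly l" "Q - R' * G \<in> Z" by blast
  then have "(P - R * G) + (Q - R' * G) \<in> Z" using linop_subgroupD(4)[OF Z] by blast
  moreover have "R + R' \<in> tpoly l" using linop_subgroupD(4)[OF tpoly_subgroup] R by blast
  ultimately show ?case by (intro bexI[of _ "R + R'"]) (auto simp: algebra_simps)
qed

section \<open>The bimodule\<close>

text \<open>The set \<open>W\<close> of admissible coefficients is all of \<open>D\<close> for the bimodule, and a space of
  semi-invariants for the algebras.\<close>

definition iota_ideal :: "nat \<Rightarrow> (nat \<Rightarrow> real) \<Rightarrow> linop set \<Rightarrow> linop set" where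
  "iota_ideal l c W = {\<Sum>i<l. r i * (iota l i - scal (of_real (c i))) | r. \<forall>i<l. r i \<in> W}"

lemma iota_idealI: "(\<And>i. i < l \<Longrightarrow> r i \<in> W) \<Longrightarrow> (\<Sum>i<l. r i * (iota l i - scal (of_real (c i)))) \<in> iota_ideal l c W"
  unfolding iota_ideal_def by blast

lemma iota_ideal_subgroup:
  assumes "linop_subgroup W" shows "linop_subgroup (iota_ideal l c W)"
  unfolding linop_subgroup_def
proof (intro conjI ballI)
  show "0 \<in> iota_ideal l c W"
    using iota_idealI[of l "\<lambda>_. 0" W c] linop_subgroupD(1)[OF assms] by simp
  fix x y assume "x \<in> iota_ideal l c W" "y \<in> iota_ideal l c W"
  then obtain r s where rs: "\<forall>i<l. r i \<in> W" "x = (\<Sum>i<l. r i * (iota l i - scal (of_real (c i))))"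
    "\<forall>i<l. s i \<in> W" "y = (\<Sum>i<l. s i * (iota l i - scal (of_real (c i))))"
    unfolding iota_ideal_def by blast
  have "x - y = (\<Sum>i<l. (r i - s i) * (iota l i - scal (of_real (c i))))"
    unfolding rs by (simp add: left_diff_distrib sum_subtractf)
  then show "x - y \<in> iota_ideal l c W"
    using rs by (auto intro!: iota_idealI linop_subgroupD(2)[OF assms])
qed

lemma iota_ideal_mult_left:
  assumes "x \<in> iota_ideal l c W" "\<And>w. w \<in> W \<Longrightarrow> a * w \<in> W'"
  shows "a * x \<in> iota_ideal l c W'"
proof -
  obtain r where r: "\<forall>i<l. r i \<in> W" "x = (\<Sum>i<l. r i * (iota l i - scal (of_real (c i))))"
    using assms(1) unfolding iota_ideal_def by blast
  have "a * x = (\<Sum>i<l. (a * r i) * (iota l i - scal (of_real (c i))))"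
    unfolding r by (simp add: sum_distrib_left mult.assoc)
  then show ?thesis using r assms(2) by (auto intro!: iota_idealI)
qed

text \<open>Moving \<open>\<iota>\<^sub>i - c\<^sub>i\<close> past a semi-invariant of weight \<open>\<theta>\<close> shifts \<open>c\<close> by \<open>\<theta>\<close>.\<close>

lemma iota_ideal_mult_right:
  assumes "x \<in> iota_ideal l c' W" "Q \<in> wspace l th" "\<And>w. w \<in> W \<Longrightarrow> w * Q \<in> W'"
    "\<And>i. i < l \<Longrightarrow> c' i = c i + of_int (th i)"
  shows "x * Q \<in> iota_ideal l c W'"
proof -
  obtain r where r: "\<forall>i<l. r i \<in> W" "x = (\<Sum>i<l. r i * (iota l i - scal (of_real (c' i))))"
    using assms(1) unfolding iota_ideal_def by blast
  have "(iota l i - scal (of_real (c' i))) * Q = Q * (iota l i - scal (of_real (c i)))" if "i < l" for i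
  proof -
    have "scal a * Q = Q * scal a" for a by (rule scal_commute)
    then show ?thesis using iota_wspace[OF assms(2) that] assms(4)[OF that]
      by (simp add: left_diff_distrib right_diff_distrib distrib_left distrib_right scal_add)
  qed
  then have "x * Q = (\<Sum>i<l. (r i * Q) * (iota l i - scal (of_real (c i))))"
    unfolding r sum_distrib_right by (intro sum.cong) (auto simp: mult.assoc)
  then show ?thesis using r assms(3) by (auto intro!: iota_idealI)
qed

lemma weyl_subgroup: "linop_subgroup (weyl l)"
  by (simp add: linop_subgroup_def)

lemma wspace_subgroup: "linop_subgroup (wspace l th)"
  by (simp add: linop_subgroup_def wspace_diff)

abbreviation linop_ring :: "linop set \<Rightarrow> linop ring" where
  "linop_ring W \<equiv> \<lparr>carrier = W, monoid.mult = (*), monoid.one = 1, ring.zero = 0, ring.add = (+)\<rparr>"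

lemma abelian_monoid_linop:
  assumes "linop_subgroup W"
  shows "abelian_monoid (linop_ring W)"
  by (rule abelian_monoidI) (use linop_subgroupD[OF assms] in \<open>auto simp: add_ac\<close>)

lemma finsum_linop:
  assumes "linop_subgroup W" "finite A" "\<And>i. i \<in> A \<Longrightarrow> f i \<in> W"
  shows "finsum (linop_ring W) f A = sum f A"
proof -
  interpret abelian_monoid "linop_ring W"
    by (rule abelian_monoid_linop[OF assms(1)])
  show ?thesis using assms(2,3)
    by (induction A rule: finite_induct) (auto simp: finsum_insert Pi_iff)
qed

lemma iota_diff_wspace: "i < l \<Longrightarrow> iota l i - scal c \<in> wspace l 0"
  by (simp add: wspace_diff)

lemma left_ideal_gen_linop:
  assumes "linop_subgroup W" "\<And>w i. w \<in> W \<Longrightarrow> i < l \<Longrightarrow> w * (iota l i - scal (of_real (c i))) \<in> W"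
  shows "left_ideal_gen (linop_ring W) l
    (\<lambda>i. iota l i - scal (of_real (c i))) = iota_ideal l c W"
proof -
  have "finsum (linop_ring W)
      (\<lambda>i. r i * (iota l i - scal (of_real (c i)))) {..<l} = (\<Sum>i<l. r i * (iota l i - scal (of_real (c i))))"
    if "\<forall>i<l. r i \<in> W" for r
    using that assms by (intro finsum_linop) auto
  then have "X = finsum (linop_ring W)
      (\<lambda>i. r i * (iota l i - scal (of_real (c i)))) {..<l} \<and> r \<in> {..<l} \<rightarrow> W \<longleftrightarrow>
    X = (\<Sum>i<l. r i * (iota l i - scal (of_real (c i)))) \<and> (\<forall>i<l. r i \<in> W)" for X r
    by (cases "\<forall>i<l. r i \<in> W") (auto simp: Pi_iff)
  then show ?thesis unfolding left_ideal_gen_def iota_ideal_def by simp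
qed

lemma weyl_inv_eq:
  "weyl_inv l = \<lparr>carrier = wspace l 0, monoid.mult = (*), monoid.one = 1, ring.zero = 0, ring.add = (+)\<rparr>"
  by (simp add: weyl_inv_def weyl_ring_def wspace_def)

lemma B_ideal_eq: "B_ideal l lam = iota_ideal l (bar lam) (weyl l)"
  unfolding B_ideal_def weyl_ring_def
  by (rule left_ideal_gen_linop[OF weyl_subgroup]) (auto intro!: weyl.mult weyl.scal diff_weyl)

lemma AD_ideal_eq: "AD_ideal l lam = iota_ideal l (bar lam) (wspace l 0)"
  unfolding AD_ideal_def weyl_inv_eq
  using wspace_mult[OF _ iota_diff_wspace, of _ l 0]
  by (intro left_ideal_gen_linop[OF wspace_subgroup]) auto

lemma B_ideal_subgroup: "linop_subgroup (B_ideal l lam)"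
  by (simp add: B_ideal_eq iota_ideal_subgroup weyl_subgroup)

definition lcoset :: "linop set \<Rightarrow> linop \<Rightarrow> linop set" where
  "lcoset J x = (\<lambda>h. h + x) ` J"

lemma lcosetI: "h \<in> J \<Longrightarrow> h + x \<in> lcoset J x"
  by (auto simp: lcoset_def)

lemma lcoset_eq_iff:
  assumes "linop_subgroup J" shows "lcoset J x = lcoset J y \<longleftrightarrow> x - y \<in> J"
proof
  assume "lcoset J x = lcoset J y"
  then have "x \<in> lcoset J y" using lcosetI[OF linop_subgroupD(1)[OF assms], of x] by simp
  then show "x - y \<in> J" by (auto simp: lcoset_def)
next
  have *: "lcoset J x \<subseteq> lcoset J y" if "x - y \<in> J" for x y
  proof
    fix z assume "z \<in> lcoset J x"
    then obtain h where h: "h \<in> J" "z = h + x" by (auto simp: lcoset_def)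
    then have "h + (x - y) \<in> J" using that linop_subgroupD(4)[OF assms] by blast
    then show "z \<in> lcoset J y" using lcosetI[of "h + (x - y)" J y] h by simp
  qed
  assume "x - y \<in> J"
  then show "lcoset J x = lcoset J y" using *[of x y] *[of y x] linop_subgroupD(3)[OF assms, of "x - y"]
    by (simp only: minus_diff_eq subset_antisym)
qed

lemma lcoset_self: "linop_subgroup J \<Longrightarrow> x \<in> lcoset J x"
  using lcosetI[of 0 J x] linop_subgroupD(1) by simp

lemma lcoset_mem_iff: "linop_subgroup J \<Longrightarrow> x \<in> lcoset J y \<longleftrightarrow> x - y \<in> J"
  unfolding lcoset_def image_iff
  by (metis add_diff_cancel_right' diff_add_cancel)

lemma B_class_eq: "B_class l lam P = lcoset (B_ideal l lam) P"
  by (auto simp: B_class_def lcoset_def a_r_coset_def' weyl_ring_def)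

lemma B_class_eq_iff: "B_class l lam P = B_class l lam Q \<longleftrightarrow> P - Q \<in> B_ideal l lam"
  by (simp add: B_class_eq lcoset_eq_iff B_ideal_subgroup)

lemma act_iota_ideal:
  assumes "g \<in> torus l" "P \<in> B_ideal l lam" shows "act l g P \<in> B_ideal l lam"
proof -
  obtain r where r: "\<forall>i<l. r i \<in> weyl l" "P = (\<Sum>i<l. r i * (iota l i - scal (of_real (bar lam i))))"
    using assms(2) unfolding B_ideal_eq iota_ideal_def by blast
  have aw: "act l g Q \<in> weyl l" if "Q \<in> weyl l" for Q
    using that
  proof (induction rule: weyl.induct)
    case (tvar i) then show ?case using assms(1) by (simp add: act_tvar weyl.intros)
  next
    case (pdiff i) then show ?case using assms(1) by (simp add: act_pdiff weyl.intros)
  qed (auto simp: act_add act_mult act_scal assms(1) intro: weyl.intros)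
  have "act l g (iota l i - scal c) = iota l i - scal c" if "i < l" for i c
    using iota_diff_wspace[OF that, of c] assms(1) by (simp add: wspace_def)
  then have "act l g P = (\<Sum>i<l. act l g (r i) * (iota l i - scal (of_real (bar lam i))))"
    unfolding r act_sum by (intro sum.cong) (auto simp: act_mult assms(1))
  then show ?thesis unfolding B_ideal_eq using r aw by (auto intro!: iota_idealI)
qed

lemma B_ideal_scal: "P \<in> B_ideal l lam \<Longrightarrow> scal c * P \<in> B_ideal l lam"
  unfolding B_ideal_eq by (erule iota_ideal_mult_left) (auto intro: weyl.intros)

text \<open>A coset on which the torus acts by \<open>\<chi>\<^sub>\<theta>\<close> contains an operator on which it does: the components of
  other weights of any representative lie in the ideal.\<close>

lemma B_carrier: "carrier (B_mod l lam th) = B_class l lam ` wspace l th"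
proof (intro equalityI subsetI)
  fix X assume "X \<in> carrier (B_mod l lam th)"
  then have X: "X \<in> a_rcosets\<^bsub>weyl_ring l\<^esub> (B_ideal l lam)"
    and inv: "\<And>g. g \<in> torus l \<Longrightarrow> act l g ` X = (\<lambda>P. scal (chr l th g) * P) ` X"
    by (auto simp: B_mod_def)
  from X obtain P where P: "P \<in> weyl l" "X = B_class l lam P"
    by (auto simp: A_RCOSETS_def' B_class_def a_r_coset_def' weyl_ring_def)
  have "act l g P - scal (chr l th g) * P \<in> B_ideal l lam" if "g \<in> torus l" for g
  proof -
    have "P \<in> X" unfolding P(2) B_class_eq by (rule lcoset_self[OF B_ideal_subgroup])
    then have "act l g P \<in> (\<lambda>P. scal (chr l th g) * P) ` X" using inv[OF that] by blast
    then obtain Q where Q: "Q \<in> X" "act l g P = scal (chr l th g) * Q" by blast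
    then have "Q - P \<in> B_ideal l lam"
      using P(2) by (simp add: B_class_eq lcoset_mem_iff B_ideal_subgroup)
    from B_ideal_scal[OF this, of "chr l th g"] show ?thesis by (simp add: Q(2) right_diff_distrib)
  qed
  then have "\<exists>S p. finite S \<and> (\<forall>d\<in>S. weyl_deg l d (p d) \<and> (\<forall>i<l. deg_wt l d i = th i)) \<and>
      P - sum p S \<in> B_ideal l lam"
    by (intro weight_component[OF B_ideal_subgroup B_ideal_scal act_iota_ideal P(1)])
  then obtain S p where S: "finite S" "\<forall>d\<in>S. weyl_deg l d (p d) \<and> (\<forall>i<l. deg_wt l d i = th i)"
    "P - sum p S \<in> B_ideal l lam" by auto
  then have "X = B_class l lam (sum p S)" using P(2) by (simp add: B_class_eq_iff)
  moreover have "sum p S \<in> wspace l th" using S(2) by (intro wspace_sum weyl_deg_wspace) auto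
  ultimately show "X \<in> B_class l lam ` wspace l th" by blast
next
  fix X assume "X \<in> B_class l lam ` wspace l th"
  then obtain Q where Q: "Q \<in> wspace l th" "X = B_class l lam Q" by blast
  have "X \<in> a_rcosets\<^bsub>weyl_ring l\<^esub> (B_ideal l lam)"
    using Q wspace_weyl[OF Q(1)] by (auto simp: A_RCOSETS_def' B_class_def a_r_coset_def' weyl_ring_def)
  moreover have "act l g ` X = (\<lambda>P. scal (chr l th g) * P) ` X" if g: "g \<in> torus l" for g
  proof -
    let ?c = "chr l th g" and ?h = "\<lambda>i. inverse (g i)"
    have aQ: "act l g Q = scal ?c * Q" using Q g by (simp add: wspace_def)
    have c: "?c \<noteq> 0" using g by simp
    have h: "?h \<in> torus l" using g by (auto simp: torus_def)
    have ah: "act l g (act l ?h P) = P" for P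
    proof -
      have "subst_op l g * (subst_op l ?h * P * subst_op l g) * subst_op l ?h =
          (subst_op l g * subst_op l ?h) * P * (subst_op l g * subst_op l ?h)"
        by (simp only: mult.assoc)
      then show ?thesis by (simp add: act_def subst_op_inverse(2)[OF g])
    qed
    show ?thesis
    proof (intro equalityI subsetI)
      fix y assume "y \<in> act l g ` X"
      then obtain b where b: "b \<in> B_ideal l lam" "y = act l g (b + Q)"
        unfolding Q(2) B_class_eq lcoset_def by blast
      have "y = scal ?c * (scal (inverse ?c) * act l g b + Q)"
        using c b(2) by (simp add: act_add aQ distrib_left scal_mult flip: mult.assoc)
      moreover have "scal (inverse ?c) * act l g b \<in> B_ideal l lam"
        by (intro B_ideal_scal act_iota_ideal g b)
      ultimately show "y \<in> (\<lambda>P. scal ?c * P) ` X"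
        unfolding Q(2) B_class_eq using lcosetI by blast
    next
      fix y assume "y \<in> (\<lambda>P. scal ?c * P) ` X"
      then obtain b where b: "b \<in> B_ideal l lam" "y = scal ?c * (b + Q)"
        unfolding Q(2) B_class_eq lcoset_def by blast
      have "y = act l g (act l ?h (scal ?c * b) + Q)"
        using b(2) by (simp add: act_add aQ distrib_left ah)
      moreover have "act l ?h (scal ?c * b) \<in> B_ideal l lam"
        by (intro B_ideal_scal act_iota_ideal h b)
      ultimately show "y \<in> act l g ` X"
        unfolding Q(2) B_class_eq using lcosetI by blast
    qed
  qed
  ultimately show "X \<in> carrier (B_mod l lam th)" by (simp add: B_mod_def)
qed

lemma B_add: "B_class l lam P \<oplus>\<^bsub>B_mod l lam th\<^esub> B_class l lam Q = B_class l lam (P + Q)"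
proof -
  have "set_add (weyl_ring l) (lcoset J P) (lcoset J Q) = lcoset J (P + Q)" if J: "linop_subgroup J" for J
  proof -
    have "set_add (weyl_ring l) (lcoset J P) (lcoset J Q) = {h + P + (k + Q) | h k. h \<in> J \<and> k \<in> J}"
      by (auto simp: set_add_def' weyl_ring_def lcoset_def)
    also have "\<dots> = lcoset J (P + Q)"
    proof (intro equalityI subsetI)
      fix x assume "x \<in> {h + P + (k + Q) | h k. h \<in> J \<and> k \<in> J}"
      then obtain h k where "h \<in> J" "k \<in> J" "x = (h + k) + (P + Q)" by (auto simp: add_ac)
      then show "x \<in> lcoset J (P + Q)" using linop_subgroupD(4)[OF J] lcosetI by blast
    next
      fix x assume "x \<in> lcoset J (P + Q)"
      then obtain h where "h \<in> J" "x = h + P + (0 + Q)" by (auto simp: lcoset_def add_ac)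
      then show "x \<in> {h + P + (k + Q) | h k. h \<in> J \<and> k \<in> J}" using linop_subgroupD(1)[OF J] by blast
    qed
    finally show ?thesis .
  qed
  from this[OF B_ideal_subgroup] show ?thesis by (simp add: B_mod_def B_class_eq)
qed

lemma UN_B_class_const:
  assumes "\<And>x. x \<in> X \<Longrightarrow> f x = Y" "X \<noteq> {}" shows "(\<Union>x\<in>X. f x) = Y"
  using assms by auto

text \<open>The left action is by cosets for \<open>\<lambda> + \<theta>\<close>, the result is a coset for \<open>\<lambda>\<close>: moving the relations of
  the former past \<open>Q\<close>, which has weight \<open>\<theta>\<close>, turns them into those of the latter.\<close>

lemma B_left_mult:
  assumes "R \<in> wspace l 0" "Q \<in> wspace l th"
  shows "(\<Union>P\<in>lcoset (AD_ideal l (shift_par lam th)) R. \<Union>S\<in>B_class l lam Q. B_class l lam (P * S)) = B_class l lam (R * Q)"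
proof -
  have J: "linop_subgroup (AD_ideal l (shift_par lam th))"
    by (simp add: AD_ideal_eq iota_ideal_subgroup wspace_subgroup)
  have "B_class l lam (P * S) = B_class l lam (R * Q)"
    if PS: "P \<in> lcoset (AD_ideal l (shift_par lam th)) R" "S \<in> B_class l lam Q" for P S
  proof -
    obtain j b where j: "j \<in> AD_ideal l (shift_par lam th)" "P = j + R"
      and b: "b \<in> B_ideal l lam" "S = b + Q"
      using PS unfolding lcoset_def B_class_eq image_iff by blast
    have left: "a * b \<in> B_ideal l lam" if "a \<in> weyl l" for a
      using b(1) that unfolding B_ideal_eq by (rule_tac iota_ideal_mult_left) (auto intro: weyl.mult)
    have jw: "j \<in> weyl l"
    proof -
      obtain r where r: "\<forall>i<l. r i \<in> wspace l 0" "j = (\<Sum>i<l. r i * (iota l i - scal (of_real (bar (shift_par lam th) i))))"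
        using j(1) unfolding AD_ideal_eq iota_ideal_def by blast
      then show ?thesis by (auto intro!: sum_weyl weyl.mult weyl.scal diff_weyl dest: wspace_weyl)
    qed
    have "j * Q \<in> B_ideal l lam"
      using j(1) unfolding AD_ideal_eq B_ideal_eq
      by (rule iota_ideal_mult_right[OF _ assms(2)])
        (auto simp: bar_def shift_par_def intro!: weyl.mult wspace_weyl[OF assms(2)] dest: wspace_weyl)
    then have "(j * b + R * b) + j * Q \<in> B_ideal l lam"
      using left[OF jw] left[OF wspace_weyl[OF assms(1)]] linop_subgroupD(4)[OF B_ideal_subgroup] by blast
    moreover have "P * S - R * Q = (j * b + R * b) + j * Q" by (simp add: j b algebra_simps)
    ultimately show ?thesis by (simp add: B_class_eq_iff)
  qed
  moreover have "B_class l lam Q \<noteq> {}" "lcoset (AD_ideal l (shift_par lam th)) R \<noteq> {}"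
    using lcoset_self[OF B_ideal_subgroup] lcoset_self[OF J] unfolding B_class_eq by blast+
  ultimately show ?thesis by (intro UN_B_class_const) auto
qed

lemma B_right_mult:
  assumes "R \<in> wspace l 0" "Q \<in> wspace l th"
  shows "(\<Union>S\<in>B_class l lam Q. \<Union>P\<in>lcoset (AD_ideal l lam) R. B_class l lam (S * P)) = B_class l lam (Q * R)"
proof -
  have J: "linop_subgroup (AD_ideal l lam)"
    by (simp add: AD_ideal_eq iota_ideal_subgroup wspace_subgroup)
  have "B_class l lam (S * P) = B_class l lam (Q * R)"
    if PS: "P \<in> lcoset (AD_ideal l lam) R" "S \<in> B_class l lam Q" for P S
  proof -
    obtain j b where j: "j \<in> AD_ideal l lam" "P = j + R"
      and b: "b \<in> B_ideal l lam" "S = b + Q"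
      using PS unfolding lcoset_def B_class_eq image_iff by blast
    have left: "a * j \<in> B_ideal l lam" if "a \<in> weyl l" for a
      using j(1) that unfolding B_ideal_eq AD_ideal_eq
      by (rule_tac iota_ideal_mult_left) (auto intro: weyl.mult dest: wspace_weyl)
    have bw: "b \<in> weyl l"
    proof -
      obtain r where r: "\<forall>i<l. r i \<in> weyl l" "b = (\<Sum>i<l. r i * (iota l i - scal (of_real (bar lam i))))"
        using b(1) unfolding B_ideal_eq iota_ideal_def by blast
      then show ?thesis by (auto intro!: sum_weyl weyl.mult weyl.scal diff_weyl)
    qed
    have "b * R \<in> B_ideal l lam"
      using b(1) unfolding B_ideal_eq
      by (rule iota_ideal_mult_right[OF _ assms(1)]) (auto intro!: weyl.mult wspace_weyl[OF assms(1)])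
    then have "(b * j + Q * j) + b * R \<in> B_ideal l lam"
      using left[OF bw] left[OF wspace_weyl[OF assms(2)]] linop_subgroupD(4)[OF B_ideal_subgroup] by blast
    moreover have "S * P - Q * R = (b * j + Q * j) + b * R" by (simp add: j b algebra_simps)
    ultimately show ?thesis by (simp add: B_class_eq_iff)
  qed
  moreover have "B_class l lam Q \<noteq> {}" "lcoset (AD_ideal l lam) R \<noteq> {}"
    using lcoset_self[OF B_ideal_subgroup] lcoset_self[OF J] unfolding B_class_eq by blast+
  ultimately show ?thesis by (intro UN_B_class_const) auto
qed

section \<open>The matrix algebra and its quotient\<close>

definition ent_wt :: "nat \<Rightarrow> nat \<Rightarrow> nat \<Rightarrow> int" where
  "ent_wt a b = unit_deg b - unit_deg a"

lemma ent_wt_add: "ent_wt a i + ent_wt i b = ent_wt a b"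
  by (auto simp: ent_wt_def)

lemma ent_wt_self [simp]: "ent_wt a a = 0"
  by (auto simp: ent_wt_def)

lemma wspace_ent_mult: "P \<in> wspace l (ent_wt a i) \<Longrightarrow> Q \<in> wspace l (ent_wt i b) \<Longrightarrow> P * Q \<in> wspace l (ent_wt a b)"
  using wspace_mult ent_wt_add by metis

lemma mat_inv_carrier:
  "carrier (mat_weyl_inv l) = {M \<in> carrier_mat l l. \<forall>a<l. \<forall>b<l. M $$ (a, b) \<in> wspace l (ent_wt a b)}"
proof -
  have "mat_act l g M = M \<longleftrightarrow> (\<forall>a<l. \<forall>b<l. act l g (M $$ (a, b)) = scal (chr l (ent_wt a b) g) * M $$ (a, b))"
    if M: "M \<in> carrier_mat l l" and g: "g \<in> torus l" for M g
  proof -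
    have c: "chr l (ent_wt a b) g = inverse (g a) * g b" if "a < l" "b < l" for a b
      using that g by (simp add: ent_wt_def chr_diff chr_unit_deg)
    have "scal (g a * inverse (g b)) * P = Q \<longleftrightarrow> P = scal (inverse (g a) * g b) * Q" if "a < l" "b < l" for a b P Q
    proof -
      have "(g a * inverse (g b)) * (inverse (g a) * g b) = 1" "(inverse (g a) * g b) * (g a * inverse (g b)) = 1"
        using that g by (auto simp: torus_def field_simps)
      moreover have "scal c * (scal d * X) = X" if "c * d = 1" for c d X
        using that by (simp add: scal_mult flip: mult.assoc)
      ultimately show ?thesis by metis
    qed
    then show ?thesis
      using M c by (auto simp: mat_act_def mat_eq_iff)
  qed
  moreover have "elements_mat M \<subseteq> weyl l \<longleftrightarrow> (\<forall>a<l. \<forall>b<l. M $$ (a, b) \<in> weyl l)"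
    if "M \<in> carrier_mat l l" for M :: "linop mat"
    using that elements_matI[OF that] by (auto dest!: elements_matD)
  ultimately show ?thesis
    by (auto simp: mat_weyl_inv_def mat_weyl_def wspace_def)
qed

lemma mat_inv_simps:
  "M \<otimes>\<^bsub>mat_weyl_inv l\<^esub> N = M * N" "M \<oplus>\<^bsub>mat_weyl_inv l\<^esub> N = M + N"
  "\<one>\<^bsub>mat_weyl_inv l\<^esub> = 1\<^sub>m l" "\<zero>\<^bsub>mat_weyl_inv l\<^esub> = 0\<^sub>m l l"
  by (simp_all add: mat_weyl_inv_def mat_weyl_def ring_mat_def)

lemma mat_mult_entry:
  "M \<in> carrier_mat l l \<Longrightarrow> N \<in> carrier_mat l l \<Longrightarrow> a < l \<Longrightarrow> b < l \<Longrightarrow>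
    (M * N) $$ (a, b) = (\<Sum>i<l. M $$ (a, i) * (N $$ (i, b) :: linop))"
  by (simp add: scalar_prod_def lessThan_atLeast0)

lemma ring_mat_inv: "ring (mat_weyl_inv l)"
proof (rule ringI)
  show "abelian_group (mat_weyl_inv l)"
  proof (rule abelian_groupI)
    fix M assume M: "M \<in> carrier (mat_weyl_inv l)"
    then have "- M \<in> carrier (mat_weyl_inv l)" by (auto simp: mat_inv_carrier wspace_uminus)
    moreover have "- M + M = 0\<^sub>m l l" using M by (auto simp: mat_inv_carrier)
    ultimately show "\<exists>N\<in>carrier (mat_weyl_inv l). N \<oplus>\<^bsub>mat_weyl_inv l\<^esub> M = \<zero>\<^bsub>mat_weyl_inv l\<^esub>"
      by (auto simp: mat_inv_simps)
  qed (auto simp: mat_inv_carrier mat_inv_simps wspace_add comm_add_mat)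
  show "Group.monoid (mat_weyl_inv l)"
  proof (rule monoidI)
    fix M N assume MN: "M \<in> carrier (mat_weyl_inv l)" "N \<in> carrier (mat_weyl_inv l)"
    then have "(M * N) $$ (a, b) \<in> wspace l (ent_wt a b)" if "a < l" "b < l" for a b
    proof -
      have "M $$ (a, i) * N $$ (i, b) \<in> wspace l (ent_wt a b)" if "i < l" for i
        using MN that \<open>a < l\<close> \<open>b < l\<close> by (intro wspace_ent_mult[of _ _ a i]) (auto simp: mat_inv_carrier)
      then show ?thesis
        using MN that by (subst mat_mult_entry) (auto simp only: mat_inv_carrier mem_Collect_eq lessThan_iff intro!: wspace_sum)
    qed
    then show "M \<otimes>\<^bsub>mat_weyl_inv l\<^esub> N \<in> carrier (mat_weyl_inv l)"
      using MN by (auto simp: mat_inv_carrier mat_inv_simps)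
  qed (auto simp: mat_inv_carrier mat_inv_simps)
qed (auto simp: mat_inv_carrier mat_inv_simps add_mult_distrib_mat mult_add_distrib_mat)

lemma mat_inv_minus:
  assumes "M \<in> carrier (mat_weyl_inv l)"
  shows "\<ominus>\<^bsub>mat_weyl_inv l\<^esub> M = - M"
proof -
  interpret ring "mat_weyl_inv l" by (rule ring_mat_inv)
  have "- M \<in> carrier (mat_weyl_inv l)" using assms by (auto simp: mat_inv_carrier wspace_uminus)
  then show ?thesis using assms
    by (intro minus_equality) (auto simp: mat_inv_simps mat_inv_carrier)
qed

text \<open>The entries at \<open>(a, b)\<close> of the ideal defining \<open>\<T>\<^sub>\<lambda>\<close>: the summand \<open>E\<^sub>b\<^sub>b\<close> of \<open>\<tau>\<^sub>b\<close> lowers the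
  parameter \<open>\<lambda>\<^sub>b\<close> by one in column \<open>b\<close>.\<close>

definition T_ent :: "nat \<Rightarrow> (nat \<Rightarrow> real) \<Rightarrow> nat \<Rightarrow> nat \<Rightarrow> linop set" where
  "T_ent l lam a b = iota_ideal l (\<lambda>i. lam i - (if i = b then 1 else 0)) (wspace l (ent_wt a b))"

lemma T_ent_subgroup: "linop_subgroup (T_ent l lam a b)"
  by (simp add: T_ent_def iota_ideal_subgroup wspace_subgroup)

definition tau_gen :: "nat \<Rightarrow> (nat \<Rightarrow> real) \<Rightarrow> nat \<Rightarrow> linop mat" where
  "tau_gen l lam i = tau l i - one_tensor l (scal (of_real (lam i)))"

lemma tau_gen_carrier [simp]: "tau_gen l lam i \<in> carrier_mat l l"
  by (simp add: tau_gen_def tau_def one_tensor_def E_tensor_def minus_carrier_mat)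

lemma tau_gen_entry:
  "a < l \<Longrightarrow> b < l \<Longrightarrow> i < l \<Longrightarrow> tau_gen l lam i $$ (a, b) =
    (if a = b then iota l i - scal (of_real (lam i - (if i = b then 1 else 0))) else 0)"
  by (auto simp: tau_gen_def tau_def one_tensor_def E_tensor_def scal_diff)

lemma tau_gen_inv: "i < l \<Longrightarrow> tau_gen l lam i \<in> carrier (mat_weyl_inv l)"
  by (auto simp: mat_inv_carrier tau_gen_entry iota_diff_wspace)

lemma mult_tau_gen_entry:
  assumes "M \<in> carrier_mat l l" "a < l" "b < l" "i < l"
  shows "(M * tau_gen l lam i) $$ (a, b) = M $$ (a, b) * (iota l i - scal (of_real (lam i - (if i = b then 1 else 0))))"
proof -
  have "(M * tau_gen l lam i) $$ (a, b) = (\<Sum>j<l. if j = b then M $$ (a, b) * tau_gen l lam i $$ (b, b) else 0)"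
    unfolding mat_mult_entry[OF assms(1) tau_gen_carrier assms(2,3)]
    by (rule sum.cong) (use assms in \<open>auto simp: tau_gen_entry\<close>)
  then show ?thesis using assms by (simp add: sum.delta tau_gen_entry)
qed

text \<open>The generators are diagonal matrices, so membership in the left ideal is decided entry by entry.\<close>

lemma T_ideal_iff:
  "X \<in> T_ideal l lam \<longleftrightarrow> X \<in> carrier_mat l l \<and> (\<forall>a<l. \<forall>b<l. X $$ (a, b) \<in> T_ent l lam a b)"
proof -
  interpret R: ring "mat_weyl_inv l" by (rule ring_mat_inv)
  have fs: "finsum (mat_weyl_inv l) (\<lambda>i. r i * tau_gen l lam i) A \<in> carrier_mat l l \<and>
    (\<forall>a<l. \<forall>b<l. finsum (mat_weyl_inv l) (\<lambda>i. r i * tau_gen l lam i) A $$ (a, b) =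
      (\<Sum>i\<in>A. r i $$ (a, b) * (iota l i - scal (of_real (lam i - (if i = b then 1 else 0))))))"
    if "finite A" "A \<subseteq> {..<l}" "\<And>i. i < l \<Longrightarrow> r i \<in> carrier (mat_weyl_inv l)" for A r
    using that(1,2)
  proof (induction A rule: finite_induct)
    case empty
    then show ?case by (simp add: mat_inv_simps)
  next
    case (insert i A)
    have c: "r j * tau_gen l lam j \<in> carrier (mat_weyl_inv l)" if "j < l" for j
      using R.m_closed[of "r j" "tau_gen l lam j"] that \<open>\<And>i. i < l \<Longrightarrow> r i \<in> carrier (mat_weyl_inv l)\<close>
      by (simp add: mat_inv_simps tau_gen_inv)
    have i: "i < l" "A \<subseteq> {..<l}" using insert.prems by auto
    have rc: "r i \<in> carrier_mat l l" using that(3)[OF i(1)] by (simp add: mat_inv_carrier)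
    have "finsum (mat_weyl_inv l) (\<lambda>i. r i * tau_gen l lam i) (insert i A) =
        r i * tau_gen l lam i + finsum (mat_weyl_inv l) (\<lambda>i. r i * tau_gen l lam i) A"
      using insert.hyps i c by (subst R.finsum_insert) (auto simp: mat_inv_simps)
    then show ?case using insert.IH[OF i(2)] insert.hyps rc i
      by (auto simp: mult_tau_gen_entry simp del: index_mult_mat)
  qed
  have ti: "X \<in> T_ideal l lam \<longleftrightarrow> (\<exists>r. (\<forall>i<l. r i \<in> carrier (mat_weyl_inv l)) \<and>
      X = finsum (mat_weyl_inv l) (\<lambda>i. r i * tau_gen l lam i) {..<l})"
    by (auto simp: T_ideal_def left_ideal_gen_def mat_inv_simps tau_gen_def Pi_iff)
  show ?thesis
  proof
    assume "X \<in> T_ideal l lam"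
    then obtain r where r: "\<forall>i<l. r i \<in> carrier (mat_weyl_inv l)"
      "X = finsum (mat_weyl_inv l) (\<lambda>i. r i * tau_gen l lam i) {..<l}" using ti by blast
    then show "X \<in> carrier_mat l l \<and> (\<forall>a<l. \<forall>b<l. X $$ (a, b) \<in> T_ent l lam a b)"
      using fs[of "{..<l}" r] by (auto simp: T_ent_def mat_inv_carrier simp del: of_real_diff intro!: iota_idealI)
  next
    assume X: "X \<in> carrier_mat l l \<and> (\<forall>a<l. \<forall>b<l. X $$ (a, b) \<in> T_ent l lam a b)"
    define good where "good a b r \<longleftrightarrow> (\<forall>i<l. r i \<in> wspace l (ent_wt a b)) \<and>
      X $$ (a, b) = (\<Sum>i<l. r i * (iota l i - scal (of_real (lam i - (if i = b then 1 else 0)))))" for a b r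
    have "\<exists>r. good a b r" if "a < l" "b < l" for a b
      using X that unfolding good_def T_ent_def iota_ideal_def by blast
    then obtain r where "\<And>a b. a < l \<Longrightarrow> b < l \<Longrightarrow> good a b (r a b)" by metis
    then have r: "\<And>a b. a < l \<Longrightarrow> b < l \<Longrightarrow> (\<forall>i<l. r a b i \<in> wspace l (ent_wt a b)) \<and>
      X $$ (a, b) = (\<Sum>i<l. r a b i * (iota l i - scal (of_real (lam i - (if i = b then 1 else 0)))))"
      unfolding good_def by blast
    define R where "R i = mat l l (\<lambda>(a, b). r a b i)" for i
    have R: "R i \<in> carrier (mat_weyl_inv l)" if "i < l" for i
      using r that by (auto simp: R_def mat_inv_carrier)
    have "X = finsum (mat_weyl_inv l) (\<lambda>i. R i * tau_gen l lam i) {..<l}"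
      using fs[of "{..<l}" R] X r R by (intro eq_matI) (auto simp: R_def)
    then show "X \<in> T_ideal l lam" using ti R by blast
  qed
qed

lemma T_ideal_zero: "0\<^sub>m l l \<in> T_ideal l lam"
  using linop_subgroupD(1)[OF T_ent_subgroup] by (auto simp: T_ideal_iff)

lemma T_ideal_subset: "X \<in> T_ideal l lam \<Longrightarrow> X \<in> carrier (mat_weyl_inv l)"
proof -
  assume X: "X \<in> T_ideal l lam"
  have "x \<in> wspace l (ent_wt a b)" if x: "x \<in> T_ent l lam a b" for x a b
  proof -
    obtain r where "\<forall>i<l. r i \<in> wspace l (ent_wt a b)"
      "x = (\<Sum>i<l. r i * (iota l i - scal (of_real (lam i - (if i = b then 1 else 0)))))"
      using x unfolding T_ent_def iota_ideal_def by blast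
    then show ?thesis
      using wspace_mult[OF _ iota_diff_wspace] by (auto intro!: wspace_sum)
  qed
  then show ?thesis using X by (auto simp: T_ideal_iff mat_inv_carrier)
qed

text \<open>The left ideal is two-sided because the \<open>\<tau>\<^sub>i\<close> are central: the weight \<open>\<epsilon>\<^sub>b - \<epsilon>\<^sub>i\<close> of an entry at
  \<open>(i, b)\<close> shifts \<open>\<iota>\<close> by exactly the difference of the corrections in the columns \<open>i\<close> and \<open>b\<close>.\<close>

lemma T_ideal_ideal: "ideal (T_ideal l lam) (mat_weyl_inv l)"
proof (rule idealI[OF ring_mat_inv])
  interpret R: ring "mat_weyl_inv l" by (rule ring_mat_inv)
  note sg = linop_subgroupD[OF T_ent_subgroup]
  show "subgroup (T_ideal l lam) (add_monoid (mat_weyl_inv l))"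
  proof (rule group.subgroupI[OF R.a_group])
    show "T_ideal l lam \<subseteq> carrier (add_monoid (mat_weyl_inv l))" using T_ideal_subset by auto
    show "T_ideal l lam \<noteq> {}" using T_ideal_zero by blast
    show "inv\<^bsub>add_monoid (mat_weyl_inv l)\<^esub> M \<in> T_ideal l lam" if "M \<in> T_ideal l lam" for M
    proof -
      have "inv\<^bsub>add_monoid (mat_weyl_inv l)\<^esub> M = - M"
        using mat_inv_minus[OF T_ideal_subset[OF that]] by (simp add: a_inv_def)
      then show ?thesis using that sg(3) by (auto simp: T_ideal_iff)
    qed
    show "M \<otimes>\<^bsub>add_monoid (mat_weyl_inv l)\<^esub> N \<in> T_ideal l lam"
      if "M \<in> T_ideal l lam" "N \<in> T_ideal l lam" for M N
      using that sg(4) by (auto simp: T_ideal_iff mat_inv_simps)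
  qed
next
  fix M N assume M: "M \<in> T_ideal l lam" and N: "N \<in> carrier (mat_weyl_inv l)"
  show "N \<otimes>\<^bsub>mat_weyl_inv l\<^esub> M \<in> T_ideal l lam"
  proof -
    have "N $$ (a, i) * M $$ (i, b) \<in> T_ent l lam a b" if "a < l" "b < l" "i < l" for a b i
      using M N that unfolding T_ent_def T_ideal_iff mat_inv_carrier
      by (intro iota_ideal_mult_left[of _ _ _ "wspace l (ent_wt i b)"] wspace_ent_mult[of _ _ a i]) auto
    then show ?thesis using M N unfolding T_ideal_iff mat_inv_carrier mat_inv_simps
      by (auto simp: mat_mult_entry simp del: index_mult_mat(1) intro!: linop_subgroup_sum[OF T_ent_subgroup])
  qed
  have right: "x * Q \<in> T_ent l lam a b" if "x \<in> T_ent l lam a i" "Q \<in> wspace l (ent_wt i b)" for x Q a b i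
    using that(1) unfolding T_ent_def
    by (rule iota_ideal_mult_right[OF _ that(2)])
      (auto simp: ent_wt_def unit_deg_def intro: wspace_ent_mult[OF _ that(2), unfolded ent_wt_def])
  show "M \<otimes>\<^bsub>mat_weyl_inv l\<^esub> N \<in> T_ideal l lam"
  proof -
    have "M $$ (a, i) * N $$ (i, b) \<in> T_ent l lam a b" if "a < l" "b < l" "i < l" for a b i
      using M N that unfolding T_ideal_iff mat_inv_carrier by (intro right[of _ a i]) auto
    then show ?thesis using M N unfolding T_ideal_iff mat_inv_carrier mat_inv_simps
      by (auto simp: mat_mult_entry simp del: index_mult_mat(1) intro!: linop_subgroup_sum[OF T_ent_subgroup])
  qed
qed

lemma T_alg_ring: "ring (T_alg l lam)"
  unfolding T_alg_def by (rule ideal.quotient_is_ring[OF T_ideal_ideal])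

lemma abelian_subgroup_of_additive: "ring R \<Longrightarrow> additive_subgroup J R \<Longrightarrow> abelian_subgroup J R"
  by (rule abelian_subgroupI3) (auto dest: ring.is_abelian_group)

lemma a_coset_eq_iff:
  assumes "ring R" "additive_subgroup J R" "x \<in> carrier R" "y \<in> carrier R"
  shows "J +>\<^bsub>R\<^esub> x = J +>\<^bsub>R\<^esub> y \<longleftrightarrow> x \<ominus>\<^bsub>R\<^esub> y \<in> J"
proof -
  interpret abelian_subgroup J R by (rule abelian_subgroup_of_additive[OF assms(1,2)])
  have "J +>\<^bsub>R\<^esub> x = J +>\<^bsub>R\<^esub> y \<longleftrightarrow> x \<in> J +>\<^bsub>R\<^esub> y"
    using a_repr_independence'[of x y] a_repr_independenceD[of x y] assms(3,4) by auto
  then show ?thesis using a_rcos_module_minus[OF assms(1,4,3)] by simp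
qed

lemma T_carrier: "carrier (T_alg l lam) = T_class l lam ` carrier (mat_weyl_inv l)"
  by (auto simp: T_alg_def FactRing_def A_RCOSETS_def' T_class_def)

lemma T_class_closed [intro]: "M \<in> carrier (mat_weyl_inv l) \<Longrightarrow> T_class l lam M \<in> carrier (T_alg l lam)"
  by (simp add: T_carrier)

lemma T_class_mult:
  "M \<in> carrier (mat_weyl_inv l) \<Longrightarrow> N \<in> carrier (mat_weyl_inv l) \<Longrightarrow>
    T_class l lam M \<otimes>\<^bsub>T_alg l lam\<^esub> T_class l lam N = T_class l lam (M * N)"
  unfolding T_alg_def T_class_def
  by (simp add: FactRing_def ideal.rcoset_mult_add[OF T_ideal_ideal] mat_inv_simps)

lemma T_class_add:
  assumes "M \<in> carrier (mat_weyl_inv l)" "N \<in> carrier (mat_weyl_inv l)"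
  shows "T_class l lam M \<oplus>\<^bsub>T_alg l lam\<^esub> T_class l lam N = T_class l lam (M + N)"
proof -
  interpret abelian_subgroup "T_ideal l lam" "mat_weyl_inv l"
    by (rule abelian_subgroup_of_additive[OF ring_mat_inv ideal.axioms(1)[OF T_ideal_ideal]])
  show ?thesis using a_rcos_sum[OF assms]
    by (simp add: T_alg_def T_class_def FactRing_def mat_inv_simps)
qed

lemma T_class_eq_iff:
  assumes "M \<in> carrier (mat_weyl_inv l)" "N \<in> carrier (mat_weyl_inv l)"
  shows "T_class l lam M = T_class l lam N \<longleftrightarrow> (\<forall>a<l. \<forall>b<l. M $$ (a, b) - N $$ (a, b) \<in> T_ent l lam a b)"
proof -
  have "M \<ominus>\<^bsub>mat_weyl_inv l\<^esub> N = M + - N"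
    using assms by (simp add: a_minus_def mat_inv_minus mat_inv_simps)
  then show ?thesis using assms
    by (auto simp: T_class_def a_coset_eq_iff[OF ring_mat_inv ideal.axioms(1)[OF T_ideal_ideal] assms]
        T_ideal_iff mat_inv_carrier)
qed

lemma T_class_minus:
  assumes "M \<in> carrier (mat_weyl_inv l)" "N \<in> carrier (mat_weyl_inv l)"
  shows "T_class l lam M \<ominus>\<^bsub>T_alg l lam\<^esub> T_class l lam N = T_class l lam (M - N)"
proof -
  interpret T: ring "T_alg l lam" by (rule T_alg_ring)
  have c: "M - N \<in> carrier (mat_weyl_inv l)" using assms by (auto simp: mat_inv_carrier wspace_diff)
  have "T_class l lam (M - N) \<oplus>\<^bsub>T_alg l lam\<^esub> T_class l lam N = T_class l lam M"
  proof -
    have "M - N + N = M" using assms by (intro eq_matI) (auto simp: mat_inv_carrier)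
    then show ?thesis using T_class_add[OF c assms(2)] by simp
  qed
  then have "T_class l lam M \<ominus>\<^bsub>T_alg l lam\<^esub> T_class l lam N =
      (T_class l lam (M - N) \<oplus>\<^bsub>T_alg l lam\<^esub> T_class l lam N) \<ominus>\<^bsub>T_alg l lam\<^esub> T_class l lam N" by simp
  also have "\<dots> = T_class l lam (M - N)"
    using T_class_closed[OF c, of lam] T_class_closed[OF assms(2), of lam]
    by (simp add: T.minus_eq T.a_assoc T.r_neg)
  finally show ?thesis .
qed

lemma E_tensor_carrier [simp]: "E_tensor l i j P \<in> carrier_mat l l"
  by (simp add: E_tensor_def)

lemma E_tensor_dim [simp]: "dim_row (E_tensor l i j P) = l" "dim_col (E_tensor l i j P) = l"
  by (simp_all add: E_tensor_def)

lemma E_tensor_entry: "a < l \<Longrightarrow> b < l \<Longrightarrow> E_tensor l i j P $$ (a, b) = (if a = i \<and> b = j then P else 0)"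
  by (simp add: E_tensor_def)

lemma E_tensor_inv: "P \<in> wspace l (ent_wt i j) \<Longrightarrow> E_tensor l i j P \<in> carrier (mat_weyl_inv l)"
  by (auto simp: mat_inv_carrier E_tensor_entry)

lemma E_tensor_mult_left:
  assumes "M \<in> carrier_mat l l" "i < l" "j < l" "a < l" "b < l"
  shows "(E_tensor l i j P * M) $$ (a, b) = (if a = i then P * M $$ (j, b) else 0)"
proof -
  have "(E_tensor l i j P * M) $$ (a, b) = (\<Sum>k<l. if k = j then (if a = i then P * M $$ (j, b) else 0) else 0)"
    unfolding mat_mult_entry[OF E_tensor_carrier assms(1,4,5)]
    by (rule sum.cong) (use assms in \<open>auto simp: E_tensor_entry\<close>)
  then show ?thesis using assms by (simp add: sum.delta)
qed

lemma E_tensor_mult_right: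
  assumes "M \<in> carrier_mat l l" "i < l" "j < l" "a < l" "b < l"
  shows "(M * E_tensor l i j P) $$ (a, b) = (if b = j then M $$ (a, i) * P else 0)"
proof -
  have "(M * E_tensor l i j P) $$ (a, b) = (\<Sum>k<l. if k = i then (if b = j then M $$ (a, i) * P else 0) else 0)"
    unfolding mat_mult_entry[OF assms(1) E_tensor_carrier assms(4,5)]
    by (rule sum.cong) (use assms in \<open>auto simp: E_tensor_entry\<close>)
  then show ?thesis using assms by (simp add: sum.delta)
qed

lemma E_tensor_mult: "i < l \<Longrightarrow> j < l \<Longrightarrow> k < l \<Longrightarrow> E_tensor l i j P * E_tensor l j k Q = E_tensor l i k (P * Q)"
  by (rule eq_matI) (auto simp: E_tensor_mult_left E_tensor_entry simp del: index_mult_mat(1))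

lemma E_tensor_corner:
  assumes "M \<in> carrier_mat l l" "i < l" "j < l"
  shows "E_tensor l i i 1 * M * E_tensor l j j 1 = E_tensor l i j (M $$ (i, j))"
proof (rule eq_matI)
  fix a b assume ab: "a < dim_row (E_tensor l i j (M $$ (i, j)))" "b < dim_col (E_tensor l i j (M $$ (i, j)))"
  have c: "E_tensor l i i 1 * M \<in> carrier_mat l l" by (rule mult_carrier_mat[OF E_tensor_carrier assms(1)])
  from ab have ab: "a < l" "b < l" by (auto simp: E_tensor_def)
  show "(E_tensor l i i 1 * M * E_tensor l j j 1) $$ (a, b) = E_tensor l i j (M $$ (i, j)) $$ (a, b)"
    using ab assms unfolding E_tensor_mult_right[OF c assms(3,3) ab]
    by (auto simp: E_tensor_mult_left E_tensor_entry simp del: index_mult_mat(1))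
qed (use assms in \<open>auto simp: E_tensor_def\<close>)

lemma A_carrier:
  assumes "l \<ge> 1"
  shows "carrier (A_alg l lam) = (\<lambda>R. T_class l lam (E_tensor l 0 0 R)) ` wspace l 0"
proof -
  have e: "E_tensor l 0 0 1 \<in> carrier (mat_weyl_inv l)" by (rule E_tensor_inv) simp
  interpret R: ring "mat_weyl_inv l" by (rule ring_mat_inv)
  have *: "T_e l lam 0 \<otimes>\<^bsub>T_alg l lam\<^esub> T_class l lam M \<otimes>\<^bsub>T_alg l lam\<^esub> T_e l lam 0 =
      T_class l lam (E_tensor l 0 0 (M $$ (0, 0)))" if M: "M \<in> carrier (mat_weyl_inv l)" for M
  proof -
    have "E_tensor l 0 0 1 * M \<in> carrier (mat_weyl_inv l)"
      using R.m_closed[OF e M] by (simp add: mat_inv_simps)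
    then show ?thesis using M e assms E_tensor_corner[of M l 0 0]
      by (simp add: T_e_def T_class_mult mat_inv_carrier)
  qed
  show ?thesis
  proof (intro equalityI subsetI)
    fix x assume "x \<in> carrier (A_alg l lam)"
    then obtain M where M: "M \<in> carrier (mat_weyl_inv l)"
      "x = T_e l lam 0 \<otimes>\<^bsub>T_alg l lam\<^esub> T_class l lam M \<otimes>\<^bsub>T_alg l lam\<^esub> T_e l lam 0"
      by (auto simp: A_alg_def T_carrier)
    moreover have "M $$ (0, 0) \<in> wspace l (ent_wt 0 0)"
      using M(1) assms by (auto simp: mat_inv_carrier simp del: ent_wt_self)
    ultimately show "x \<in> (\<lambda>R. T_class l lam (E_tensor l 0 0 R)) ` wspace l 0"
      using *[OF M(1)] unfolding ent_wt_self by blast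
  next
    fix x assume "x \<in> (\<lambda>R. T_class l lam (E_tensor l 0 0 R)) ` wspace l 0"
    then obtain R where R: "R \<in> wspace l 0" "x = T_class l lam (E_tensor l 0 0 R)" by blast
    have E: "E_tensor l 0 0 R \<in> carrier (mat_weyl_inv l)" using R by (intro E_tensor_inv) simp
    have "x = T_e l lam 0 \<otimes>\<^bsub>T_alg l lam\<^esub> T_class l lam (E_tensor l 0 0 R) \<otimes>\<^bsub>T_alg l lam\<^esub> T_e l lam 0"
      using *[OF E] R assms by (simp add: E_tensor_entry)
    then show "x \<in> carrier (A_alg l lam)" using E by (auto simp: A_alg_def)
  qed
qed

lemma A_to_AD_class:
  assumes "l \<ge> 1" "R \<in> wspace l 0"
  shows "A_to_AD l lam (T_class l lam (E_tensor l 0 0 R)) = lcoset (AD_ideal l lam) R"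
proof -
  have eq: "AD_ideal l lam = T_ent l lam 0 0"
    by (simp add: AD_ideal_eq T_ent_def bar_def[abs_def] zero_fun_def[symmetric])
  have J: "linop_subgroup (AD_ideal l lam)" unfolding eq by (rule T_ent_subgroup)
  have c: "AD_ideal l lam +>\<^bsub>weyl_inv l\<^esub> x = lcoset (AD_ideal l lam) x" for x
    by (auto simp: a_r_coset_def' weyl_inv_eq lcoset_def)
  have "lcoset (AD_ideal l lam) (M $$ (0, 0)) = lcoset (AD_ideal l lam) R"
    if M: "M \<in> T_class l lam (E_tensor l 0 0 R)" for M
  proof -
    obtain h where h: "h \<in> T_ideal l lam" "M = h + E_tensor l 0 0 R"
      using M unfolding T_class_def a_r_coset_def' mat_inv_simps by blast
    then have "M $$ (0, 0) = h $$ (0, 0) + R" using assms by (simp add: E_tensor_entry E_tensor_def T_ideal_iff)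
    moreover have "h $$ (0, 0) \<in> AD_ideal l lam" using h(1) assms unfolding eq by (auto simp: T_ideal_iff)
    ultimately show ?thesis by (simp add: lcoset_eq_iff[OF J])
  qed
  moreover have "0\<^sub>m l l + E_tensor l 0 0 R \<in> T_class l lam (E_tensor l 0 0 R)"
    unfolding T_class_def a_r_coset_def' mat_inv_simps using T_ideal_zero by blast
  ultimately show ?thesis unfolding A_to_AD_def c by (intro UN_B_class_const) auto
qed

section \<open>Standard modules\<close>

text \<open>The class of \<open>E\<^sub>0\<^sub>k \<otimes> P\<close> in \<open>e\<^sub>0 \<Delta>\<^sub>\<lambda>(k)\<close>, that is, \<open>P 1\<^sub>k\<close>.\<close>

definition vec :: "nat \<Rightarrow> (nat \<Rightarrow> real) \<Rightarrow> nat \<Rightarrow> linop \<Rightarrow> linop mat set set" where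
  "vec l lam k P = TA_star l lam +>\<^bsub>T_alg l lam\<^esub> T_class l lam (E_tensor l 0 k P)"

lemma tvar_wspace: "i < l \<Longrightarrow> tvar i \<in> wspace l (ent_wt i (cpred l i))"
  by (rule weyl_deg_wspace[OF weyl_deg.tvar]) (auto simp: deg_wt_unit_deg ent_wt_def)

lemma pdiff_wspace: "i < l \<Longrightarrow> pdiff i \<in> wspace l (ent_wt (cpred l i) i)"
proof (rule weyl_deg_wspace[OF weyl_deg.pdiff])
  fix j assume "i < l" "j < l"
  then show "deg_wt l (- unit_deg i) j = ent_wt (cpred l i) i j"
    unfolding deg_wt_uminus using deg_wt_unit_deg[of i l j] by (simp add: ent_wt_def)
qed

lemma A_star_carrier [simp]: "A_star l \<in> carrier_mat l l"
  by (simp add: A_star_def)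

lemma A_star_inv: "A_star l \<in> carrier (mat_weyl_inv l)"
  by (auto simp: mat_inv_carrier A_star_def pdiff_wspace)

lemma mult_A_star_entry:
  assumes "M \<in> carrier_mat l l" "a < l" "b < l"
  shows "(M * A_star l) $$ (a, b) = M $$ (a, cpred l b) * pdiff b"
proof -
  have "(M * A_star l) $$ (a, b) = (\<Sum>j<l. if j = cpred l b then M $$ (a, cpred l b) * pdiff b else 0)"
    unfolding mat_mult_entry[OF assms(1) A_star_carrier assms(2,3)]
    by (rule sum.cong) (use assms in \<open>auto simp: A_star_def\<close>)
  then show ?thesis using assms by (simp add: sum.delta)
qed

lemma TA_star_eq: "TA_star l lam = {T_class l lam (N * A_star l) | N. N \<in> carrier (mat_weyl_inv l)}"
  unfolding TA_star_def T_carrier using A_star_inv T_class_mult by (auto simp: image_iff) metis+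

lemma TA_star_left:
  assumes "x \<in> carrier (T_alg l lam)" "j \<in> TA_star l lam"
  shows "x \<otimes>\<^bsub>T_alg l lam\<^esub> j \<in> TA_star l lam"
proof -
  interpret T: ring "T_alg l lam" by (rule T_alg_ring)
  show ?thesis using assms T_class_closed[OF A_star_inv]
    by (auto simp: TA_star_def T.m_assoc[symmetric])
qed

lemma TA_star_subgroup: "additive_subgroup (TA_star l lam) (T_alg l lam)"
proof (rule additive_subgroupI)
  interpret T: ring "T_alg l lam" by (rule T_alg_ring)
  let ?A = "T_class l lam (A_star l)"
  have A: "?A \<in> carrier (T_alg l lam)" using A_star_inv by blast
  show "subgroup (TA_star l lam) (add_monoid (T_alg l lam))"
  proof (rule group.subgroupI[OF T.a_group])
    show "TA_star l lam \<subseteq> carrier (add_monoid (T_alg l lam))" using A by (auto simp: TA_star_def)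
    show "TA_star l lam \<noteq> {}" using T.zero_closed by (auto simp: TA_star_def)
    fix x assume "x \<in> TA_star l lam"
    then obtain u where u: "u \<in> carrier (T_alg l lam)" "x = u \<otimes>\<^bsub>T_alg l lam\<^esub> ?A" by (auto simp: TA_star_def)
    have "\<ominus>\<^bsub>T_alg l lam\<^esub> x = (\<ominus>\<^bsub>T_alg l lam\<^esub> u) \<otimes>\<^bsub>T_alg l lam\<^esub> ?A" using u A by (simp add: T.l_minus)
    then have "\<ominus>\<^bsub>T_alg l lam\<^esub> x \<in> TA_star l lam"
      unfolding TA_star_def using T.a_inv_closed[OF u(1)] by blast
    then show "inv\<^bsub>add_monoid (T_alg l lam)\<^esub> x \<in> TA_star l lam" by (simp only: a_inv_def)
    fix y assume "y \<in> TA_star l lam"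
    then obtain v where v: "v \<in> carrier (T_alg l lam)" "y = v \<otimes>\<^bsub>T_alg l lam\<^esub> ?A" by (auto simp: TA_star_def)
    have "x \<oplus>\<^bsub>T_alg l lam\<^esub> y = (u \<oplus>\<^bsub>T_alg l lam\<^esub> v) \<otimes>\<^bsub>T_alg l lam\<^esub> ?A" using u v A by (simp add: T.l_distr)
    then show "x \<otimes>\<^bsub>add_monoid (T_alg l lam)\<^esub> y \<in> TA_star l lam" using u v by (auto simp: TA_star_def)
  qed
qed

text \<open>An additive map that preserves \<open>J\<close> is constant modulo \<open>J\<close> on cosets; this evaluates the unions
  over representatives by which operations on quotients are given.\<close>

lemma UN_coset_map:
  assumes "ring R" "additive_subgroup J R" "x \<in> carrier R"
    and f: "\<And>y. y \<in> carrier R \<Longrightarrow> f y \<in> carrier R"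
      "\<And>y z. y \<in> carrier R \<Longrightarrow> z \<in> carrier R \<Longrightarrow> f (y \<oplus>\<^bsub>R\<^esub> z) = f y \<oplus>\<^bsub>R\<^esub> f z"
      "\<And>y. y \<in> J \<Longrightarrow> f y \<in> J"
  shows "(\<Union>y\<in>J +>\<^bsub>R\<^esub> x. J +>\<^bsub>R\<^esub> f y) = J +>\<^bsub>R\<^esub> f x"
proof (rule UN_B_class_const)
  interpret R: ring R by fact
  interpret J: abelian_subgroup J R by (rule abelian_subgroup_of_additive[OF assms(1,2)])
  show "J +>\<^bsub>R\<^esub> x \<noteq> {}" using J.a_rcos_self[OF assms(3)] by auto
  fix y assume "y \<in> J +>\<^bsub>R\<^esub> x"
  then obtain h where h: "h \<in> J" "y = h \<oplus>\<^bsub>R\<^esub> x" by (auto simp: a_r_coset_def')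
  then have hc: "h \<in> carrier R" by simp
  have "(f h \<oplus>\<^bsub>R\<^esub> f x) \<ominus>\<^bsub>R\<^esub> f x = f h"
    using f(1)[OF hc] f(1)[OF assms(3)] by (simp add: R.minus_eq R.a_assoc R.r_neg)
  then show "J +>\<^bsub>R\<^esub> f y = J +>\<^bsub>R\<^esub> f x"
    using f hc h assms by (simp add: a_coset_eq_iff[OF assms(1,2)])
qed

lemma E_star_shift:
  assumes "k < l" shows "A_star l * E_tensor l k k 1 = E_tensor l (cpred l k) (cpred l k) 1 * A_star l"
proof (rule eq_matI)
  fix a b assume "a < dim_row (E_tensor l (cpred l k) (cpred l k) 1 * A_star l)"
    "b < dim_col (E_tensor l (cpred l k) (cpred l k) 1 * A_star l)"
  then have ab: "a < l" "b < l" by (simp_all add: E_tensor_def A_star_def)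
  show "(A_star l * E_tensor l k k 1) $$ (a, b) = (E_tensor l (cpred l k) (cpred l k) 1 * A_star l) $$ (a, b)"
    unfolding E_tensor_mult_right[OF A_star_carrier assms assms ab]
      mult_A_star_entry[OF E_tensor_carrier ab]
    using ab assms by (auto simp: A_star_def E_tensor_entry) (metis csucc_cpred)+
qed (simp_all add: E_tensor_def A_star_def)

lemma TA_star_right_e:
  assumes "j \<in> TA_star l lam" "k < l"
  shows "j \<otimes>\<^bsub>T_alg l lam\<^esub> T_e l lam k \<in> TA_star l lam"
proof -
  interpret R: ring "mat_weyl_inv l" by (rule ring_mat_inv)
  have E: "E_tensor l i i 1 \<in> carrier (mat_weyl_inv l)" for i by (rule E_tensor_inv) simp
  obtain N where N: "N \<in> carrier (mat_weyl_inv l)" "j = T_class l lam (N * A_star l)"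
    using assms by (auto simp: TA_star_eq)
  have NA: "N * A_star l \<in> carrier (mat_weyl_inv l)"
    using R.m_closed[OF N(1) A_star_inv] by (simp add: mat_inv_simps)
  have NE: "N * E_tensor l (cpred l k) (cpred l k) 1 \<in> carrier (mat_weyl_inv l)"
    using R.m_closed[OF N(1) E] by (simp add: mat_inv_simps)
  have "N * A_star l * E_tensor l k k 1 = N * (A_star l * E_tensor l k k 1)"
    using R.m_assoc[OF N(1) A_star_inv E] by (simp add: mat_inv_simps)
  also have "\<dots> = N * E_tensor l (cpred l k) (cpred l k) 1 * A_star l"
    unfolding E_star_shift[OF assms(2)] using R.m_assoc[OF N(1) E A_star_inv] by (simp add: mat_inv_simps)
  finally show ?thesis using NE unfolding N(2) T_e_def T_class_mult[OF NA E] by (auto simp: TA_star_eq)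
qed

lemma Delta_carrier:
  assumes "k < l"
  shows "carrier (Delta l lam k) =
    (\<lambda>M. TA_star l lam +>\<^bsub>T_alg l lam\<^esub> T_class l lam (M * E_tensor l k k 1)) ` carrier (mat_weyl_inv l)"
proof -
  interpret T: ring "T_alg l lam" by (rule T_alg_ring)
  have E: "E_tensor l k k 1 \<in> carrier (mat_weyl_inv l)" by (rule E_tensor_inv) simp
  then have e: "T_e l lam k \<in> carrier (T_alg l lam)" unfolding T_e_def by blast
  have *: "(\<Union>x\<in>TA_star l lam +>\<^bsub>T_alg l lam\<^esub> T_class l lam M.
      TA_star l lam +>\<^bsub>T_alg l lam\<^esub> (x \<otimes>\<^bsub>T_alg l lam\<^esub> T_e l lam k)) =
      TA_star l lam +>\<^bsub>T_alg l lam\<^esub> T_class l lam (M * E_tensor l k k 1)" if M: "M \<in> carrier (mat_weyl_inv l)" for M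
  proof -
    have "(\<Union>x\<in>TA_star l lam +>\<^bsub>T_alg l lam\<^esub> T_class l lam M.
      TA_star l lam +>\<^bsub>T_alg l lam\<^esub> (x \<otimes>\<^bsub>T_alg l lam\<^esub> T_e l lam k)) =
      TA_star l lam +>\<^bsub>T_alg l lam\<^esub> (T_class l lam M \<otimes>\<^bsub>T_alg l lam\<^esub> T_e l lam k)"
      by (rule UN_coset_map[OF T_alg_ring TA_star_subgroup T_class_closed[OF M]])
        (use e TA_star_right_e assms in \<open>auto simp: T.l_distr\<close>)
    then show ?thesis by (simp add: T_e_def T_class_mult M E)
  qed
  have "carrier (left_quot (T_alg l lam) (TA_star l lam)) =
      (\<lambda>M. TA_star l lam +>\<^bsub>T_alg l lam\<^esub> T_class l lam M) ` carrier (mat_weyl_inv l)"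
    by (auto simp: left_quot_def A_RCOSETS_def' T_carrier)
  then show ?thesis by (auto simp: Delta_def Let_def * image_iff) (metis *)+
qed

lemma Delta_smult:
  assumes "M \<in> carrier (mat_weyl_inv l)" "N \<in> carrier (mat_weyl_inv l)"
  shows "T_class l lam M \<odot>\<^bsub>Delta l lam k\<^esub> (TA_star l lam +>\<^bsub>T_alg l lam\<^esub> T_class l lam N) =
    TA_star l lam +>\<^bsub>T_alg l lam\<^esub> T_class l lam (M * N)"
proof -
  interpret T: ring "T_alg l lam" by (rule T_alg_ring)
  have "(\<Union>x\<in>TA_star l lam +>\<^bsub>T_alg l lam\<^esub> T_class l lam N.
      TA_star l lam +>\<^bsub>T_alg l lam\<^esub> (T_class l lam M \<otimes>\<^bsub>T_alg l lam\<^esub> x)) =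
      TA_star l lam +>\<^bsub>T_alg l lam\<^esub> (T_class l lam M \<otimes>\<^bsub>T_alg l lam\<^esub> T_class l lam N)"
    by (rule UN_coset_map[OF T_alg_ring TA_star_subgroup])
      (use assms T_class_closed TA_star_left in \<open>auto simp: T.r_distr\<close>)
  then show ?thesis by (simp add: Delta_def Let_def left_quot_def T_class_mult assms)
qed

lemma e0_Delta_carrier:
  assumes "k < l"
  shows "carrier (e0_Delta l lam k) = vec l lam k ` wspace l (ent_wt 0 k)"
proof -
  interpret R: ring "mat_weyl_inv l" by (rule ring_mat_inv)
  have E: "E_tensor l i i 1 \<in> carrier (mat_weyl_inv l)" for i by (rule E_tensor_inv) simp
  have *: "T_e l lam 0 \<odot>\<^bsub>Delta l lam k\<^esub> (TA_star l lam +>\<^bsub>T_alg l lam\<^esub> T_class l lam (M * E_tensor l k k 1)) =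
      vec l lam k (M $$ (0, k))" if M: "M \<in> carrier (mat_weyl_inv l)" for M
  proof -
    have ME: "M * E_tensor l k k 1 \<in> carrier (mat_weyl_inv l)"
      using R.m_closed[OF M E] by (simp add: mat_inv_simps)
    have "E_tensor l 0 0 1 * (M * E_tensor l k k 1) = E_tensor l 0 k (M $$ (0, k))"
      using R.m_assoc[OF E M E] E_tensor_corner[of M l 0 k] M assms
      by (simp add: mat_inv_simps mat_inv_carrier)
    then show ?thesis unfolding T_e_def vec_def by (simp add: Delta_smult[OF E ME])
  qed
  have c: "carrier (e0_Delta l lam k) = (\<lambda>X. T_e l lam 0 \<odot>\<^bsub>Delta l lam k\<^esub> X) ` carrier (Delta l lam k)"
    by (auto simp: e0_Delta_def)
  have "carrier (e0_Delta l lam k) = (\<lambda>M. vec l lam k (M $$ (0, k))) ` carrier (mat_weyl_inv l)"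
    unfolding c Delta_carrier[OF assms] image_image by (rule image_cong[OF refl *])
  also have "\<dots> = vec l lam k ` wspace l (ent_wt 0 k)"
  proof (intro equalityI subsetI)
    fix x assume "x \<in> (\<lambda>M. vec l lam k (M $$ (0, k))) ` carrier (mat_weyl_inv l)"
    then show "x \<in> vec l lam k ` wspace l (ent_wt 0 k)" using assms by (auto simp: mat_inv_carrier)
  next
    fix x assume "x \<in> vec l lam k ` wspace l (ent_wt 0 k)"
    then obtain P where P: "P \<in> wspace l (ent_wt 0 k)" "x = vec l lam k P" by blast
    then have "x = vec l lam k (E_tensor l 0 k P $$ (0, k))" using assms by (simp add: E_tensor_entry)
    then show "x \<in> (\<lambda>M. vec l lam k (M $$ (0, k))) ` carrier (mat_weyl_inv l)"
      using E_tensor_inv[OF P(1)] by blast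
  qed
  finally show ?thesis .
qed

lemma vec_smult:
  assumes "0 < l" "k < l" "R \<in> wspace l 0" "P \<in> wspace l (ent_wt 0 k)"
  shows "T_class l lam (E_tensor l 0 0 R) \<odot>\<^bsub>e0_Delta l lam k\<^esub> vec l lam k P = vec l lam k (R * P)"
proof -
  have "E_tensor l 0 0 R \<in> carrier (mat_weyl_inv l)" using assms by (intro E_tensor_inv) simp
  from Delta_smult[OF this E_tensor_inv[OF assms(4)], of lam k] show ?thesis
    using assms by (simp add: e0_Delta_def vec_def E_tensor_mult)
qed

lemma vec_add:
  assumes "P \<in> wspace l (ent_wt 0 k)" "Q \<in> wspace l (ent_wt 0 k)"
  shows "vec l lam k P \<oplus>\<^bsub>e0_Delta l lam k\<^esub> vec l lam k Q = vec l lam k (P + Q)"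
proof -
  interpret J: abelian_subgroup "TA_star l lam" "T_alg l lam"
    by (rule abelian_subgroup_of_additive[OF T_alg_ring TA_star_subgroup])
  have "E_tensor l 0 k P + E_tensor l 0 k Q = E_tensor l 0 k (P + Q)"
    by (rule eq_matI) (auto simp: E_tensor_def)
  then show ?thesis
    using J.a_rcos_sum[OF T_class_closed[OF E_tensor_inv[OF assms(1)], of lam] T_class_closed[OF E_tensor_inv[OF assms(2)], of lam]]
    by (simp add: e0_Delta_def Delta_def Let_def left_quot_def vec_def T_class_add E_tensor_inv assms)
qed

text \<open>Only the entry at \<open>(0, k)\<close> matters. There a left multiple of \<open>A\<^sup>*\<close> contributes a left multiple of
  \<open>\<partial>\<^sub>k\<close>, and the relations of \<open>\<T>\<^sub>\<lambda>\<close> contribute \<open>T_ent\<close>.\<close>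

lemma vec_eq_iff:
  assumes k: "k < l" and P: "P \<in> wspace l (ent_wt 0 k)" and Q: "Q \<in> wspace l (ent_wt 0 k)"
  shows "vec l lam k P = vec l lam k Q \<longleftrightarrow>
    (\<exists>r\<in>wspace l (ent_wt 0 (cpred l k)). P - Q - r * pdiff k \<in> T_ent l lam 0 k)"
proof -
  interpret R: ring "mat_weyl_inv l" by (rule ring_mat_inv)
  have PQ: "P - Q \<in> wspace l (ent_wt 0 k)" using P Q by (rule wspace_diff)
  have E: "E_tensor l 0 k P - E_tensor l 0 k Q = E_tensor l 0 k (P - Q)"
    by (rule eq_matI) (auto simp: E_tensor_def)
  have eq: "vec l lam k P = vec l lam k Q \<longleftrightarrow> T_class l lam (E_tensor l 0 k (P - Q)) \<in> TA_star l lam"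
    unfolding vec_def
    by (simp add: a_coset_eq_iff[OF T_alg_ring TA_star_subgroup] T_class_closed E_tensor_inv P Q
        T_class_minus E)
  show ?thesis
  proof
    assume "vec l lam k P = vec l lam k Q"
    then obtain N where N: "N \<in> carrier (mat_weyl_inv l)"
      "T_class l lam (E_tensor l 0 k (P - Q)) = T_class l lam (N * A_star l)"
      unfolding eq TA_star_eq by blast
    have NA: "N * A_star l \<in> carrier (mat_weyl_inv l)"
      using R.m_closed[OF N(1) A_star_inv] by (simp add: mat_inv_simps)
    have "E_tensor l 0 k (P - Q) $$ (0, k) - (N * A_star l) $$ (0, k) \<in> T_ent l lam 0 k"
      using N(2) k unfolding T_class_eq_iff[OF E_tensor_inv[OF PQ] NA] by auto
    moreover have "N $$ (0, cpred l k) \<in> wspace l (ent_wt 0 (cpred l k))" "N \<in> carrier_mat l l"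
      using N(1) k by (auto simp: mat_inv_carrier)
    ultimately show "\<exists>r\<in>wspace l (ent_wt 0 (cpred l k)). P - Q - r * pdiff k \<in> T_ent l lam 0 k"
      using k by (auto simp: E_tensor_entry mult_A_star_entry simp del: index_mult_mat(1))
  next
    assume "\<exists>r\<in>wspace l (ent_wt 0 (cpred l k)). P - Q - r * pdiff k \<in> T_ent l lam 0 k"
    then obtain r where r: "r \<in> wspace l (ent_wt 0 (cpred l k))" "P - Q - r * pdiff k \<in> T_ent l lam 0 k"
      by blast
    define N where "N = E_tensor l 0 (cpred l k) r"
    have N: "N \<in> carrier (mat_weyl_inv l)" unfolding N_def by (rule E_tensor_inv[OF r(1)])
    have NA: "N * A_star l \<in> carrier (mat_weyl_inv l)"
      using R.m_closed[OF N A_star_inv] by (simp add: mat_inv_simps)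
    have inj: "cpred l b = cpred l k \<longleftrightarrow> b = k" if "b < l" for b using that k by (metis csucc_cpred)
    have "E_tensor l 0 k (P - Q) $$ (a, b) - (N * A_star l) $$ (a, b) \<in> T_ent l lam a b" if "a < l" "b < l" for a b
    proof -
      have "(N * A_star l) $$ (a, b) = (if a = 0 \<and> b = k then r * pdiff k else 0)"
        using that inj by (simp add: N_def mult_A_star_entry E_tensor_entry del: index_mult_mat(1))
      then show ?thesis using r(2) that linop_subgroupD(1)[OF T_ent_subgroup] by (auto simp: E_tensor_entry)
    qed
    then have "T_class l lam (E_tensor l 0 k (P - Q)) = T_class l lam (N * A_star l)"
      unfolding T_class_eq_iff[OF E_tensor_inv[OF PQ] NA] by blast
    then show "vec l lam k P = vec l lam k Q" unfolding eq TA_star_eq using N by blast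
  qed
qed

section \<open>The standard module as a space of monomials\<close>

definition cdeg :: "nat list \<Rightarrow> nat \<Rightarrow> int" where
  "cdeg xs i = int (count_list xs i)"

lemma cdeg_Cons: "cdeg (x # xs) = unit_deg x + cdeg xs"
  by (auto simp: cdeg_def unit_deg_def)

lemma count_list_distinct: "distinct xs \<Longrightarrow> count_list xs i = (if i \<in> set xs then 1 else 0)"
  by (induction xs) auto

lemma cdeg_Nil: "cdeg [] i = 0"
  by (simp add: cdeg_def)

lemma weyl_deg_tvars: "set xs \<subseteq> {..<l} \<Longrightarrow> weyl_deg l (cdeg xs) (prod_list (map tvar xs))"
proof (induction xs)
  case Nil
  have "weyl_deg l 0 (prod_list (map tvar []))" by (simp add: weyl_deg_one)
  then show ?case by (rule weyl_deg_cong) (simp add: cdeg_Nil)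
next
  case (Cons x xs)
  then have "weyl_deg l (unit_deg x + cdeg xs) (tvar x * prod_list (map tvar xs))"
    by (intro weyl_deg.mult weyl_deg.tvar) auto
  then show ?case by (simp only: cdeg_Cons list.map prod_list.Cons)
qed

lemma weyl_deg_pdiffs: "set xs \<subseteq> {..<l} \<Longrightarrow> weyl_deg l (- cdeg xs) (prod_list (map pdiff xs))"
proof (induction xs)
  case Nil
  have "weyl_deg l 0 (prod_list (map pdiff []))" by (simp add: weyl_deg_one)
  then show ?case by (rule weyl_deg_cong) (simp add: cdeg_Nil)
next
  case (Cons x xs)
  have x: "x < l" "set xs \<subseteq> {..<l}" using Cons.prems by auto
  have "weyl_deg l (- unit_deg x + - cdeg xs) (pdiff x * prod_list (map pdiff xs))"
    by (intro weyl_deg.mult weyl_deg.pdiff x Cons.IH)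
  then have "weyl_deg l (- unit_deg x + - cdeg xs) (prod_list (map pdiff (x # xs)))" by simp
  then show ?case by (rule weyl_deg_cong) (simp add: cdeg_Cons)
qed

lemma rho_tvars:
  "set xs \<subseteq> {..<l} \<Longrightarrow> rho l (prod_list (map tvar xs)) (tmon x) = tmon (shift (cdeg xs) x)"
proof (induction xs)
  case Nil
  have "shift (cdeg []) x = x" by (auto simp: shift_def cdeg_Nil)
  then show ?case by (simp add: rho_1)
next
  case (Cons y ys)
  have y: "y < l" "set ys \<subseteq> {..<l}" using Cons.prems by auto
  then have "prod_list (map tvar ys) \<in> weyl l" using weyl_deg_tvars weyl_deg_weyl by blast
  then have "rho l (tvar y * prod_list (map tvar ys)) (tmon x) = tmon (shift (unit_deg y + cdeg ys) x)"
    using y by (simp only: rho_mult weyl.tvar Cons.IH rho_tvar shift_shift)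
  then show ?case by (simp only: cdeg_Cons list.map prod_list.Cons)
qed

text \<open>Successive derivatives in direction \<open>i\<close> multiply \<open>t\<^sup>x\<close> by \<open>x\<^sub>i\<close>, \<open>x\<^sub>i - 1\<close>, and so on. A factor zero
  appears only if \<open>x\<^sub>i\<close> is natural and smaller than the number of these derivatives.\<close>

lemma rho_pdiffs:
  assumes "set xs \<subseteq> {..<l}" "\<And>i n. i \<in> set xs \<Longrightarrow> n < count_list xs i \<Longrightarrow> x i \<noteq> real n"
  shows "\<exists>c. c \<noteq> 0 \<and> rho l (prod_list (map pdiff xs)) (tmon x) = smul c (tmon (shift (- cdeg xs) x))"
  using assms
proof (induction xs)
  case Nil
  have "shift (- cdeg []) x = x" by (auto simp: shift_def cdeg_Nil)
  then have "rho l (prod_list (map pdiff [])) (tmon x) = smul 1 (tmon (shift (- cdeg []) x))"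
    by (simp only: list.map prod_list.Nil rho_1) (simp add: smul_def)
  then show ?case using one_neq_zero[where 'a = complex] by blast
next
  case (Cons y ys)
  have y: "y < l" "set ys \<subseteq> {..<l}" using Cons.prems by auto
  have "\<And>i n. i \<in> set ys \<Longrightarrow> n < count_list ys i \<Longrightarrow> x i \<noteq> real n"
    using Cons.prems(2) by (metis count_list.simps(2) less_SucI list.set_intros(2) add.commute plus_1_eq_Suc)
  then obtain c where c: "c \<noteq> 0" "rho l (prod_list (map pdiff ys)) (tmon x) = smul c (tmon (shift (- cdeg ys) x))"
    using Cons.IH[OF y(2)] by blast
  have w: "prod_list (map pdiff ys) \<in> weyl l" using weyl_deg_pdiffs[OF y(2)] weyl_deg_weyl by blast
  let ?z = "shift (- cdeg ys) x"
  have z: "?z y \<noteq> 0" using Cons.prems(2)[of y "count_list ys y"] by (simp add: shift_def cdeg_def)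
  have s: "- unit_deg y + - cdeg ys = - cdeg (y # ys)" by (auto simp: cdeg_Cons)
  have "rho l (pdiff y * prod_list (map pdiff ys)) (tmon x) =
      smul (c * of_real (?z y)) (tmon (shift (- unit_deg y + - cdeg ys) x))"
    using y w by (simp only: rho_mult weyl.pdiff c(2) rho_linear rho_pdiff smul_smul shift_shift)
  then have "rho l (prod_list (map pdiff (y # ys))) (tmon x) =
      smul (c * of_real (?z y)) (tmon (shift (- cdeg (y # ys)) x))" by (simp only: s) simp
  moreover have "c * of_real (?z y) \<noteq> 0" using c(1) z by simp
  ultimately show ?case by blast
qed

text \<open>The exponent of the highest weight vector \<open>e\<^sub>0 t\<^sub>0 t\<^sub>l\<^sub>-\<^sub>1 \<cdots> t\<^sub>k\<^sub>+\<^sub>1 1\<^sub>k\<close> of \<open>e\<^sub>0 \<Delta>\<^sub>\<lambda>(k)\<close>.\<close>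

definition hw_exp :: "nat \<Rightarrow> (nat \<Rightarrow> real) \<Rightarrow> nat \<Rightarrow> nat \<Rightarrow> real" where
  "hw_exp l lam k i = (if i < l then (\<Sum>j<i. bar lam j) - (\<Sum>j<k. bar lam j) else 0)"

definition path_deg :: "nat \<Rightarrow> nat \<Rightarrow> nat \<Rightarrow> int" where
  "path_deg l k i = (if k \<noteq> 0 \<and> i < l \<and> (i = 0 \<or> k < i) then 1 else 0)"

text \<open>The exponent of \<open>1\<^sub>k\<close>.\<close>

definition gen_exp :: "nat \<Rightarrow> (nat \<Rightarrow> real) \<Rightarrow> nat \<Rightarrow> nat \<Rightarrow> real" where
  "gen_exp l lam k = shift (- path_deg l k) (hw_exp l lam k)"

lemma t_path_word:
  assumes "k < l"
  obtains xs where "set xs \<subseteq> {..<l}" "t_path l k = prod_list (map tvar xs)" "cdeg xs = path_deg l k"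
proof (cases "k = 0")
  case True
  then have "t_path l k = prod_list (map tvar [])" by (simp add: t_path_def)
  moreover have "cdeg [] = path_deg l k" using True by (auto simp: cdeg_Nil path_deg_def)
  ultimately show thesis using that[of "[]"] by simp
next
  case False
  let ?xs = "0 # rev [k + 1..<l]"
  have "count_list (rev [k + 1..<l]) i = (if k < i \<and> i < l then 1 else 0)" for i
    by (subst count_list_distinct) auto
  then have "cdeg ?xs = path_deg l k"
    using False assms by (auto simp: cdeg_def path_deg_def fun_eq_iff)
  moreover have "t_path l k = prod_list (map tvar ?xs)" using False by (simp add: t_path_def)
  moreover have "set ?xs \<subseteq> {..<l}" using assms by auto
  ultimately show thesis using that by blast
qed

lemma weyl_deg_t_path: "k < l \<Longrightarrow> weyl_deg l (path_deg l k) (t_path l k)"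
  by (metis t_path_word weyl_deg_tvars)

lemma rho_t_path: "k < l \<Longrightarrow> rho l (t_path l k) (tmon x) = tmon (shift (path_deg l k) x)"
  by (metis t_path_word rho_tvars)

lemma rho_t_path_gen: "k < l \<Longrightarrow> rho l (t_path l k) (tmon (gen_exp l lam k)) = tmon (hw_exp l lam k)"
  by (simp add: rho_t_path gen_exp_def)

lemma deg_wt_path_deg: "k < l \<Longrightarrow> i < l \<Longrightarrow> deg_wt l (path_deg l k) i = ent_wt 0 k i"
  by (cases "i + 1 = l") (auto simp: deg_wt_def csucc_def path_deg_def ent_wt_def unit_deg_def)

lemma t_path_wspace: "k < l \<Longrightarrow> t_path l k \<in> wspace l (ent_wt 0 k)"
  using weyl_deg_wspace[OF weyl_deg_t_path deg_wt_path_deg] by blast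

lemma hw_exp_step:
  assumes "lam \<in> R_one l" "i < l"
  shows "hw_exp l lam k (csucc l i) - hw_exp l lam k i = bar lam i"
proof (cases "i + 1 = l")
  case True
  have "(\<Sum>j<l. bar lam j) = (\<Sum>j<l. lam j) - (\<Sum>j<l. if j = 0 then 1 else 0)"
    unfolding bar_def sum_subtractf by simp
  also have "(\<Sum>j<l. if j = 0 then 1 else 0 :: real) = 1" using assms(2) by (subst sum.delta) auto
  finally have "(\<Sum>j<l. bar lam j) = 0" using assms(1) by (simp add: R_one_def)
  then have "(\<Sum>j<i. bar lam j) + bar lam i = 0" using True by (metis Suc_eq_plus1 sum.lessThan_Suc)
  then show ?thesis using True assms(2) by (simp add: csucc_def hw_exp_def)
next
  case False
  then show ?thesis using assms(2) by (simp add: csucc_def hw_exp_def)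
qed

lemma gen_exp_step:
  assumes "lam \<in> R_one l" "i < l" "k < l"
  shows "gen_exp l lam k (csucc l i) - gen_exp l lam k i = lam i - (if i = k then 1 else 0)"
proof -
  have "gen_exp l lam k (csucc l i) - gen_exp l lam k i =
      (hw_exp l lam k (csucc l i) - hw_exp l lam k i) - of_int (deg_wt l (path_deg l k) i)"
    by (simp add: gen_exp_def shift_def deg_wt_def)
  also have "\<dots> = bar lam i - of_int (ent_wt 0 k i)"
    using hw_exp_step[OF assms(1,2)] deg_wt_path_deg[OF assms(3,2)] by simp
  also have "\<dots> = lam i - (if i = k then 1 else 0)"
    by (auto simp: bar_def ent_wt_def unit_deg_def)
  finally show ?thesis .
qed

lemma gen_exp_self: "k < l \<Longrightarrow> gen_exp l lam k k = 0"
  by (auto simp: gen_exp_def shift_def path_deg_def hw_exp_def)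

lemma rho_iota: "i < l \<Longrightarrow> rho l (iota l i) (tmon x) = smul (of_real (x (csucc l i) - x i)) (tmon x)"
  unfolding iota_euler
  by (subst rho_diff) (auto simp: rho_euler smul_def left_diff_distrib)

lemma rho_iota_ideal:
  assumes "P \<in> iota_ideal l c W" "W \<subseteq> weyl l" "\<And>i. i < l \<Longrightarrow> x (csucc l i) - x i = c i"
  shows "rho l P (tmon x) = 0"
proof -
  obtain r where r: "\<forall>i<l. r i \<in> W" "P = (\<Sum>i<l. r i * (iota l i - scal (of_real (c i))))"
    using assms(1) unfolding iota_ideal_def by blast
  have "rho l (r i * (iota l i - scal (of_real (c i)))) (tmon x) = 0" if "i < l" for i
  proof -
    have rw: "r i \<in> weyl l" using r that assms(2) by blast
    have "rho l (iota l i - scal (of_real (c i))) (tmon x) = 0"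
      using that assms(3)[OF that] by (subst rho_diff) (auto simp: rho_iota rho_scal weyl.scal)
    then show ?thesis using that rw rho_linear(4)[OF rw] by (subst rho_mult) (auto intro!: diff_weyl weyl.scal)
  qed
  moreover have "r i * (iota l i - scal (of_real (c i))) \<in> weyl l" if "i < l" for i
    using r that assms(2) by (auto intro!: weyl.mult diff_weyl weyl.scal)
  ultimately show ?thesis unfolding r(2) by (subst rho_sum) auto
qed

lemma rho_T_ent:
  assumes "lam \<in> R_one l" "k < l" "P \<in> T_ent l lam a k"
  shows "rho l P (tmon (gen_exp l lam k)) = 0"
  using assms(3) unfolding T_ent_def
  by (rule rho_iota_ideal) (use gen_exp_step[OF assms(1) _ assms(2)] wspace_weyl in auto)

text \<open>The monomial \<open>t\<^sup>x\<close>, with \<open>x\<close> the exponent of \<open>1\<^sub>k\<close>, satisfies the relations that define \<open>1\<^sub>k\<close>, so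
  \<open>P 1\<^sub>k \<mapsto> P t\<^sup>x\<close> is well defined.\<close>

lemma vec_eq_imp_rho_eq:
  assumes "lam \<in> R_one l" "k < l" "P \<in> wspace l (ent_wt 0 k)" "Q \<in> wspace l (ent_wt 0 k)"
    and "vec l lam k P = vec l lam k Q"
  shows "rho l P (tmon (gen_exp l lam k)) = rho l Q (tmon (gen_exp l lam k))"
proof -
  let ?x = "gen_exp l lam k"
  obtain r where r: "r \<in> wspace l (ent_wt 0 (cpred l k))" "P - Q - r * pdiff k \<in> T_ent l lam 0 k"
    using assms(5) vec_eq_iff[OF assms(2,3,4)] by blast
  have w: "P \<in> weyl l" "Q \<in> weyl l" "r \<in> weyl l" "pdiff k \<in> weyl l"
    using assms r wspace_weyl weyl.pdiff by blast+
  have "rho l (r * pdiff k) (tmon ?x) = 0"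
    using w assms(2) gen_exp_self[OF assms(2), of lam] rho_linear(4)[OF w(3)]
    by (simp add: rho_mult rho_pdiff) (simp add: smul_def zero_fun_def[symmetric])
  moreover have "rho l (P - Q - r * pdiff k) (tmon ?x) = 0" by (rule rho_T_ent[OF assms(1,2) r(2)])
  ultimately show ?thesis using w by (simp add: rho_diff weyl.mult)
qed

lemma iota_ideal_single:
  assumes "w \<in> W" "0 \<in> W" "i < l" "c i = d"
  shows "w * (iota l i - scal (of_real d)) \<in> iota_ideal l c W"
proof -
  have "(\<Sum>j<l. (if j = i then w else 0) * (iota l j - scal (of_real (c j)))) \<in> iota_ideal l c W"
    by (rule iota_idealI) (use assms in auto)
  also have "(\<Sum>j<l. (if j = i then w else 0) * (iota l j - scal (of_real (c j)))) =
      (\<Sum>j<l. if j = i then w * (iota l i - scal (of_real (c i))) else 0)"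
    by (rule sum.cong) auto
  finally show ?thesis using assms by (simp add: sum.delta)
qed

text \<open>The relations \<open>\<iota>\<^sub>j\<close> with \<open>j < i\<close> telescope to the difference of two Euler operators.\<close>

lemma euler_diff_T_ent:
  assumes "lam \<in> R_one l" "k < l" "r \<in> wspace l (ent_wt 0 k)"
  shows "i < l \<Longrightarrow> r * ((euler i - scal (of_real (gen_exp l lam k i))) -
    (euler 0 - scal (of_real (gen_exp l lam k 0)))) \<in> T_ent l lam 0 k"
proof (induction i)
  case 0
  then show ?case using linop_subgroupD(1)[OF T_ent_subgroup] by simp
next
  case (Suc i)
  let ?x = "gen_exp l lam k"
  have i: "i < l" "csucc l i = Suc i" using Suc by (simp_all add: csucc_def)
  have "r * (iota l i - scal (of_real (lam i - (if i = k then 1 else 0)))) \<in> T_ent l lam 0 k"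
    unfolding T_ent_def using assms i by (intro iota_ideal_single) auto
  also have "lam i - (if i = k then 1 else 0) = ?x (Suc i) - ?x i"
    using gen_exp_step[OF assms(1) i(1) assms(2)] i(2) by simp
  finally have "r * (iota l i - scal (of_real (?x (Suc i) - ?x i))) +
      r * ((euler i - scal (of_real (?x i))) - (euler 0 - scal (of_real (?x 0)))) \<in> T_ent l lam 0 k"
    using Suc.IH[OF i(1)] linop_subgroupD(4)[OF T_ent_subgroup] by blast
  then show ?case
    by (simp add: iota_euler i(2) scal_diff algebra_simps)
qed

definition vec_null :: "nat \<Rightarrow> (nat \<Rightarrow> real) \<Rightarrow> nat \<Rightarrow> linop set" where
  "vec_null l lam k = {P \<in> wspace l (ent_wt 0 k). vec l lam k P = vec l lam k 0}"

lemma vec_null_iff: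
  assumes "k < l"
  shows "P \<in> vec_null l lam k \<longleftrightarrow> P \<in> wspace l (ent_wt 0 k) \<and>
    (\<exists>r\<in>wspace l (ent_wt 0 (cpred l k)). P - r * pdiff k \<in> T_ent l lam 0 k)"
  using vec_eq_iff[OF assms _ wspace_zero] by (auto simp: vec_null_def)

lemma vec_eq_null_iff:
  assumes "k < l" "P \<in> wspace l (ent_wt 0 k)" "Q \<in> wspace l (ent_wt 0 k)"
  shows "vec l lam k P = vec l lam k Q \<longleftrightarrow> P - Q \<in> vec_null l lam k"
  using assms by (simp add: vec_null_iff vec_eq_iff wspace_diff)

lemma vec_null_subgroup:
  assumes "k < l" shows "linop_subgroup (vec_null l lam k)"
  unfolding linop_subgroup_def
proof (intro conjI ballI)
  show "0 \<in> vec_null l lam k" by (simp add: vec_null_def)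
  fix P Q assume "P \<in> vec_null l lam k" "Q \<in> vec_null l lam k"
  then show "P - Q \<in> vec_null l lam k"
    using vec_eq_null_iff[OF assms, of P Q lam] by (auto simp: vec_null_def)
qed

lemma vec_null_mult_pdiff:
  assumes "k < l" "r \<in> wspace l (ent_wt 0 (cpred l k))"
  shows "r * pdiff k \<in> vec_null l lam k"
  unfolding vec_null_iff[OF assms(1)]
  using wspace_ent_mult[OF assms(2) pdiff_wspace[OF assms(1)]] assms(2)
    linop_subgroupD(1)[OF T_ent_subgroup[of l lam 0 k]] by (intro conjI bexI[of _ r]) auto

lemma T_ent_vec_null:
  assumes "k < l" "P \<in> T_ent l lam 0 k" "P \<in> wspace l (ent_wt 0 k)" shows "P \<in> vec_null l lam k"
  unfolding vec_null_iff[OF assms(1)] using assms by (intro conjI bexI[of _ 0]) auto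

text \<open>The Euler operator \<open>t\<^sub>k \<partial>\<^sub>k\<close> kills \<open>1\<^sub>k\<close>, and differences of Euler operators have prescribed
  eigenvalues, so all eigenvalues on \<open>1\<^sub>k\<close> are known.\<close>

lemma eig_vec_null:
  assumes "lam \<in> R_one l" "k < l" and d: "\<And>i. i < l \<Longrightarrow> deg_wt l d i = ent_wt 0 k i"
    and "eig l (gen_exp l lam k) d P"
  shows "P \<in> vec_null l lam k"
  using assms(4)
proof (induction rule: eig.induct)
  case zero
  show ?case by (rule linop_subgroupD(1)[OF vec_null_subgroup[OF assms(2)]])
next
  case (add P Q)
  show ?case by (rule linop_subgroupD(4)[OF vec_null_subgroup[OF assms(2)] add.IH])
next
  case (gen i r)
  let ?E = "\<lambda>i. euler i - scal (of_real (gen_exp l lam k i))"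
  note sg = linop_subgroupD[OF vec_null_subgroup[OF assms(2), of lam]]
  have r: "r \<in> wspace l (ent_wt 0 k)" using gen d by (intro weyl_deg_wspace) auto
  have E: "?E j \<in> wspace l 0" if "j < l" for j using that by (simp add: wspace_diff)
  have null: "r * (?E j - ?E 0) \<in> vec_null l lam k" if "j < l" for j
  proof (rule T_ent_vec_null[OF assms(2) euler_diff_T_ent[OF assms(1,2) r that]])
    have "?E j - ?E 0 \<in> wspace l 0" using that by (intro wspace_diff E) auto
    from wspace_mult[OF r this] show "r * (?E j - ?E 0) \<in> wspace l (ent_wt 0 k)" by simp
  qed
  have "?E k = tvar k * pdiff k" using gen_exp_self[OF assms(2)] by (simp add: euler_def)
  then have "r * ?E k \<in> vec_null l lam k"
    using vec_null_mult_pdiff[OF assms(2) wspace_ent_mult[OF r tvar_wspace[OF assms(2)]]]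
    by (simp add: mult.assoc)
  then have "r * (?E i - ?E 0) - r * (?E k - ?E 0) + r * ?E k \<in> vec_null l lam k"
    using null[OF gen(1)] null[OF assms(2)] sg by blast
  then show ?case by (simp add: right_diff_distrib)
qed

text \<open>A negative exponent at \<open>k\<close> provides a factor \<open>\<partial>\<^sub>k\<close>, which can be moved to the right end.\<close>

lemma nmon_vec_null:
  assumes "k < l" and d: "\<And>i. i < l \<Longrightarrow> deg_wt l d i = ent_wt 0 k i" "\<And>i. i \<ge> l \<Longrightarrow> d i = 0"
    and "d k < 0"
  shows "scal c * nmon l d \<in> vec_null l lam k"
proof -
  have e: "d + unit_deg k - unit_deg k = d" by auto
  have "(d + unit_deg k) k \<le> 0" using assms(4) by (simp add: unit_deg_def)
  then have eq: "nmon l d = nmon l (d + unit_deg k) * pdiff k"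
    using nmon_pdiff[OF assms(1), of "d + unit_deg k"] unfolding e by simp
  have w: "weyl_deg l (d + unit_deg k) (nmon l (d + unit_deg k))"
    using assms(1) d(2) by (intro weyl_deg_nmon) (auto simp: unit_deg_def)
  have "nmon l (d + unit_deg k) \<in> wspace l (ent_wt 0 (cpred l k))"
  proof (rule weyl_deg_wspace[OF w])
    fix i assume i: "i < l"
    show "deg_wt l (d + unit_deg k) i = ent_wt 0 (cpred l k) i"
      using d(1)[OF i] deg_wt_unit_deg[OF assms(1) i] by (simp add: deg_wt_add ent_wt_def)
  qed
  then have "scal c * nmon l (d + unit_deg k) \<in> wspace l (ent_wt 0 (cpred l k))"
    using wspace_mult[OF wspace_scal] by fastforce
  from vec_null_mult_pdiff[OF assms(1) this] show ?thesis by (simp add: eq mult.assoc)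
qed

lemma path_ray:
  assumes "k < l"
  shows "i < l \<Longrightarrow> deg_wt l (ray l (path_deg l k) m) i = ent_wt 0 k i"
    "i \<ge> l \<Longrightarrow> ray l (path_deg l k) m i = 0" "ray l (path_deg l k) m k = m"
  using assms by (simp add: deg_wt_ray deg_wt_path_deg, auto simp: ray_def one_deg_def path_deg_def)

text \<open>The highest weight vector has degree \<open>m = 0\<close> on its line and everything below it vanishes.\<close>

lemma vec_spanned:
  assumes "lam \<in> R_one l" "k < l" "P \<in> wspace l (ent_wt 0 k)"
  shows "\<exists>R\<in>tpoly l. vec l lam k P = vec l lam k (R * t_path l k)"
proof -
  have "\<exists>R\<in>tpoly l. P - R * t_path l k \<in> vec_null l lam k"
  proof (rule wspace_spanned[where d = "path_deg l k" and nu = "gen_exp l lam k" and \<gamma> = 1])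
    show "rho l (t_path l k) (tmon (gen_exp l lam k)) = smul 1 (tmon (hw_exp l lam k))"
      by (simp add: rho_t_path_gen assms smul_def)
    show "P \<in> vec_null l lam k" if "eig l (gen_exp l lam k) (ray l (path_deg l k) m) P" for m P
      using eig_vec_null[OF assms(1,2) path_ray(1)[OF assms(2)] that] .
    show "scal c * nmon l (ray l (path_deg l k) m) \<in> vec_null l lam k" if "m < 0" for m c
      using that path_ray[OF assms(2)] by (intro nmon_vec_null assms(2)) auto
  qed (use assms in \<open>auto simp: vec_null_subgroup weyl_deg_t_path deg_wt_path_deg, simp add: path_deg_def\<close>)
  moreover have "R * t_path l k \<in> wspace l (ent_wt 0 k)" if "R \<in> tpoly l" for R
    using wspace_mult[OF tpoly_wspace[OF that] t_path_wspace[OF assms(2)]] by simp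
  ultimately show ?thesis using vec_eq_null_iff[OF assms(2,3)] by metis
qed

text \<open>The form of the vanishing below the highest weight that applies to arbitrary operators, not just
  to normal forms.\<close>

lemma vec_null_below:
  assumes "lam \<in> R_one l" "k < l" "weyl_deg l (ray l (path_deg l k) m) P" "m < 0"
  shows "P \<in> vec_null l lam k"
proof -
  let ?d = "ray l (path_deg l k) m"
  obtain a where "eig l (gen_exp l lam k) ?d (P - scal a * nmon l ?d)"
    using normal_form[OF assms(3)] by blast
  from eig_vec_null[OF assms(1,2) path_ray(1)[OF assms(2)] this]
  have "P - scal a * nmon l ?d \<in> vec_null l lam k" .
  moreover have "scal a * nmon l ?d \<in> vec_null l lam k"
    using assms(4) path_ray[OF assms(2)] by (intro nmon_vec_null assms(2)) auto
  ultimately show ?thesis using linop_subgroupD(4)[OF vec_null_subgroup[OF assms(2)]] by fastforce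
qed

lemma pdprod_path_null:
  assumes "lam \<in> R_one l" "k < l" shows "pdprod l * t_path l k \<in> vec_null l lam k"
proof (rule vec_null_below[OF assms])
  have "weyl_deg l (- one_deg l + path_deg l k) (pdprod l * t_path l k)"
    by (intro weyl_deg.mult weyl_deg_pdprod weyl_deg_t_path assms)
  then show "weyl_deg l (ray l (path_deg l k) (- 1)) (pdprod l * t_path l k)"
    by (rule weyl_deg_cong) (simp add: ray_def)
qed simp

lemma euler_path_null:
  assumes "lam \<in> R_one l" "k < l" "i < l"
  shows "(euler i - scal (of_real (hw_exp l lam k i))) * t_path l k \<in> vec_null l lam k"
proof (rule eig_vec_null[OF assms(1,2) deg_wt_path_deg[OF assms(2)]])
  have "euler i * t_path l k = t_path l k * (euler i + scal (of_int (path_deg l k i)))"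
    by (rule euler_weyl_deg[OF weyl_deg_t_path[OF assms(2)]])
  moreover have "scal (of_real (hw_exp l lam k i)) * t_path l k = t_path l k * scal (of_real (hw_exp l lam k i))"
    by (rule scal_commute)
  ultimately have "(euler i - scal (of_real (hw_exp l lam k i))) * t_path l k =
      t_path l k * (euler i - scal (of_real (gen_exp l lam k i)))"
    by (simp add: gen_exp_def shift_def scal_diff left_diff_distrib right_diff_distrib distrib_left)
  then show "eig l (gen_exp l lam k) (path_deg l k) ((euler i - scal (of_real (hw_exp l lam k i))) * t_path l k)"
    using eig.gen[OF assms(3) weyl_deg_t_path[OF assms(2)]] by simp
qed

section \<open>Tensor products\<close>

text \<open>The closure conditions make the defining relations of the tensor product elements of the free
  abelian group on \<open>B \<times> N\<close>.\<close>

locale tensor_data =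
  fixes R :: "('a, 'm) ring_scheme" and B :: "('c, 'b, 'k) module_scheme" and ract :: "'b \<Rightarrow> 'a \<Rightarrow> 'b"
    and N :: "('a, 'n, 'p) module_scheme"
  assumes closed_B_add: "b \<in> carrier B \<Longrightarrow> b' \<in> carrier B \<Longrightarrow> b \<oplus>\<^bsub>B\<^esub> b' \<in> carrier B"
    and closed_N_add: "n \<in> carrier N \<Longrightarrow> n' \<in> carrier N \<Longrightarrow> n \<oplus>\<^bsub>N\<^esub> n' \<in> carrier N"
    and closed_ract: "b \<in> carrier B \<Longrightarrow> a \<in> carrier R \<Longrightarrow> ract b a \<in> carrier B"
    and closed_smult: "a \<in> carrier R \<Longrightarrow> n \<in> carrier N \<Longrightarrow> a \<odot>\<^bsub>N\<^esub> n \<in> carrier N"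
begin

abbreviation "F \<equiv> tensor_free B N"
abbreviation "H \<equiv> tensor_rel R B ract N"
abbreviation "BN \<equiv> tensor R B ract N"
abbreviation "pure \<equiv> pure_tensor R B ract N"

definition gens :: "(('b \<times> 'n) \<Rightarrow>\<^sub>0 int) set" where
  "gens = {frag_of (b \<oplus>\<^bsub>B\<^esub> b', n) - frag_of (b, n) - frag_of (b', n) | b b' n.
        b \<in> carrier B \<and> b' \<in> carrier B \<and> n \<in> carrier N} \<union>
     {frag_of (b, n \<oplus>\<^bsub>N\<^esub> n') - frag_of (b, n) - frag_of (b, n') | b n n'.
        b \<in> carrier B \<and> n \<in> carrier N \<and> n' \<in> carrier N} \<union>
     {frag_of (ract b a, n) - frag_of (b, a \<odot>\<^bsub>N\<^esub> n) | b a n.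
        b \<in> carrier B \<and> a \<in> carrier R \<and> n \<in> carrier N}"

lemma gens_cases [consumes 1, case_names add_left add_right balanced]:
  assumes "h \<in> gens"
  obtains b b' n where "h = frag_of (b \<oplus>\<^bsub>B\<^esub> b', n) - frag_of (b, n) - frag_of (b', n)"
      "b \<in> carrier B" "b' \<in> carrier B" "n \<in> carrier N"
  | b n n' where "h = frag_of (b, n \<oplus>\<^bsub>N\<^esub> n') - frag_of (b, n) - frag_of (b, n')"
      "b \<in> carrier B" "n \<in> carrier N" "n' \<in> carrier N"
  | b r n where "h = frag_of (ract b r, n) - frag_of (b, r \<odot>\<^bsub>N\<^esub> n)"
      "b \<in> carrier B" "r \<in> carrier R" "n \<in> carrier N"
  using assms unfolding gens_def by blast

lemma H_eq: "H = generate F gens"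
  by (simp add: tensor_rel_def gens_def)

lemma F_group: "group F" and F_comm: "comm_group F"
  by (simp_all add: tensor_free_def abelian_free_Abelian_group)

lemma F_simps: "x \<otimes>\<^bsub>F\<^esub> y = x + y" "\<one>\<^bsub>F\<^esub> = 0"
  "x \<in> carrier F \<longleftrightarrow> Poly_Mapping.keys x \<subseteq> carrier B \<times> carrier N"
  by (simp_all add: tensor_free_def)

lemma F_diff: "x \<in> carrier F \<Longrightarrow> y \<in> carrier F \<Longrightarrow> x - y \<in> carrier F"
  using keys_diff[of x y] by (auto simp: F_simps)

lemma F_inv: "x \<in> carrier F \<Longrightarrow> inv\<^bsub>F\<^esub> x = - x"
  by (simp add: tensor_free_def)

lemma frag_F: "b \<in> carrier B \<Longrightarrow> n \<in> carrier N \<Longrightarrow> frag_of (b, n) \<in> carrier F"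
  by (simp add: F_simps)

lemma gens_F: "gens \<subseteq> carrier F"
  unfolding gens_def
  by (auto intro!: F_diff frag_F closed_B_add closed_N_add closed_ract closed_smult)

lemma H_subgroup: "subgroup H F"
  unfolding H_eq by (rule group.generate_is_subgroup[OF F_group gens_F])

lemma H_F: "x \<in> H \<Longrightarrow> x \<in> carrier F"
  using subgroup.mem_carrier[OF H_subgroup] .

lemma H_0: "0 \<in> H"
  using subgroup.one_closed[OF H_subgroup] by (simp add: F_simps)

lemma H_add: "x \<in> H \<Longrightarrow> y \<in> H \<Longrightarrow> x + y \<in> H"
  using subgroup.m_closed[OF H_subgroup] by (simp add: F_simps)

lemma H_minus: "x \<in> H \<Longrightarrow> - x \<in> H"
  using subgroup.m_inv_closed[OF H_subgroup] F_inv[OF H_F] by metis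

lemma H_diff: "x \<in> H \<Longrightarrow> y \<in> H \<Longrightarrow> x - y \<in> H"
  using H_add[OF _ H_minus] by fastforce

lemma gens_H: "x \<in> gens \<Longrightarrow> x \<in> H"
  unfolding H_eq by (rule generate.incl)

lemma H_induct [consumes 1, case_names zero diff gen]:
  assumes "x \<in> H" "P 0" "\<And>x y. P x \<Longrightarrow> P y \<Longrightarrow> P (x - y)" "\<And>x. x \<in> gens \<Longrightarrow> P x"
  shows "P x"
  using assms(1) unfolding H_eq
proof (induction rule: generate.induct)
  case one
  then show ?case using assms(2) by (simp add: F_simps)
next
  case (incl h)
  then show ?case using assms(4) by simp
next
  case (inv h)
  have "inv\<^bsub>F\<^esub> h = - h" using inv gens_F by (intro F_inv) auto
  then show ?case using assms(3)[OF assms(2) assms(4)[OF inv]] by simp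
next
  case (eng g h)
  have "P (g - (0 - h))" by (intro assms(3) assms(2) eng)
  then show ?case by (simp add: F_simps)
qed

lemma coset_eq_iff: "H #>\<^bsub>F\<^esub> x = H #>\<^bsub>F\<^esub> y \<longleftrightarrow> x - y \<in> H"
proof
  assume "H #>\<^bsub>F\<^esub> x = H #>\<^bsub>F\<^esub> y"
  moreover have "0 + x \<in> H #>\<^bsub>F\<^esub> x" unfolding r_coset_def F_simps using H_0 by blast
  ultimately obtain h where "h \<in> H" "0 + x = h + y" unfolding r_coset_def F_simps by blast
  then show "x - y \<in> H" by simp
next
  have "H #>\<^bsub>F\<^esub> x \<subseteq> H #>\<^bsub>F\<^esub> y" if "x - y \<in> H" for x y
  proof
    fix z assume "z \<in> H #>\<^bsub>F\<^esub> x"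
    then obtain h where "h \<in> H" "z = h + x" unfolding r_coset_def F_simps by blast
    then have "h + (x - y) \<in> H" "z = (h + (x - y)) + y" using that H_add by auto
    then show "z \<in> H #>\<^bsub>F\<^esub> y" unfolding r_coset_def F_simps by blast
  qed
  moreover assume "x - y \<in> H"
  moreover from this have "y - x \<in> H" using H_minus by fastforce
  ultimately show "H #>\<^bsub>F\<^esub> x = H #>\<^bsub>F\<^esub> y" by blast
qed

lemma coset_mem: "z \<in> H #>\<^bsub>F\<^esub> x \<Longrightarrow> z - x \<in> H"
  unfolding r_coset_def F_simps by auto

lemma coset_self: "x \<in> H #>\<^bsub>F\<^esub> x"
proof -
  have "0 + x \<in> H #>\<^bsub>F\<^esub> x" unfolding r_coset_def F_simps using H_0 by blast
  then show ?thesis by simp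
qed

lemma tensor_carrier: "carrier BN = {H #>\<^bsub>F\<^esub> x | x. x \<in> carrier F}"
  by (auto simp: tensor_def Let_def FactGroup_def RCOSETS_def)

lemma tensor_add:
  assumes "x \<in> carrier F" "y \<in> carrier F"
  shows "(H #>\<^bsub>F\<^esub> x) \<oplus>\<^bsub>BN\<^esub> (H #>\<^bsub>F\<^esub> y) = H #>\<^bsub>F\<^esub> (x + y)"
proof -
  have "H \<lhd> F" using comm_group.subgroup_imp_normal[OF F_comm H_subgroup] .
  from normal.rcos_sum[OF this assms] show ?thesis
    by (simp add: tensor_def Let_def FactGroup_def F_simps)
qed

definition ext :: "'c \<Rightarrow> (('b \<times> 'n) \<Rightarrow>\<^sub>0 int) \<Rightarrow> (('b \<times> 'n) \<Rightarrow>\<^sub>0 int)" where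
  "ext a = frag_extend (\<lambda>(b, n). frag_of (a \<odot>\<^bsub>B\<^esub> b, n))"

lemma ext_simps: "ext a (x + y) = ext a x + ext a y" "ext a (x - y) = ext a x - ext a y"
  "ext a 0 = 0" "ext a (frag_of (b, n)) = frag_of (a \<odot>\<^bsub>B\<^esub> b, n)"
  by (simp_all add: ext_def frag_extend_add frag_extend_diff)

lemma tensor_smult:
  assumes a: "\<And>b. b \<in> carrier B \<Longrightarrow> a \<odot>\<^bsub>B\<^esub> b \<in> carrier B"
    "\<And>b b'. b \<in> carrier B \<Longrightarrow> b' \<in> carrier B \<Longrightarrow> a \<odot>\<^bsub>B\<^esub> (b \<oplus>\<^bsub>B\<^esub> b') = a \<odot>\<^bsub>B\<^esub> b \<oplus>\<^bsub>B\<^esub> a \<odot>\<^bsub>B\<^esub> b'"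
    "\<And>b r. b \<in> carrier B \<Longrightarrow> r \<in> carrier R \<Longrightarrow> a \<odot>\<^bsub>B\<^esub> (ract b r) = ract (a \<odot>\<^bsub>B\<^esub> b) r"
  shows "a \<odot>\<^bsub>BN\<^esub> (H #>\<^bsub>F\<^esub> x) = H #>\<^bsub>F\<^esub> ext a x"
proof -
  have "ext a h \<in> H" if "h \<in> H" for h
    using that
  proof (induction rule: H_induct)
    case (gen h)
    from gen have "ext a h \<in> gens"
    proof (cases rule: gens_cases)
      case (add_left b b' n)
      then have "ext a h = frag_of (a \<odot>\<^bsub>B\<^esub> b \<oplus>\<^bsub>B\<^esub> a \<odot>\<^bsub>B\<^esub> b', n) - frag_of (a \<odot>\<^bsub>B\<^esub> b, n) - frag_of (a \<odot>\<^bsub>B\<^esub> b', n)"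
        by (simp add: ext_simps a)
      then show ?thesis unfolding gens_def using a(1) add_left by blast
    next
      case (add_right b n n')
      then have "ext a h = frag_of (a \<odot>\<^bsub>B\<^esub> b, n \<oplus>\<^bsub>N\<^esub> n') - frag_of (a \<odot>\<^bsub>B\<^esub> b, n) - frag_of (a \<odot>\<^bsub>B\<^esub> b, n')"
        by (simp add: ext_simps)
      then show ?thesis unfolding gens_def using a(1) add_right by blast
    next
      case (balanced b r n)
      then have "ext a h = frag_of (ract (a \<odot>\<^bsub>B\<^esub> b) r, n) - frag_of (a \<odot>\<^bsub>B\<^esub> b, r \<odot>\<^bsub>N\<^esub> n)"
        by (simp add: ext_simps a)
      then show ?thesis unfolding gens_def using a(1) balanced by blast
    qed
    then show ?case by (rule gens_H)
  qed (simp_all add: ext_simps H_0 H_diff)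
  then have "H #>\<^bsub>F\<^esub> ext a y = H #>\<^bsub>F\<^esub> ext a x" if "y \<in> H #>\<^bsub>F\<^esub> x" for y
    unfolding coset_eq_iff using coset_mem[OF that] by (simp flip: ext_simps)
  then have "(\<Union>y\<in>H #>\<^bsub>F\<^esub> x. H #>\<^bsub>F\<^esub> ext a y) = H #>\<^bsub>F\<^esub> ext a x"
  proof (rule UN_B_class_const)
    show "H #>\<^bsub>F\<^esub> x \<noteq> {}" using coset_self by blast
  qed
  then show ?thesis by (simp add: tensor_def Let_def ext_def)
qed

lemma pure_eq: "pure b n = H #>\<^bsub>F\<^esub> frag_of (b, n)"
  by (simp add: pure_tensor_def)

lemma frag_add_left:
  "b \<in> carrier B \<Longrightarrow> b' \<in> carrier B \<Longrightarrow> n \<in> carrier N \<Longrightarrow>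
    frag_of (b \<oplus>\<^bsub>B\<^esub> b', n) - frag_of (b, n) - frag_of (b', n) \<in> H"
  by (rule gens_H) (unfold gens_def, blast)

lemma frag_add_right:
  "b \<in> carrier B \<Longrightarrow> n \<in> carrier N \<Longrightarrow> n' \<in> carrier N \<Longrightarrow>
    frag_of (b, n \<oplus>\<^bsub>N\<^esub> n') - frag_of (b, n) - frag_of (b, n') \<in> H"
  by (rule gens_H) (unfold gens_def, blast)

lemma frag_balanced:
  "b \<in> carrier B \<Longrightarrow> a \<in> carrier R \<Longrightarrow> n \<in> carrier N \<Longrightarrow>
    frag_of (ract b a, n) - frag_of (b, a \<odot>\<^bsub>N\<^esub> n) \<in> H"
  by (rule gens_H) (unfold gens_def, blast)

lemma F_induct [consumes 1, case_names zero diff frag]: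
  assumes "x \<in> carrier F" "P 0" "\<And>x y. x \<in> carrier F \<Longrightarrow> y \<in> carrier F \<Longrightarrow> P x \<Longrightarrow> P y \<Longrightarrow> P (x - y)"
    "\<And>b n. b \<in> carrier B \<Longrightarrow> n \<in> carrier N \<Longrightarrow> P (frag_of (b, n))"
  shows "P x"
  using assms(1) unfolding F_simps
  by (rule free_Abelian_group_induct) (use assms(2-) in \<open>auto simp: F_simps\<close>)

text \<open>Bilinear balanced maps extend to the free abelian group and vanish on the relations; the
  subtraction rule is recorded since it compares representatives of one coset.\<close>

lemma tensor_universal:
  fixes \<beta> :: "'b \<Rightarrow> 'n \<Rightarrow> 'v::ab_group_add"
  assumes "\<And>b b' n. b \<in> carrier B \<Longrightarrow> b' \<in> carrier B \<Longrightarrow> n \<in> carrier N \<Longrightarrow> \<beta> (b \<oplus>\<^bsub>B\<^esub> b') n = \<beta> b n + \<beta> b' n"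
    "\<And>b n n'. b \<in> carrier B \<Longrightarrow> n \<in> carrier N \<Longrightarrow> n' \<in> carrier N \<Longrightarrow> \<beta> b (n \<oplus>\<^bsub>N\<^esub> n') = \<beta> b n + \<beta> b n'"
    "\<And>b a n. b \<in> carrier B \<Longrightarrow> a \<in> carrier R \<Longrightarrow> n \<in> carrier N \<Longrightarrow> \<beta> (ract b a) n = \<beta> b (a \<odot>\<^bsub>N\<^esub> n)"
  shows "\<exists>h. (\<forall>x\<in>carrier F. \<forall>y\<in>carrier F. h (x + y) = h x + h y \<and> h (x - y) = h x - h y) \<and> h 0 = 0 \<and>
    (\<forall>b\<in>carrier B. \<forall>n\<in>carrier N. h (frag_of (b, n)) = \<beta> b n) \<and> (\<forall>x\<in>H. h x = 0)"
proof -
  define G :: "'v monoid" where "G = \<lparr>carrier = UNIV, monoid.mult = (+), one = 0\<rparr>"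
  have G: "comm_group G"
    unfolding G_def by (rule comm_groupI) (auto simp: add_ac intro: exI[of _ "- x" for x])
  obtain h where h: "h \<in> hom F G" "\<And>z. z \<in> carrier B \<times> carrier N \<Longrightarrow> h (frag_of z) = (\<lambda>(b, n). \<beta> b n) z"
    using comm_group.free_Abelian_group_universal[OF G, of "\<lambda>(b, n). \<beta> b n" "carrier B \<times> carrier N"]
    unfolding tensor_free_def by (auto simp: G_def)
  have add: "h (x + y) = h x + h y" if "x \<in> carrier F" "y \<in> carrier F" for x y
    using h(1) that by (simp add: hom_def G_def F_simps)
  have diff: "h (x - y) = h x - h y" if "x \<in> carrier F" "y \<in> carrier F" for x y
    using add[OF F_diff[OF that] that(2)] by simp
  have "0 \<in> carrier F" by (simp add: F_simps)
  then have h0: "h 0 = 0" using add[of 0 0] by simp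
  have frag: "h (frag_of (b, n)) = \<beta> b n" if "b \<in> carrier B" "n \<in> carrier N" for b n
    using h(2)[of "(b, n)"] that by simp
  have "h x = 0 \<and> x \<in> carrier F" if "x \<in> H" for x
    using that
  proof (induction rule: H_induct)
    case zero
    then show ?case using h0 \<open>0 \<in> carrier F\<close> by simp
  next
    case (diff x y)
    then show ?case using \<open>\<And>x y. x \<in> carrier F \<Longrightarrow> y \<in> carrier F \<Longrightarrow> h (x - y) = h x - h y\<close> F_diff by auto
  next
    case (gen x)
    then have "x \<in> carrier F" using gens_F by blast
    moreover from gen have "h x = 0"
    proof (cases rule: gens_cases)
      case add_left
      then show ?thesis using assms(1) by (simp add: diff frag F_diff frag_F closed_B_add)
    next
      case add_right
      then show ?thesis using assms(2) by (simp add: diff frag F_diff frag_F closed_N_add)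
    next
      case balanced
      then show ?thesis using assms(3) by (simp add: diff frag F_diff frag_F closed_smult closed_ract)
    qed
    ultimately show ?case by simp
  qed
  then show ?thesis using add diff h0 frag by blast
qed

end

section \<open>The highest weight vector of the shifted module\<close>

lemma cyc_sum_eq_diff:
  fixes x :: "nat \<Rightarrow> 'a::ab_group_add"
  assumes "sum x {..<l} = 0" "i < l" "j < l" "i \<noteq> j"
  shows "cyc_sum l x i j = sum x {..<j} - sum x {..<i}"
proof -
  have s: "sum x {a..<b} = sum x {..<b} - sum x {..<a}" if "a \<le> b" for a b
    using that sum.atLeastLessThan_concat[of 0 a b x] by (simp add: lessThan_atLeast0 algebra_simps)
  show ?thesis
    using assms s[of i j] s[of i l] s[of 0 j] by (simp add: cyc_sum_def)
qed

lemma cyc_sum_bar: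
  assumes "i < l" "j < l" "i \<noteq> j"
  shows "cyc_sum l lam i j = cyc_sum l (bar lam) i j \<or> cyc_sum l lam i j = cyc_sum l (bar lam) i j + 1"
proof -
  have "sum lam A = sum (bar lam) A + (if 0 \<in> A then 1 else 0)" if "finite A" for A
  proof -
    have "sum lam A = (\<Sum>i\<in>A. bar lam i + (if i = 0 then 1 else 0))" by (simp add: bar_def)
    also have "\<dots> = sum (bar lam) A + (if 0 \<in> A then 1 else 0)"
      using that by (simp add: sum.distrib sum.delta)
    finally show ?thesis .
  qed
  then show ?thesis using assms by (auto simp: cyc_sum_def)
qed

lemma sum_bar: "lam \<in> R_one l \<Longrightarrow> 1 \<le> l \<Longrightarrow> sum (bar lam) {..<l} = 0"
proof -
  assume "lam \<in> R_one l" "1 \<le> l"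
  moreover have "sum (bar lam) {..<l} = (\<Sum>j<l. lam j) - (\<Sum>j<l. if j = 0 then 1 else 0)"
    unfolding bar_def sum_subtractf by simp
  ultimately show ?thesis by (subst (asm) sum.delta) (auto simp: R_one_def)
qed

lemma hw_exp_cyc_sum:
  assumes "lam \<in> R_one l" "i < l" "k < l" "i \<noteq> k"
  shows "hw_exp l lam k i = cyc_sum l (bar lam) k i"
proof -
  have "sum (bar lam) {..<l} = 0" using sum_bar[OF assms(1)] assms(2) by simp
  from cyc_sum_eq_diff[OF this assms(3,2)] show ?thesis using assms by (simp add: hw_exp_def)
qed

text \<open>The degree of the element \<open>f\<close> of the theorem, and the difference of the highest weights for
  \<open>\<lambda> + \<theta>\<close> and \<open>\<lambda>\<close>.\<close>

definition shift_deg :: "nat \<Rightarrow> (nat \<Rightarrow> int) \<Rightarrow> nat \<Rightarrow> nat \<Rightarrow> int" where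
  "shift_deg l th k i = (if i < l then sum th {..<i} - sum th {..<k} else 0)"

lemma deg_wt_shift_deg:
  assumes "th \<in> Z_zero l" "i < l"
  shows "deg_wt l (shift_deg l th k) i = th i"
proof (cases "i + 1 = l")
  case True
  then have "sum th {..<i} + th i = 0"
    using assms(1) by (auto simp: Z_zero_def)
  then show ?thesis using True assms(2) by (simp add: deg_wt_def csucc_def shift_deg_def)
next
  case False
  then show ?thesis using assms(2) by (simp add: deg_wt_def csucc_def shift_deg_def)
qed

lemma hw_exp_shift:
  assumes "k < l"
  shows "hw_exp l (shift_par lam th) k = shift (shift_deg l th k) (hw_exp l lam k)"
proof
  fix i
  have "sum (bar (shift_par lam th)) A = sum (bar lam) A + of_int (sum th A)" for A
  proof -
    have "sum (bar (shift_par lam th)) A = (\<Sum>i\<in>A. bar lam i + of_int (th i))"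
      by (rule sum.cong) (auto simp: bar_def shift_par_def)
    then show ?thesis by (simp add: sum.distrib)
  qed
  then show "hw_exp l (shift_par lam th) k i = shift (shift_deg l th k) (hw_exp l lam k) i"
    using assms by (simp add: hw_exp_def shift_def shift_deg_def)
qed

lemma shift_par_R_one:
  assumes "lam \<in> R_one l" "th \<in> Z_zero l" shows "shift_par lam th \<in> R_one l"
proof -
  have "(\<Sum>i<l. real_of_int (th i)) = of_int (\<Sum>i<l. th i)" by (simp only: of_int_sum)
  also have "\<dots> = 0" using assms(2) by (simp only: Z_zero_def mem_Collect_eq of_int_0)
  finally show ?thesis using assms by (simp add: R_one_def Z_zero_def shift_par_def sum.distrib)
qed

text \<open>A natural exponent \<open>\<nu>\<^sub>i = n\<close> that is used up by differentiation would make
  \<open>\<lambda>\<^sub>i + \<dots> + \<lambda>\<^sub>k\<^sub>-\<^sub>1\<close> equal to \<open>- n\<close> or \<open>1 - n\<close>, and \<open>n \<noteq> 0\<close> by regularity. The condition on \<open>\<theta>\<close> then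
  puts \<open>k\<close> below \<open>i\<close> in the ordering, where no derivatives in direction \<open>i\<close> occur.\<close>

lemma hw_exp_avoids:
  assumes l: "lam \<in> R_reg l" "th \<in> Z_lam l lam" and i: "i < l" "k < l" "i \<noteq> k"
    and n: "int n < - shift_deg l th k i"
  shows "hw_exp l lam k i \<noteq> real n"
proof
  assume eq: "hw_exp l lam k i = real n"
  have one: "lam \<in> R_one l" and reg: "cyc_sum l (bar lam) i k \<noteq> 0" using l i by (auto simp: R_reg_def)
  have th: "th \<in> Z_zero l" using l(2) by (auto simp: Z_lam_def Z_reg_def)
  have s0: "sum (bar lam) {..<l} = 0" using sum_bar[OF one] i by simp
  have t0: "sum th {..<l} = 0" using th by (simp add: Z_zero_def)
  have neg: "cyc_sum l (bar lam) i k = - real n"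
    using cyc_sum_eq_diff[OF s0 i(1,2,3)] eq i by (simp add: hw_exp_def)
  then have "n \<noteq> 0" using reg by auto
  have "cyc_sum l lam i k = of_int (- int n) \<or> cyc_sum l lam i k = of_int (1 - int n)"
    using cyc_sum_bar[OF i(1,2,3), of lam] neg by auto
  moreover have "- int n \<le> 0" "1 - int n \<le> 0" using \<open>n \<noteq> 0\<close> by auto
  ultimately have "cyc_sum l lam i k \<in> \<int>\<^sub>\<le>\<^sub>0" by (metis nonpos_Ints_of_int)
  then have "cyc_sum l th i k < 0" using l(2) i by (auto simp: Z_lam_def)
  then have "sum th {..<k} - sum th {..<i} < 0" using cyc_sum_eq_diff[OF t0 i(1,2,3)] by simp
  then show False using n i by (simp add: shift_deg_def)
qed

definition blocks :: "nat list \<Rightarrow> (nat \<Rightarrow> nat) \<Rightarrow> (nat \<Rightarrow> nat list) \<Rightarrow> nat list" where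
  "blocks js e w = concat (map (\<lambda>j. concat (replicate (e j) (w j))) js)"

lemma prod_list_replicate_concat:
  "prod_list (map f (concat (replicate n xs))) = (prod_list (map f xs) :: linop) ^ n"
  by (induction n) auto

lemma prod_list_blocks:
  "prod_list (map f (blocks js e w)) = (\<Prod>j\<leftarrow>js. (prod_list (map f (w j)) :: linop) ^ e j)"
  by (induction js) (simp_all add: blocks_def prod_list_replicate_concat)

lemma count_list_replicate_concat: "count_list (concat (replicate n xs)) x = n * count_list xs x"
  by (induction n) auto

lemma count_list_blocks: "count_list (blocks js e w) x = (\<Sum>j\<leftarrow>js. e j * count_list (w j) x)"
  by (induction js) (simp_all add: blocks_def count_list_replicate_concat)

lemma set_blocks: "set (blocks js e w) \<subseteq> (\<Union>j\<in>set js. set (w j))"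
  by (auto simp: blocks_def)

text \<open>The block with index \<open>j\<close> has exponent \<open>s(\<eta>\<^sub>j\<^sub>+\<^sub>1) - s(\<eta>\<^sub>j)\<close>, where \<open>s\<close> denotes the partial sums of \<open>\<theta>\<close>.
  The variable with index \<open>\<eta>\<^sub>p\<close> occurs in the blocks \<open>i \<le> j < p\<close> and the derivative in the blocks
  \<open>p \<le> j < i\<close>, so the multiplicities telescope.\<close>

lemma f_tilde_words:
  assumes th: "th \<in> Z_zero l" and en: "theta_enum l th \<eta>" and i: "i \<in> {1..l}"
  shows "\<exists>xs ys. set xs \<subseteq> {..<l} \<and> set ys \<subseteq> {..<l} \<and>
    f_tilde l th \<eta> i = prod_list (map tvar xs) * prod_list (map pdiff ys) \<and>
    cdeg xs + - cdeg ys = shift_deg l th (\<eta> i) \<and>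
    (\<forall>x\<in>set ys. x \<noteq> \<eta> i \<and> int (count_list ys x) = - shift_deg l th (\<eta> i) x)"
proof -
  define e where "e j = nat (cyc_sum l th (\<eta> j) (\<eta> (j + 1)))" for j
  define xs where "xs = blocks [i..<l] e (\<lambda>j. map \<eta> [j + 1..<l + 1])"
  define ys where "ys = blocks [1..<i] e (\<lambda>j. map \<eta> [1..<j + 1])"
  define s where "s m = sum th {..<\<eta> m}" for m
  have bij: "bij_betw \<eta> {1..l} {..<l}" using en by (simp add: theta_enum_def)
  then have inj: "inj_on \<eta> {1..l}" and rng: "\<And>m. m \<in> {1..l} \<Longrightarrow> \<eta> m < l"
    by (auto simp: bij_betw_def)
  have t0: "sum th {..<l} = 0" using th by (simp add: Z_zero_def)
  have e: "int (e j) = s (j + 1) - s j" if "1 \<le> j" "j < l" for j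
  proof -
    have gt: "theta_gt l th (\<eta> (j + 1)) (\<eta> j)" using en that by (simp add: theta_enum_def)
    then have ne: "\<eta> (j + 1) \<noteq> \<eta> j" by (simp add: theta_gt_def)
    have lt: "\<eta> j < l" "\<eta> (j + 1) < l" using rng that by auto
    have "cyc_sum l th (\<eta> j) (\<eta> (j + 1)) = s (j + 1) - s j"
      "cyc_sum l th (\<eta> (j + 1)) (\<eta> j) = s j - s (j + 1)"
      using cyc_sum_eq_diff[OF t0 lt] cyc_sum_eq_diff[OF t0 lt(2,1)] ne by (auto simp: s_def)
    then show ?thesis using gt by (simp add: e_def theta_gt_def)
  qed
  have tel: "(\<Sum>j\<in>{a..<b}. int (e j)) = s b - s a" if "1 \<le> a" "a \<le> b" "b \<le> l" for a b
  proof -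
    have "(\<Sum>j\<in>{a..<b}. int (e j)) = (\<Sum>j\<in>{a..<b}. s (Suc j) - s j)"
      using that by (intro sum.cong) (auto simp: e)
    then show ?thesis using sum_Suc_diff'[OF that(2), of s] by simp
  qed
  have cnt: "count_list (map \<eta> [a..<b + 1]) (\<eta> p) = (if a \<le> p \<and> p \<le> b then 1 else 0)"
    if "1 \<le> a" "b \<le> l" "p \<in> {1..l}" for a b p
  proof -
    have "inj_on \<eta> (set [a..<b + 1])" by (rule inj_on_subset[OF inj]) (use that in auto)
    then have d: "distinct (map \<eta> [a..<b + 1])" by (simp add: distinct_map del: upt_Suc)
    have "\<eta> p \<in> set (map \<eta> [a..<b + 1]) \<longleftrightarrow> a \<le> p \<and> p \<le> b"
    proof
      assume "\<eta> p \<in> set (map \<eta> [a..<b + 1])"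
      then obtain q where q: "a \<le> q" "q \<le> b" "\<eta> p = \<eta> q" by auto
      then have "p = q" using inj that by (auto dest: inj_onD)
      then show "a \<le> p \<and> p \<le> b" using q by simp
    next
      assume "a \<le> p \<and> p \<le> b"
      then have "p \<in> set [a..<b + 1]" by (auto simp del: upt_Suc)
      then show "\<eta> p \<in> set (map \<eta> [a..<b + 1])" unfolding set_map by (rule imageI)
    qed
    then show ?thesis by (subst count_list_distinct[OF d]) auto
  qed
  have cx: "int (count_list xs (\<eta> p)) = (if i \<le> p then s p - s i else 0)" if p: "p \<in> {1..l}" for p
  proof -
    have "int (count_list xs (\<eta> p)) = (\<Sum>j\<in>{i..<l}. int (e j) * (if j < p then 1 else 0))"
      unfolding xs_def count_list_blocks sum_list_distinct_conv_sum_set[OF distinct_upt] set_upt of_nat_sum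
      using p i by (intro sum.cong refl) (subst cnt, auto)
    also have "\<dots> = (\<Sum>j\<in>{i..<p}. int (e j))"
      using p by (intro sum.mono_neutral_cong_right) auto
    finally show ?thesis using tel[of i p] p i by auto
  qed
  have cy: "int (count_list ys (\<eta> p)) = (if p \<le> i then s i - s p else 0)" if p: "p \<in> {1..l}" for p
  proof -
    have "int (count_list ys (\<eta> p)) = (\<Sum>j\<in>{1..<i}. int (e j) * (if p \<le> j then 1 else 0))"
      unfolding ys_def count_list_blocks sum_list_distinct_conv_sum_set[OF distinct_upt] set_upt of_nat_sum
      using p i by (intro sum.cong refl) (subst cnt, auto)
    also have "\<dots> = (\<Sum>j\<in>{p..<i}. int (e j))"
      using p by (intro sum.mono_neutral_cong_right) auto
    finally show ?thesis using tel[of p i] p i by auto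
  qed
  have xl: "set xs \<subseteq> {..<l}"
    unfolding xs_def using i rng by (intro order_trans[OF set_blocks]) auto
  have yl: "set ys \<subseteq> {..<l}"
    unfolding ys_def using i rng by (intro order_trans[OF set_blocks]) auto
  have f: "f_tilde l th \<eta> i = prod_list (map tvar xs) * prod_list (map pdiff ys)"
    unfolding f_tilde_def xs_def ys_def prod_list_blocks e_def by (simp add: comp_def del: upt_Suc)
  have ex: "\<exists>p\<in>{1..l}. x = \<eta> p" if "x < l" for x
    using bij that unfolding bij_betw_def by (metis image_iff lessThan_iff)
  have cd: "cdeg xs + - cdeg ys = shift_deg l th (\<eta> i)"
  proof
    fix x
    show "(cdeg xs + - cdeg ys) x = shift_deg l th (\<eta> i) x"
    proof (cases "x < l")
      case True
      then obtain p where p: "p \<in> {1..l}" "x = \<eta> p" using ex by blast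
      then show ?thesis using cx[OF p(1)] cy[OF p(1)] True by (simp add: cdeg_def shift_deg_def s_def)
    next
      case False
      then have "x \<notin> set xs" "x \<notin> set ys" using xl yl by auto
      then show ?thesis using False by (simp add: cdeg_def shift_deg_def count_list_0_iff)
    qed
  qed
  have ct: "x \<noteq> \<eta> i \<and> int (count_list ys x) = - shift_deg l th (\<eta> i) x" if x: "x \<in> set ys" for x
  proof -
    have xl: "x < l" using x yl by auto
    then obtain p where p: "p \<in> {1..l}" "x = \<eta> p" using ex by blast
    have "count_list ys x \<noteq> 0" using x by (simp add: count_list_0_iff)
    then have "p < i" using cy[OF p(1)] p(2) by (auto split: if_splits simp: order_le_less)
    then show ?thesis using cy[OF p(1)] p inj i xl by (auto simp: shift_deg_def s_def dest: inj_onD)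
  qed
  show ?thesis using xl yl f cd ct by blast
qed

lemma f_tilde_deg:
  assumes "th \<in> Z_zero l" "theta_enum l th \<eta>" "i \<in> {1..l}"
  shows "weyl_deg l (shift_deg l th (\<eta> i)) (f_tilde l th \<eta> i)"
proof -
  obtain xs ys where w: "set xs \<subseteq> {..<l}" "set ys \<subseteq> {..<l}"
    "f_tilde l th \<eta> i = prod_list (map tvar xs) * prod_list (map pdiff ys)"
    "cdeg xs + - cdeg ys = shift_deg l th (\<eta> i)"
    using f_tilde_words[OF assms] by blast
  show ?thesis unfolding w(3) w(4)[symmetric] by (intro weyl_deg.mult weyl_deg_tvars weyl_deg_pdiffs w)
qed

lemma rho_f_tilde:
  assumes l: "lam \<in> R_reg l" "th \<in> Z_lam l lam" and en: "theta_enum l th \<eta>" and i: "i \<in> {1..l}"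
  shows "\<exists>\<gamma>. \<gamma> \<noteq> 0 \<and> rho l (f_tilde l th \<eta> i) (tmon (hw_exp l lam (\<eta> i))) =
    smul \<gamma> (tmon (hw_exp l (shift_par lam th) (\<eta> i)))"
proof -
  let ?k = "\<eta> i" and ?x = "hw_exp l lam (\<eta> i)"
  have k: "?k < l" using en i by (auto simp: theta_enum_def bij_betw_def)
  have th: "th \<in> Z_zero l" using l(2) by (auto simp: Z_lam_def Z_reg_def)
  obtain xs ys where w: "set xs \<subseteq> {..<l}" "set ys \<subseteq> {..<l}"
    "f_tilde l th \<eta> i = prod_list (map tvar xs) * prod_list (map pdiff ys)"
    "cdeg xs + - cdeg ys = shift_deg l th ?k"
    and ys: "\<And>x. x \<in> set ys \<Longrightarrow> x \<noteq> ?k \<and> int (count_list ys x) = - shift_deg l th ?k x"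
    using f_tilde_words[OF th en i] by blast
  have "?x y \<noteq> real n" if "y \<in> set ys" "n < count_list ys y" for y n
  proof -
    have "y < l" using that w by auto
    moreover have "int n < - shift_deg l th ?k y" using ys[OF that(1)] that(2) by linarith
    ultimately show ?thesis using ys[OF that(1)] by (intro hw_exp_avoids[OF l _ k]) auto
  qed
  then obtain c where c: "c \<noteq> 0"
    "rho l (prod_list (map pdiff ys)) (tmon ?x) = smul c (tmon (shift (- cdeg ys) ?x))"
    using rho_pdiffs[OF w(2), of ?x] by blast
  have W: "prod_list (map tvar xs) \<in> weyl l" "prod_list (map pdiff ys) \<in> weyl l"
    using weyl_deg_tvars[OF w(1)] weyl_deg_pdiffs[OF w(2)] weyl_deg_weyl by blast+
  have "rho l (f_tilde l th \<eta> i) (tmon ?x) = smul c (tmon (shift (cdeg xs + - cdeg ys) ?x))"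
    unfolding w(3) by (simp only: rho_mult[OF W] c(2) rho_linear(2)[OF W(1)] rho_tvars[OF w(1)] shift_shift)
  then show ?thesis using c(1) unfolding w(4) hw_exp_shift[OF k] by blast
qed

section \<open>The isomorphism\<close>

text \<open>Two modules that embed into one space with the same image are isomorphic, provided every scalar
  acts on both images through one map \<open>g\<close> of that space.\<close>

lemma left_module_iso_via:
  fixes \<phi> :: "'b \<Rightarrow> 'v::plus" and \<psi> :: "'c \<Rightarrow> 'v"
  assumes inj: "inj_on \<phi> (carrier M)" "inj_on \<psi> (carrier N)"
    and img: "\<phi> ` carrier M = \<psi> ` carrier N"
    and add: "\<And>x y. x \<in> carrier M \<Longrightarrow> y \<in> carrier M \<Longrightarrow> \<phi> (x \<oplus>\<^bsub>M\<^esub> y) = \<phi> x + \<phi> y"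
      "\<And>x y. x \<in> carrier N \<Longrightarrow> y \<in> carrier N \<Longrightarrow> x \<oplus>\<^bsub>N\<^esub> y \<in> carrier N \<and> \<psi> (x \<oplus>\<^bsub>N\<^esub> y) = \<psi> x + \<psi> y"
    and smult: "\<And>a. a \<in> carrier R \<Longrightarrow> \<exists>g. (\<forall>x\<in>carrier M. \<phi> (a \<odot>\<^bsub>M\<^esub> x) = g (\<phi> x)) \<and>
      (\<forall>y\<in>carrier N. a \<odot>\<^bsub>N\<^esub> y \<in> carrier N \<and> \<psi> (a \<odot>\<^bsub>N\<^esub> y) = g (\<psi> y))"
    and x0: "x0 \<in> carrier M" "y0 \<in> carrier N" "\<phi> x0 = \<psi> y0"
  shows "\<exists>h\<in>left_module_iso R M N. h x0 = y0"
proof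
  define h where "h = inv_into (carrier N) \<psi> \<circ> \<phi>"
  have h: "h x \<in> carrier N" "\<psi> (h x) = \<phi> x" if "x \<in> carrier M" for x
    using that img inv_into_into[of "\<phi> x" \<psi> "carrier N"] f_inv_into_f[of "\<phi> x" \<psi> "carrier N"]
    by (auto simp: h_def)
  have eq: "h x = y" if "x \<in> carrier M" "y \<in> carrier N" "\<phi> x = \<psi> y" for x y
    using that inv_into_f_f[OF inj(2)] by (simp add: h_def)
  show "h x0 = y0" by (rule eq[OF x0])
  have "bij_betw h (carrier M) (carrier N)"
  proof (rule bij_betw_imageI)
    show "inj_on h (carrier M)" using inj(1) h(2) by (metis inj_on_def)
    show "h ` carrier M = carrier N"
    proof (intro equalityI subsetI)
      fix y assume y: "y \<in> carrier N"
      then obtain x where "x \<in> carrier M" "\<phi> x = \<psi> y" using img by (metis imageE imageI)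
      then show "y \<in> h ` carrier M" using eq y by blast
    qed (use h in blast)
  qed
  moreover have "h (x \<oplus>\<^bsub>M\<^esub> y) = h x \<oplus>\<^bsub>N\<^esub> h y" if "x \<in> carrier M" "y \<in> carrier M" for x y
  proof -
    have "\<phi> (x \<oplus>\<^bsub>M\<^esub> y) = \<psi> (h x \<oplus>\<^bsub>N\<^esub> h y)" using add h that by simp
    moreover have "h x \<oplus>\<^bsub>N\<^esub> h y \<in> carrier N" using add(2) h that by blast
    ultimately show ?thesis using inv_into_f_f[OF inj(2)] by (simp only: h_def comp_apply)
  qed
  moreover have "h (a \<odot>\<^bsub>M\<^esub> x) = a \<odot>\<^bsub>N\<^esub> h x" if a: "a \<in> carrier R" and x: "x \<in> carrier M" for a x
  proof -
    obtain g where g: "\<forall>x\<in>carrier M. \<phi> (a \<odot>\<^bsub>M\<^esub> x) = g (\<phi> x)"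
      "\<forall>y\<in>carrier N. a \<odot>\<^bsub>N\<^esub> y \<in> carrier N \<and> \<psi> (a \<odot>\<^bsub>N\<^esub> y) = g (\<psi> y)" using smult[OF a] by blast
    then have "\<phi> (a \<odot>\<^bsub>M\<^esub> x) = \<psi> (a \<odot>\<^bsub>N\<^esub> h x)" using h x by simp
    moreover have "a \<odot>\<^bsub>N\<^esub> h x \<in> carrier N" using g h x by blast
    ultimately show ?thesis using inv_into_f_f[OF inj(2)] by (simp only: h_def comp_apply)
  qed
  ultimately show "h \<in> left_module_iso R M N" by (simp add: left_module_iso_def)
qed

abbreviation a_el :: "nat \<Rightarrow> (nat \<Rightarrow> real) \<Rightarrow> linop \<Rightarrow> linop mat set" where
  "a_el l lam R \<equiv> T_class l lam (E_tensor l 0 0 R)"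

text \<open>An operator \<open>f\<close> that can serve as the left factor of the new highest weight vector: it has the
  degree by which the highest weights differ and maps \<open>t\<^sup>\<nu>\<close> to a nonzero multiple of \<open>t\<^sup>\<nu>\<^sup>'\<close>.\<close>

locale shift_setting =
  fixes l :: nat and lam :: "nat \<Rightarrow> real" and th :: "nat \<Rightarrow> int" and k :: nat and f :: linop and \<gamma> :: complex
  assumes l: "1 \<le> l" and k: "k < l" and reg: "lam \<in> R_reg l" and th: "th \<in> Z_zero l"
    and f_deg: "weyl_deg l (shift_deg l th k) f"
    and f_hw: "rho l f (tmon (hw_exp l lam k)) = smul \<gamma> (tmon (hw_exp l (shift_par lam th) k))"
    and \<gamma>: "\<gamma> \<noteq> 0"
begin

abbreviation "cl \<equiv> B_class l lam"
abbreviation "v \<equiv> vec l lam k"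
abbreviation "w \<equiv> v (t_path l k)"
abbreviation "W \<equiv> wspace l (ent_wt 0 k)"
abbreviation "lam' \<equiv> shift_par lam th"

lemma R_one: "lam \<in> R_one l" using reg by (simp add: R_reg_def)

lemma R_one': "lam' \<in> R_one l" by (rule shift_par_R_one[OF R_one th])

lemma W_mult: "R \<in> wspace l 0 \<Longrightarrow> P \<in> W \<Longrightarrow> R * P \<in> W"
  using wspace_mult[of R l 0 P] by simp

lemma th_mult_right: "Q \<in> wspace l th \<Longrightarrow> R \<in> wspace l 0 \<Longrightarrow> Q * R \<in> wspace l th"
  using wspace_mult[of Q l th R 0] by simp

lemma th_mult_left: "Q \<in> wspace l th \<Longrightarrow> R \<in> wspace l 0 \<Longrightarrow> R * Q \<in> wspace l th"
  using wspace_mult[of R l 0 Q th] by simp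

lemma ract_cl: "R \<in> wspace l 0 \<Longrightarrow> Q \<in> wspace l th \<Longrightarrow> B_ract l lam (cl Q) (a_el l lam R) = cl (Q * R)"
  by (simp add: B_ract_def A_to_AD_class[OF l] B_right_mult)

lemma smult_cl: "R \<in> wspace l 0 \<Longrightarrow> Q \<in> wspace l th \<Longrightarrow> a_el l lam' R \<odot>\<^bsub>B_mod l lam th\<^esub> cl Q = cl (R * Q)"
  by (simp add: B_mod_def A_to_AD_class[OF l] B_left_mult)

lemma smult_v: "R \<in> wspace l 0 \<Longrightarrow> P \<in> W \<Longrightarrow> a_el l lam R \<odot>\<^bsub>e0_Delta l lam k\<^esub> v P = v (R * P)"
  using l k by (simp add: vec_smult)

sublocale tensor_data "A_alg l lam" "B_mod l lam th" "B_ract l lam" "e0_Delta l lam k"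
proof
  fix b b' assume "b \<in> carrier (B_mod l lam th)" "b' \<in> carrier (B_mod l lam th)"
  then show "b \<oplus>\<^bsub>B_mod l lam th\<^esub> b' \<in> carrier (B_mod l lam th)"
    by (auto simp: B_carrier B_add wspace_add)
next
  fix n n' assume "n \<in> carrier (e0_Delta l lam k)" "n' \<in> carrier (e0_Delta l lam k)"
  then show "n \<oplus>\<^bsub>e0_Delta l lam k\<^esub> n' \<in> carrier (e0_Delta l lam k)"
    by (auto simp: e0_Delta_carrier[OF k] vec_add wspace_add)
next
  fix b a assume "b \<in> carrier (B_mod l lam th)" "a \<in> carrier (A_alg l lam)"
  then show "B_ract l lam b a \<in> carrier (B_mod l lam th)"
    by (auto simp: B_carrier A_carrier[OF l] ract_cl th_mult_right)
next
  fix a n assume "a \<in> carrier (A_alg l lam)" "n \<in> carrier (e0_Delta l lam k)"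
  then show "a \<odot>\<^bsub>e0_Delta l lam k\<^esub> n \<in> carrier (e0_Delta l lam k)"
    by (auto simp: e0_Delta_carrier[OF k] A_carrier[OF l] smult_v W_mult)
qed

abbreviation fr :: "linop \<Rightarrow> linop \<Rightarrow> (linop set \<times> linop mat set set) \<Rightarrow>\<^sub>0 int" where
  "fr Q P \<equiv> frag_of (cl Q, v P)"

lemma cl_B: "Q \<in> wspace l th \<Longrightarrow> cl Q \<in> carrier (B_mod l lam th)"
  by (simp add: B_carrier)

lemma v_N: "P \<in> W \<Longrightarrow> v P \<in> carrier (e0_Delta l lam k)"
  by (simp add: e0_Delta_carrier[OF k])

lemma path_W: "t_path l k \<in> W"
  by (rule t_path_wspace[OF k])

lemma fr_F: "Q \<in> wspace l th \<Longrightarrow> P \<in> W \<Longrightarrow> fr Q P \<in> carrier F"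
  by (intro frag_F cl_B v_N)

lemma fr_diff:
  assumes "Q \<in> wspace l th" "Q' \<in> wspace l th" "P \<in> W"
  shows "fr (Q - Q') P - (fr Q P - fr Q' P) \<in> H"
proof -
  have d: "Q - Q' \<in> wspace l th" using assms by (simp add: wspace_diff)
  have "fr (Q - Q' + Q') P - fr (Q - Q') P - fr Q' P \<in> H"
    using frag_add_left[OF cl_B[OF d] cl_B[OF assms(2)] v_N[OF assms(3)]] by (simp only: B_add)
  from H_minus[OF this] show ?thesis by (simp add: algebra_simps)
qed

lemma fr_0_left: "P \<in> W \<Longrightarrow> fr 0 P \<in> H"
  using fr_diff[of 0 0 P] by simp

lemma fr_0_right:
  assumes "Q \<in> wspace l th" shows "fr Q 0 \<in> H"
proof -
  have "frag_of (cl Q, v 0 \<oplus>\<^bsub>e0_Delta l lam k\<^esub> v 0) - fr Q 0 - fr Q 0 \<in> H"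
    by (intro frag_add_right cl_B v_N assms wspace_zero)
  then have "- fr Q 0 \<in> H" by (simp add: vec_add)
  from H_minus[OF this] show ?thesis by simp
qed

lemma fr_balanced:
  assumes "Q \<in> wspace l th" "R \<in> wspace l 0" "P \<in> W"
  shows "fr (Q * R) P - fr Q (R * P) \<in> H"
proof -
  have "a_el l lam R \<in> carrier (A_alg l lam)" using assms by (simp add: A_carrier[OF l])
  from frag_balanced[OF cl_B[OF assms(1)] this v_N[OF assms(3)]] show ?thesis
    using assms by (simp add: ract_cl smult_v)
qed

text \<open>The invariant \<open>R\<close> crosses the tensor sign and meets the highest weight vector.\<close>

lemma fr_null:
  assumes "Q \<in> wspace l th" "R \<in> wspace l 0" "R * t_path l k \<in> vec_null l lam k"
  shows "fr (Q * R) (t_path l k) \<in> H"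
proof -
  have "v (R * t_path l k) = v 0" using assms(3) by (simp add: vec_null_def)
  then have "fr (Q * R) (t_path l k) - fr Q 0 \<in> H"
    using fr_balanced[OF assms(1,2) path_W] by simp
  from H_add[OF this fr_0_right[OF assms(1)]] show ?thesis by simp
qed

definition null :: "linop set" where
  "null = {Q \<in> wspace l th. fr Q (t_path l k) \<in> H}"

lemma null_subgroup: "linop_subgroup null"
  unfolding linop_subgroup_def null_def
proof (intro conjI ballI CollectI; (elim CollectE conjE)?)
  show "0 \<in> wspace l th" by simp
  show "fr 0 (t_path l k) \<in> H" by (rule fr_0_left[OF path_W])
  fix Q Q' assume Q: "Q \<in> wspace l th" "Q' \<in> wspace l th" "fr Q (t_path l k) \<in> H" "fr Q' (t_path l k) \<in> H"
  show "Q - Q' \<in> wspace l th" using Q by (simp add: wspace_diff)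
  show "fr (Q - Q') (t_path l k) \<in> H"
    using H_add[OF fr_diff[OF Q(1,2) path_W] H_diff[OF Q(3,4)]] by simp
qed

lemma shift_ray:
  "i < l \<Longrightarrow> deg_wt l (ray l (shift_deg l th k) m) i = th i"
  "i \<ge> l \<Longrightarrow> ray l (shift_deg l th k) m i = 0" "ray l (shift_deg l th k) m k = m"
  using k by (simp add: deg_wt_ray deg_wt_shift_deg[OF th], auto simp: ray_def one_deg_def shift_deg_def)

text \<open>The Euler operators are invariant, so they cross the tensor sign and take their eigenvalue on the
  highest weight vector.\<close>

lemma eig_null:
  assumes "eig l (hw_exp l lam k) (ray l (shift_deg l th k) m) P" shows "P \<in> null"
  using assms
proof (induction rule: eig.induct)
  case zero
  show ?case by (rule linop_subgroupD(1)[OF null_subgroup])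
next
  case (add P Q)
  show ?case by (rule linop_subgroupD(4)[OF null_subgroup add.IH])
next
  case (gen i r)
  let ?E = "euler i - scal (of_real (hw_exp l lam k i))"
  have r: "r \<in> wspace l th" by (rule weyl_deg_wspace[OF gen(2) shift_ray(1)])
  have E: "?E \<in> wspace l 0" using gen(1) by (simp add: wspace_diff)
  have "fr (r * ?E) (t_path l k) \<in> H"
    by (rule fr_null[OF r E euler_path_null[OF R_one k gen(1)]])
  then show ?case using th_mult_right[OF r E] by (simp add: null_def)
qed

text \<open>Below the highest weight the exponent at \<open>k\<close> is negative, so only Euler operators with index
  different from \<open>k\<close> appear when \<open>\<partial>\<^sub>0 \<cdots> \<partial>\<^sub>l\<^sub>-\<^sub>1\<close> is split off on the right. Their eigenvalues are nonzero
  by regularity, and \<open>\<partial>\<^sub>0 \<cdots> \<partial>\<^sub>l\<^sub>-\<^sub>1\<close> crosses the tensor sign and kills the highest weight vector.\<close>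

lemma below_null:
  assumes "m < 0" shows "scal c * nmon l (ray l (shift_deg l th k) m) \<in> null"
proof -
  let ?d = "ray l (shift_deg l th k) m" and ?x = "hw_exp l lam k"
  define g :: complex where "g = (\<Prod>i<l. if ?d i \<ge> 0 then of_real (?x i) else 1)"
  have "?x i \<noteq> 0" if "i < l" "?d i \<ge> 0" for i
  proof -
    have ne: "i \<noteq> k" using that(2) shift_ray(3)[of m] assms by auto
    then have "cyc_sum l (bar lam) k i \<noteq> 0" using reg that(1) k unfolding R_reg_def by blast
    then show ?thesis using hw_exp_cyc_sum[OF R_one that(1) k ne] by simp
  qed
  then have g: "g \<noteq> 0" by (auto simp: g_def)
  \<comment> \<open>The Euler operators that \<open>\<partial>\<^sub>0 \<cdots> \<partial>\<^sub>l\<^sub>-\<^sub>1\<close> leaves behind have the product \<open>g\<close> of their eigenvalues.\<close>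
  define u where "u = scal (c / g) * nmon l ?d"
  have nm: "weyl_deg l ?d (nmon l ?d)" by (rule weyl_deg_nmon) (rule shift_ray(2))
  then have u: "weyl_deg l ?d u" unfolding u_def by (rule weyl_deg_scal_mult)
  define u' where "u' = scal (c / g) * nmon l (?d + one_deg l)"
  have "weyl_deg l (?d + one_deg l) u'"
    unfolding u'_def using shift_ray(2)[of _ m] by (intro weyl_deg_scal_mult weyl_deg_nmon) (simp add: one_deg_def)
  then have u': "u' \<in> wspace l th"
  proof (rule weyl_deg_wspace)
    fix i assume i: "i < l"
    show "deg_wt l (?d + one_deg l) i = th i"
      using shift_ray(1)[OF i, of m] i by (simp add: deg_wt_def one_deg_def)
  qed
  have pd: "pdprod l \<in> wspace l 0"
    by (rule weyl_deg_wspace[OF weyl_deg_pdprod]) (simp add: deg_wt_def one_deg_def)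
  have "u * euler_prod ?d l = u' * pdprod l"
    unfolding u_def u'_def by (simp only: mult.assoc nmon_pdprod)
  then have "u * euler_prod ?d l \<in> null"
    using fr_null[OF u' pd pdprod_path_null[OF R_one k]] th_mult_right[OF u' pd] by (simp add: null_def)
  moreover have "u * euler_prod ?d l - scal g * u \<in> null"
    using eig_null[OF eig_euler_prod[OF u order_refl]] unfolding g_def .
  ultimately have "u * euler_prod ?d l - (u * euler_prod ?d l - scal g * u) \<in> null"
    using linop_subgroupD(2)[OF null_subgroup] by blast
  then show ?thesis using g by (simp add: u_def scal_mult flip: mult.assoc)
qed

lemma f_th: "f \<in> wspace l th"
  by (rule weyl_deg_wspace[OF f_deg deg_wt_shift_deg[OF th]])

lemma tf_th: "R \<in> tpoly l \<Longrightarrow> R * f \<in> wspace l th"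
  by (rule th_mult_left[OF f_th tpoly_wspace])

lemma fr_spanned:
  assumes "Q \<in> wspace l th"
  shows "\<exists>R\<in>tpoly l. fr Q (t_path l k) - fr (R * f) (t_path l k) \<in> H"
proof -
  have "\<exists>R\<in>tpoly l. Q - R * f \<in> null"
  proof (rule wspace_spanned[OF null_subgroup _ _ f_deg f_hw \<gamma>])
    show "shift_deg l th k i = 0" if "i \<ge> l" for i using that by (simp add: shift_deg_def)
  qed (use eig_null below_null deg_wt_shift_deg[OF th] assms in auto)
  then obtain R where R: "R \<in> tpoly l" "fr (Q - R * f) (t_path l k) \<in> H" by (auto simp: null_def)
  from H_diff[OF R(2) fr_diff[OF assms tf_th[OF R(1)] path_W]]
  show ?thesis using R(1) by auto
qed

text \<open>Elements of the standard module are invariants applied to the highest weight vector; these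
  invariants are moved to the left tensor factor, which is then reduced to normal form.\<close>

lemma F_spanned:
  assumes "x \<in> carrier F" shows "\<exists>R\<in>tpoly l. x - fr (R * f) (t_path l k) \<in> H"
  using assms
proof (induction rule: F_induct)
  case zero
  have "0 - fr (0 * f) (t_path l k) \<in> H" using H_minus[OF fr_0_left[OF path_W]] by simp
  then show ?case by (intro bexI[of _ 0]) auto
next
  case (diff x y)
  then obtain R R' where R: "R \<in> tpoly l" "x - fr (R * f) (t_path l k) \<in> H"
    "R' \<in> tpoly l" "y - fr (R' * f) (t_path l k) \<in> H" by blast
  have "fr (R * f - R' * f) (t_path l k) - (fr (R * f) (t_path l k) - fr (R' * f) (t_path l k)) \<in> H"
    by (intro fr_diff tf_th R path_W)
  from H_diff[OF H_diff[OF R(2,4)] this]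
  have "x - y - fr ((R - R') * f) (t_path l k) \<in> H" by (simp add: left_diff_distrib algebra_simps)
  then show ?case using tpoly_diff[OF R(1,3)] by blast
next
  case (frag b n)
  obtain Q where Q: "Q \<in> wspace l th" "b = cl Q" using frag(1) by (auto simp: B_carrier)
  obtain P where P: "P \<in> W" "n = v P" using frag(2) by (auto simp: e0_Delta_carrier[OF k])
  obtain R where R: "R \<in> tpoly l" "n = v (R * t_path l k)" using vec_spanned[OF R_one k P(1)] P(2) by auto
  have QR: "Q * R \<in> wspace l th" by (rule th_mult_right[OF Q(1) tpoly_wspace[OF R(1)]])
  obtain S where S: "S \<in> tpoly l" "fr (Q * R) (t_path l k) - fr (S * f) (t_path l k) \<in> H"
    using fr_spanned[OF QR] by blast
  from H_diff[OF S(2) fr_balanced[OF Q(1) tpoly_wspace[OF R(1)] path_W]]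
  have "frag_of (b, n) - fr (S * f) (t_path l k) \<in> H" by (simp add: Q(2) R(2))
  then show ?case using S(1) by blast
qed

abbreviation g :: rmon where "g \<equiv> tmon (gen_exp l lam k)"
abbreviation g' :: rmon where "g' \<equiv> tmon (gen_exp l lam' k)"
abbreviation val :: "linop \<Rightarrow> rmon" where "val R \<equiv> rho l R (smul \<gamma> (tmon (hw_exp l lam' k)))"

text \<open>Operators \<open>P\<close> in row \<open>0\<close> and column \<open>k\<close> change the eigenvalues of the \<open>\<iota>\<^sub>i\<close> on \<open>1\<^sub>k\<close> into those
  prescribed by the bimodule.\<close>

lemma B_ideal_kills:
  assumes "Q \<in> B_ideal l lam" "P \<in> W" shows "rho l Q (rho l P g) = 0"
proof -
  obtain r where r: "\<forall>i<l. r i \<in> weyl l" "Q = (\<Sum>i<l. r i * (iota l i - scal (of_real (bar lam i))))"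
    using assms(1) unfolding B_ideal_eq iota_ideal_def by blast
  have QW: "Q \<in> weyl l" unfolding r(2) using r(1) by (auto intro!: sum_weyl weyl.mult diff_weyl weyl.scal)
  have PW: "P \<in> weyl l" by (rule wspace_weyl[OF assms(2)])
  have "Q * P \<in> iota_ideal l (\<lambda>i. lam i - (if i = k then 1 else 0)) (weyl l)"
    using assms(1) unfolding B_ideal_eq
    by (rule iota_ideal_mult_right[OF _ assms(2)])
      (auto simp: bar_def ent_wt_def unit_deg_def intro: weyl.mult PW)
  then have "rho l (Q * P) g = 0"
    by (rule rho_iota_ideal) (auto simp: gen_exp_step[OF R_one _ k])
  then show ?thesis by (simp add: rho_mult QW PW)
qed

lemma v_determines: "P \<in> W \<Longrightarrow> P' \<in> W \<Longrightarrow> v P = v P' \<Longrightarrow> rho l P g = rho l P' g"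
  by (rule vec_eq_imp_rho_eq[OF R_one k])

lemma cl_determines:
  assumes "Q \<in> wspace l th" "Q' \<in> wspace l th" "cl Q = cl Q'" "P \<in> W"
  shows "rho l Q (rho l P g) = rho l Q' (rho l P g)"
proof -
  have "Q - Q' \<in> B_ideal l lam" using assms(3) by (simp add: B_class_eq_iff)
  from B_ideal_kills[OF this assms(4)] show ?thesis
    by (simp add: rho_diff wspace_weyl[OF assms(1)] wspace_weyl[OF assms(2)])
qed

text \<open>The pairing \<open>[Q] \<otimes> P 1\<^sub>k \<mapsto> Q P t\<^sup>x\<close>.\<close>

definition pairing :: "linop set \<Rightarrow> linop mat set set \<Rightarrow> rmon" where
  "pairing b n = rho l (SOME Q. Q \<in> wspace l th \<and> cl Q = b) (rho l (SOME P. P \<in> W \<and> v P = n) g)"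

lemma pairing_eq:
  assumes "Q \<in> wspace l th" "P \<in> W" shows "pairing (cl Q) (v P) = rho l Q (rho l P g)"
proof -
  let ?Q = "SOME Q'. Q' \<in> wspace l th \<and> cl Q' = cl Q" and ?P = "SOME P'. P' \<in> W \<and> v P' = v P"
  have Q: "?Q \<in> wspace l th \<and> cl ?Q = cl Q" by (rule someI[of _ Q]) (simp add: assms)
  have P: "?P \<in> W \<and> v ?P = v P" by (rule someI[of _ P]) (simp add: assms)
  have "rho l ?P g = rho l P g" using P assms(2) by (intro v_determines) auto
  moreover have "rho l ?Q (rho l P g) = rho l Q (rho l P g)" using Q assms by (intro cl_determines) auto
  ultimately show ?thesis by (simp add: pairing_def)
qed

lemma pairing_hom:
  obtains h where "\<And>x y. x \<in> carrier F \<Longrightarrow> y \<in> carrier F \<Longrightarrow> h (x + y) = h x + h y"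
    "\<And>x y. x \<in> carrier F \<Longrightarrow> y \<in> carrier F \<Longrightarrow> h (x - y) = h x - h y" "h 0 = 0"
    "\<And>Q P. Q \<in> wspace l th \<Longrightarrow> P \<in> W \<Longrightarrow> h (fr Q P) = rho l Q (rho l P g)"
    "\<And>x. x \<in> H \<Longrightarrow> h x = 0"
proof -
  have w: "P \<in> weyl l" if "P \<in> wspace l a" for P a using that by (rule wspace_weyl)
  have "\<exists>h. (\<forall>x\<in>carrier F. \<forall>y\<in>carrier F. h (x + y) = h x + h y \<and> h (x - y) = h x - h y) \<and> h 0 = 0 \<and>
    (\<forall>b\<in>carrier (B_mod l lam th). \<forall>n\<in>carrier (e0_Delta l lam k). h (frag_of (b, n)) = pairing b n) \<and> (\<forall>x\<in>H. h x = 0)"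
  proof (rule tensor_universal)
    fix b b' n assume "b \<in> carrier (B_mod l lam th)" "b' \<in> carrier (B_mod l lam th)" "n \<in> carrier (e0_Delta l lam k)"
    then show "pairing (b \<oplus>\<^bsub>B_mod l lam th\<^esub> b') n = pairing b n + pairing b' n"
      unfolding B_carrier e0_Delta_carrier[OF k]
      by (auto simp: B_add pairing_eq wspace_add rho_add w)
  next
    fix b n n' assume "b \<in> carrier (B_mod l lam th)" "n \<in> carrier (e0_Delta l lam k)" "n' \<in> carrier (e0_Delta l lam k)"
    then show "pairing b (n \<oplus>\<^bsub>e0_Delta l lam k\<^esub> n') = pairing b n + pairing b n'"
      unfolding B_carrier e0_Delta_carrier[OF k]
      by (auto simp: vec_add pairing_eq wspace_add rho_add rho_linear(1) w)
  next
    fix b a n assume "b \<in> carrier (B_mod l lam th)" "a \<in> carrier (A_alg l lam)" "n \<in> carrier (e0_Delta l lam k)"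
    then show "pairing (B_ract l lam b a) n = pairing b (a \<odot>\<^bsub>e0_Delta l lam k\<^esub> n)"
      unfolding B_carrier e0_Delta_carrier[OF k] A_carrier[OF l]
      by (auto simp: ract_cl smult_v pairing_eq th_mult_right W_mult rho_mult w)
  qed
  then obtain h where h: "\<forall>x\<in>carrier F. \<forall>y\<in>carrier F. h (x + y) = h x + h y \<and> h (x - y) = h x - h y" "h 0 = 0"
    "\<forall>b\<in>carrier (B_mod l lam th). \<forall>n\<in>carrier (e0_Delta l lam k). h (frag_of (b, n)) = pairing b n" "\<forall>x\<in>H. h x = 0"
    by blast
  show thesis
    by (rule that[of h]) (use h in \<open>simp_all add: cl_B v_N pairing_eq\<close>)
qed

lemma val_inj: "inj_on val (tpoly l)"
proof (rule inj_onI)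
  fix R R' assume R: "R \<in> tpoly l" "R' \<in> tpoly l" "val R = val R'"
  then have "val (R - R') = 0"
    by (simp add: rho_diff wspace_weyl[OF tpoly_wspace])
  then have "R - R' = 0" by (rule tpoly_faithful[OF l tpoly_diff[OF R(1,2)] _ \<gamma>])
  then show "R = R'" by simp
qed

lemma val_eq: "R \<in> tpoly l \<Longrightarrow> rho l (R * f) (rho l (t_path l k) g) = val R"
  using wspace_weyl[OF tpoly_wspace] wspace_weyl[OF f_th]
  by (simp add: rho_mult rho_t_path_gen[OF k] f_hw)

lemma val_eq':
  assumes "R \<in> tpoly l" shows "smul \<gamma> (rho l (R * t_path l k) g') = val R"
  using wspace_weyl[OF tpoly_wspace[OF assms]] wspace_weyl[OF path_W]
  by (simp add: rho_mult rho_t_path_gen[OF k] rho_linear)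

lemma shift_iso:
  "\<exists>h\<in>left_module_iso (A_alg l lam') (e0_Delta l lam' k) (S_fun l lam th (e0_Delta l lam k)).
    h (vec l lam' k (t_path l k)) = S_tensor l lam th (e0_Delta l lam k) (cl f) w"
proof -
  let ?M = "e0_Delta l lam' k" and ?N = "S_fun l lam th (e0_Delta l lam k)" and ?v' = "vec l lam' k"
  let ?H = "\<lambda>x. H #>\<^bsub>F\<^esub> x"
  have w: "P \<in> weyl l" if "P \<in> wspace l a" for P a using that by (rule wspace_weyl)
  obtain h where h: "\<And>x y. x \<in> carrier F \<Longrightarrow> y \<in> carrier F \<Longrightarrow> h (x + y) = h x + h y"
    "\<And>x y. x \<in> carrier F \<Longrightarrow> y \<in> carrier F \<Longrightarrow> h (x - y) = h x - h y" "h 0 = 0"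
    "\<And>Q P. Q \<in> wspace l th \<Longrightarrow> P \<in> W \<Longrightarrow> h (fr Q P) = rho l Q (rho l P g)"
    "\<And>x. x \<in> H \<Longrightarrow> h x = 0"
    using pairing_hom by blast
  define \<psi> where "\<psi> X = h (SOME x. x \<in> carrier F \<and> x \<in> X)" for X
  have \<psi>: "\<psi> (?H x) = h x" if x: "x \<in> carrier F" for x
  proof -
    let ?y = "SOME y. y \<in> carrier F \<and> y \<in> ?H x"
    have y: "?y \<in> carrier F \<and> ?y \<in> ?H x" by (rule someI[of _ x]) (simp add: x coset_self)
    then have "h (?y - x) = 0" using h(5) coset_mem by blast
    then show ?thesis using h(2) y x by (simp add: \<psi>_def)
  qed
  \<comment> \<open>The factor \<open>\<gamma>\<close> makes the two highest weight vectors correspond.\<close>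
  define \<phi> where "\<phi> X = smul \<gamma> (rho l (SOME P. P \<in> W \<and> ?v' P = X) g')" for X
  have \<phi>: "\<phi> (?v' P) = smul \<gamma> (rho l P g')" if P: "P \<in> W" for P
  proof -
    let ?P = "SOME P'. P' \<in> W \<and> ?v' P' = ?v' P"
    have "?P \<in> W \<and> ?v' ?P = ?v' P" by (rule someI[of _ P]) (simp add: P)
    then have "rho l ?P g' = rho l P g'" using P by (intro vec_eq_imp_rho_eq[OF R_one' k]) auto
    then show ?thesis by (simp add: \<phi>_def)
  qed
  have M: "carrier ?M = ?v' ` W" by (rule e0_Delta_carrier[OF k])
  have N: "carrier ?N = ?H ` carrier F" unfolding S_fun_def tensor_carrier by blast
  have tW: "R * t_path l k \<in> W" if "R \<in> tpoly l" for R by (rule W_mult[OF tpoly_wspace[OF that] path_W])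
  have M': "carrier ?M = (\<lambda>R. ?v' (R * t_path l k)) ` tpoly l"
    unfolding M using vec_spanned[OF R_one' k] tW by (auto simp: image_iff)
  have N': "carrier ?N = (\<lambda>R. ?H (fr (R * f) (t_path l k))) ` tpoly l"
  proof (intro equalityI subsetI)
    fix X assume "X \<in> carrier ?N"
    then obtain x where x: "x \<in> carrier F" "X = ?H x" unfolding N by blast
    then obtain R where "R \<in> tpoly l" "x - fr (R * f) (t_path l k) \<in> H" using F_spanned by blast
    then show "X \<in> (\<lambda>R. ?H (fr (R * f) (t_path l k))) ` tpoly l" using x(2) coset_eq_iff by blast
  next
    fix X assume "X \<in> (\<lambda>R. ?H (fr (R * f) (t_path l k))) ` tpoly l"
    then show "X \<in> carrier ?N" unfolding N using fr_F[OF tf_th path_W] by blast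
  qed
  have \<phi>R: "\<phi> (?v' (R * t_path l k)) = val R" if "R \<in> tpoly l" for R
    using \<phi>[OF tW[OF that]] val_eq'[OF that] by simp
  have \<psi>R: "\<psi> (?H (fr (R * f) (t_path l k))) = val R" if "R \<in> tpoly l" for R
    using \<psi>[OF fr_F[OF tf_th[OF that] path_W]] h(4)[OF tf_th[OF that] path_W] val_eq[OF that] by simp
  show ?thesis
  proof (rule left_module_iso_via[where \<phi> = \<phi> and \<psi> = \<psi>])
    show "inj_on \<phi> (carrier ?M)"
      unfolding M' by (rule inj_onI) (use \<phi>R val_inj in \<open>auto dest: inj_onD\<close>)
    show "inj_on \<psi> (carrier ?N)"
      unfolding N' by (rule inj_onI) (use \<psi>R val_inj in \<open>auto dest: inj_onD\<close>)
    show "\<phi> ` carrier ?M = \<psi> ` carrier ?N"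
      unfolding M' N' image_image by (rule image_cong[OF refl]) (simp add: \<phi>R \<psi>R)
  next
    fix x y assume "x \<in> carrier ?M" "y \<in> carrier ?M"
    then obtain P Q where "P \<in> W" "x = ?v' P" "Q \<in> W" "y = ?v' Q" unfolding M by blast
    then show "\<phi> (x \<oplus>\<^bsub>?M\<^esub> y) = \<phi> x + \<phi> y"
      by (simp add: vec_add \<phi> wspace_add rho_add w) (auto simp: smul_def distrib_left)
  next
    fix x y assume "x \<in> carrier ?N" "y \<in> carrier ?N"
    then obtain p q where p: "p \<in> carrier F" "x = ?H p" "q \<in> carrier F" "y = ?H q" unfolding N by blast
    have pq: "p + q \<in> carrier F" using F_diff[OF p(1) F_diff[OF _ p(3)], of 0] by (simp add: F_simps)
    have "x \<oplus>\<^bsub>?N\<^esub> y = ?H (p + q)" unfolding p(2,4) S_fun_def by (rule tensor_add[OF p(1,3)])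
    then show "x \<oplus>\<^bsub>?N\<^esub> y \<in> carrier ?N \<and> \<psi> (x \<oplus>\<^bsub>?N\<^esub> y) = \<psi> x + \<psi> y"
      unfolding N using pq p by (simp add: \<psi> h(1))
  next
    fix a assume "a \<in> carrier (A_alg l lam')"
    then obtain R where R: "R \<in> wspace l 0" "a = a_el l lam' R" unfolding A_carrier[OF l] by blast
    show "\<exists>G. (\<forall>x\<in>carrier ?M. \<phi> (a \<odot>\<^bsub>?M\<^esub> x) = G (\<phi> x)) \<and>
      (\<forall>y\<in>carrier ?N. a \<odot>\<^bsub>?N\<^esub> y \<in> carrier ?N \<and> \<psi> (a \<odot>\<^bsub>?N\<^esub> y) = G (\<psi> y))"
    proof (intro exI[of _ "rho l R"] conjI ballI)
      fix x assume "x \<in> carrier ?M"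
      then obtain P where P: "P \<in> W" "x = ?v' P" unfolding M by blast
      have "a \<odot>\<^bsub>?M\<^esub> x = ?v' (R * P)" unfolding R(2) P(2) using l by (intro vec_smult R P k) simp
      then show "\<phi> (a \<odot>\<^bsub>?M\<^esub> x) = rho l R (\<phi> x)"
        using P R by (simp add: \<phi> W_mult rho_mult w rho_linear(2)[OF w[OF R(1)]])
    next
      fix y assume "y \<in> carrier ?N"
      then obtain p where p: "p \<in> carrier F" "y = ?H p" unfolding N by blast
      have sm: "a \<odot>\<^bsub>?N\<^esub> y = ?H (ext a p)"
        unfolding p(2) S_fun_def
        by (rule tensor_smult)
          (auto simp: B_carrier A_carrier[OF l] R(2) smult_cl[OF R(1)] th_mult_left[OF _ R(1)] B_add wspace_add
            distrib_left ract_cl th_mult_right mult.assoc)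
      have "ext a p \<in> carrier F \<and> h (ext a p) = rho l R (h p)"
        using p(1)
      proof (induction rule: F_induct)
        case zero
        have "(0 :: (linop set \<times> linop mat set set) \<Rightarrow>\<^sub>0 int) \<in> carrier F" by (simp add: F_simps)
        then show ?case by (simp only: ext_simps(3) h(3) rho_linear(4)[OF w[OF R(1)]] simp_thms)
      next
        case (diff x y)
        then show ?case by (simp only: ext_simps(2) h(2) F_diff rho_linear(3)[OF w[OF R(1)]] simp_thms)
      next
        case (frag b n)
        then obtain Q P where QP: "Q \<in> wspace l th" "b = cl Q" "P \<in> W" "n = v P"
          unfolding B_carrier e0_Delta_carrier[OF k] by blast
        have "ext a (frag_of (b, n)) = fr (R * Q) P" by (simp add: ext_simps R(2) QP smult_cl[OF R(1)])
        then show ?case using QP R(1) by (simp add: h(4) fr_F th_mult_left rho_mult w)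
      qed
      then show "a \<odot>\<^bsub>?N\<^esub> y \<in> carrier ?N" "\<psi> (a \<odot>\<^bsub>?N\<^esub> y) = rho l R (\<psi> y)"
        unfolding sm N using p by (auto simp: \<psi>)
    qed
  next
    have S: "S_tensor l lam th (e0_Delta l lam k) (cl f) w = ?H (fr (1 * f) (t_path l k))"
      by (simp add: S_tensor_def pure_eq)
    have V: "?v' (t_path l k) = ?v' (1 * t_path l k)" by simp
    show "?v' (t_path l k) \<in> carrier ?M" unfolding V M' using tpoly_one by blast
    show "S_tensor l lam th (e0_Delta l lam k) (cl f) w \<in> carrier ?N"
      unfolding S N' using tpoly_one by blast
    show "\<phi> (?v' (t_path l k)) = \<psi> (S_tensor l lam th (e0_Delta l lam k) (cl f) w)"
      unfolding S V by (simp only: \<phi>R[OF tpoly_one] \<psi>R[OF tpoly_one])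
  qed
qed

end

theorem proposition1p2:
  fixes l i :: nat and lam :: "nat \<Rightarrow> real" and th :: "nat \<Rightarrow> int" and \<eta> :: "nat \<Rightarrow> nat"
  assumes "l \<ge> 1"
    and "lam \<in> R_reg l"
    and "th \<in> Z_lam l lam"
    and "theta_enum l th \<eta>"
    and "i \<in> {1..l}"
  shows "\<exists>h \<in> left_module_iso (A_alg l (shift_par lam th))
            (e0_Delta l (shift_par lam th) (\<eta> i))
            (S_fun l lam th (e0_Delta l lam (\<eta> i))).
          h (e0_vec l (shift_par lam th) (\<eta> i)) =
            S_tensor l lam th (e0_Delta l lam (\<eta> i))
              (B_class l lam (f_tilde l th \<eta> i)) (e0_vec l lam (\<eta> i))"
proof -
  have th: "th \<in> Z_zero l" using assms(3) by (simp add: Z_lam_def Z_reg_def)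
  have k: "\<eta> i < l" using assms(4,5) by (auto simp: theta_enum_def bij_betw_def)
  obtain \<gamma> where \<gamma>: "\<gamma> \<noteq> 0" "rho l (f_tilde l th \<eta> i) (tmon (hw_exp l lam (\<eta> i))) =
    smul \<gamma> (tmon (hw_exp l (shift_par lam th) (\<eta> i)))"
    using rho_f_tilde[OF assms(2-5)] by blast
  interpret shift_setting l lam th "\<eta> i" "f_tilde l th \<eta> i" \<gamma>
    by unfold_locales (use assms th k \<gamma> f_tilde_deg[OF th assms(4,5)] in auto)
  show ?thesis using shift_iso by (simp add: e0_vec_def vec_def)
qed

end
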